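(* Let $X = R(S) \subset \mathbb{T}^3$ be a sofic set with adjacency matrices $A_{(s,t)} \in \mathrm{M}_n(\mathbb{Z}_{\ge 0})$, $(s,t) \in I_1 \times I_2$, let $A = \sum_{w\in I_1\times I_2} A_w$, and let $a_1 = \log_{m_2} m_1$. Suppose that the following conditions hold. (1) $X$ has a recursive structure with $\boldsymbol{v} \in \mathbb{R}^n\setminus\{0\}$, and $A$ is primitive. (2) There is at least one non-removable index in $I_1$. (3) There are a removable index $u \in I_1$ and a string $(t_1, \ldots, t_L) \in I_1^L$ such that $M_u M_{t_L} \cdots M_{t_1}$ is increasing with respect to the $\ell^1$-norm, that is, $\| M_u M_{t_L} \cdots M_{t_1} \boldsymbol{x} \|_1 \ge \|\boldsymbol{x}\|_1$ for any $\boldsymbol{x} \in \mathbb{R}^{\bigoplus\Gamma}$. For a string $s = (s_1, \ldots, s_k) \in I_1^k$, define $c(s) \ge 0$ by $$M_u M_{s_k} \cdots M_{s_1} \Phi_0 = c(s)\, \Phi_0,$$ and define, for each integer $k \ge 0$, $$b_k = \sum_{s \in (I_1 \setminus \{u\})^k} c(s)^{a_1}.$$ Then $$\dim_{\mathrm{H}}(X) = \log_{m_1} r,$$ where $r$ is the unique positive solution to the equation $$r = b_0 + \frac{b_1}{r} + \frac{b_2}{r^2} + \cdots.$$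
   Context: Setting. Let $1 < m_1 \le m_2 \le m_3$ be integers, $I_i = \{0,\ldots,m_i-1\}$ for $i=1,2,3$, $I = I_1 \times I_2\times I_3$, and $\mathbb{T} = \mathbb{R}/\mathbb{Z}$. Let $G = \langle V, E\rangle$ be a finite directed graph, possibly with loops and multiple edges, with vertex set $V = \{v_1,\ldots,v_n\}$, whose edges are labeled by elements of $I$ in a right-resolving fashion: any two distinct edges emanating from the same vertex have different labels. The sofic system $S \subset I^{\mathbb{N}}$ is the set of all label sequences arising from infinite paths in $G$. Define $R : I^{\mathbb{N}} \to \mathbb{T}^3$ by $$R\big( (e_1^{(k)}, e_2^{(k)}, e_3^{(k)})_{k=1}^\infty \big) = \Big( \sum_{k=1}^\infty \frac{e_1^{(k)}}{m_1^k},\ \sum_{k=1}^\infty \frac{e_2^{(k)}}{m_2^k},\ \sum_{k=1}^\infty \frac{e_3^{(k)}}{m_3^k} \Big).$$ The sofic set is $X = R(S)$, and $\dim_{\mathrm H}$ denotes Hausdorff dimension. Put $a_1 = \log_{m_2} m_1$ and $a_2 = \log_{m_3} m_2$. Adjacency matrices. For $(s,t) \in I_1 \times I_2$, $A_{(s,t)} \in \mathrm{M}_n(\mathbb{Z}_{\ge 0})$ is the matrix whose $(p,q)$ entry is the number of edges $e \in E$ from $v_p$ to $v_q$ whose label is $(s,t,k)$ for some $k \in I_3$. Terminology. A square matrix $A$ is primitive if there is an integer $d$ such that every entry of $A^d$ is positive. For $B \in \mathrm{M}_n(\mathbb{R})$, $\mathrm{Im}_R(B) = \{ x^\top B : x \in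 \mathbb{R}^n\}$. Recursive structure. $X$ has a recursive structure with $\boldsymbol{v} \in \mathbb{R}^n\setminus\{0\}$ if for any $s \in I_1$ there is $t \in I_2$ with $\mathrm{Im}_R(A_{(s,t)}) = \mathrm{Span}\{\boldsymbol{v}^\top\}$. In this case, for $u \in I_1$ let $$P(u) = \{ t \in I_2 : \text{either } A_{(u,t)} = O \text{ or } \mathrm{Im}_R(A_{(u,t)}) = \mathrm{Span}\{\boldsymbol{v}^\top\} \}, \qquad Q(u) = \{u\} \times P(u).$$ An index $u \in I_1$ is removable if $P(u) = I_2$. Let $J \subset I_1$ be the set of indices that are not removable. Coefficients. For $u \in I_1$, $p \in Q(u)$ and $w = (w_1,\ldots,w_N) \in (I_1\times I_2)^N$, define $D_w(p) \ge 0$ by $\boldsymbol{v}^\top A_{w_1}\cdots A_{w_N} A_p = D_w(p)\, \boldsymbol{v}^\top$, and $D_\varnothing(p)$ by $\boldsymbol{v}^\top A_p = D_\varnothing(p)\, \boldsymbol{v}^\top$. For $u \in I_1$ define $$C_\varnothing(u) = \sum_{p \in Q(u)} D_\varnothing(p)^{a_2}, \qquad C_s(u) = \sum_{p \in Q(u)} \ \sum_{w \in R^N(s)} D_w(p)^{a_2} \quad (s \in J^N,\ N \ge 1),$$ where $R^N(s) = \{ (s_i,t_i)_{i=1}^N \in (I_1\times I_2)^N : t_i \notin P(s_i) \text{ for each } 1 \le i \le N\}$ for $s = (s_1,\ldots,s_N)$. Tree and operators. Let $\Gamma = \{\varnothing\} \cup \bigcup_{k=1}^\infty J^k$ be the set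 of all finite words in letters from $J$, including the empty word $\varnothing$. Let $\mathbb{R}^{\bigoplus\Gamma}$ be the direct sum of copies of $\mathbb{R}$ indexed by $\Gamma$ (finitely supported families), with $\ell^1$-norm $\|\cdot\|_1$. For $u \in J$, the linear operator $M_u : \mathbb{R}^{\bigoplus\Gamma} \to \mathbb{R}^{\bigoplus\Gamma}$ is defined, for $x = (x_\mu)_{\mu\in\Gamma}$, by $$(M_u x)_\lambda = \begin{cases} \sum_{s\in\Gamma} C_s(u)\, x_s & \text{if } \lambda = \varnothing,\\ x_{\lambda'} & \text{if } \lambda = \lambda' u \text{ (concatenation of } \lambda'\in\Gamma \text{ and } u),\\ 0 & \text{otherwise.}\end{cases}$$ For $u \in I_1\setminus J$ (removable), $M_u$ is defined by $(M_u x)_\varnothing = \sum_{s\in\Gamma} C_s(u)\, x_s$ and $(M_u x)_\lambda = 0$ for all $\lambda \ne \varnothing$. The vector $\Phi_0 \in \mathbb{R}^{\bigoplus\Gamma}$ has $(\Phi_0)_\varnothing = 1$ and all other entries $0$. For $k=0$ the only string is the empty one, and $c(\varnothing)$ is given by $M_u\Phi_0 = c(\varnothing)\Phi_0$, so $b_0 = c(\varnothing)^{a_1}$.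
   Formalization: Condition (3) is required only for x with nonnegative entries: for x of arbitrary sign it contradicts (2), because M_u with u removable has image in the line spanned by Φ_0 while the space is infinite-dimensional, so some nonzero x is sent to 0. *)

theory Defs
  imports "HOL-Analysis.Analysis" "Graph_Theory.Digraph"
begin

section \<open>The circle and Hausdorff dimension\<close>

quotient_type circle = real / "\<lambda>x y. x - y \<in> \<int>"
proof (rule equivpI)
  show "reflp (\<lambda>x y :: real. x - y \<in> \<int>)"
    by (simp add: reflp_def)
  show "symp (\<lambda>x y :: real. x - y \<in> \<int>)"
    by (metis Ints_minus minus_diff_eq sympI)
  show "transp (\<lambda>x y :: real. x - y \<in> \<int>)"
  proof (rule transpI)
    fix x y z :: real
    assume "x - y \<in> \<int>" "y - z \<in> \<int>"
    then have "(x - y) + (y - z) \<in> \<int>" by (rule Ints_add)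
    then show "x - z \<in> \<int>" by simp
  qed
qed

lemma infdist_Ints_le: "infdist (x::real) \<int> \<le> \<bar>x - of_int k\<bar>"
  using infdist_le[of "of_int k" \<int> x] by (simp add: dist_real_def)

lemma infdist_Ints_attained: "\<exists>k. infdist (x::real) \<int> = \<bar>x - of_int k\<bar>"
proof -
  obtain y :: real where "y \<in> \<int>" "infdist x \<int> = dist x y"
    using infdist_attains_inf[of "\<int> :: real set" x] Ints_0 by (metis closed_Ints empty_iff)
  then show ?thesis by (auto simp: dist_real_def elim!: Ints_cases)
qed

lemma infdist_Ints_add: "infdist (x + y :: real) \<int> \<le> infdist x \<int> + infdist y \<int>"
proof -
  obtain j k where "infdist x \<int> = \<bar>x - of_int j\<bar>" "infdist y \<int> = \<bar>y - of_int k\<bar>"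
    using infdist_Ints_attained by metis
  with infdist_Ints_le[of "x + y" "j + k"] show ?thesis by simp
qed

lemma infdist_Ints_minus: "infdist (- x :: real) \<int> = infdist x \<int>"
proof -
  have "infdist (- y) \<int> \<le> infdist y \<int>" for y :: real
  proof -
    obtain k where "infdist y \<int> = \<bar>y - of_int k\<bar>"
      using infdist_Ints_attained by metis
    with infdist_Ints_le[of "- y" "- k"] show ?thesis by simp
  qed
  from this[of x] this[of "- x"] show ?thesis by simp
qed

lemma infdist_Ints_cong:
  assumes "x - y \<in> \<int>"
  shows "infdist (x::real) \<int> = infdist y \<int>"
proof -
  have "infdist (x - y) \<int> = 0" "infdist (y - x) \<int> = 0"
    using assms infdist_Ints_minus[of "x - y"] by simp_all
  with infdist_Ints_add[of "x - y" y] infdist_Ints_add[of "y - x" x] show ?thesis by simp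
qed

instantiation circle :: metric_space
begin

lift_definition dist_circle :: "circle \<Rightarrow> circle \<Rightarrow> real" is "\<lambda>x y. infdist (x - y) \<int>"
proof -
  fix a b c d :: real
  assume "a - b \<in> \<int>" "c - d \<in> \<int>"
  then have "(a - b) - (c - d) \<in> \<int>" by (rule Ints_diff)
  then show "infdist (a - c) \<int> = infdist (b - d) \<int>"
    by (intro infdist_Ints_cong) (simp add: algebra_simps)
qed

definition uniformity_circle :: "(circle \<times> circle) filter" where
  "uniformity_circle = (INF e\<in>{0<..}. principal {(x, y). dist x y < e})"

definition open_circle :: "circle set \<Rightarrow> bool" where
  "open_circle U = (\<forall>x\<in>U. eventually (\<lambda>(x', y). x' = x \<longrightarrow> y \<in> U) uniformity)"

instance
proof
  show "dist x y = 0 \<longleftrightarrow> x = y" for x y :: circle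
  proof (transfer, goal_cases)
    case (1 x y)
    show ?case
      using in_closed_iff_infdist_zero[of "\<int> :: real set" "x - y"] by auto
  qed
  show "dist x y \<le> dist x z + dist y z" for x y z :: circle
  proof (transfer, goal_cases)
    case (1 x y z)
    show ?case
      using infdist_Ints_add[of "x - z" "z - y"] infdist_Ints_minus[of "y - z"] by simp
  qed
qed (auto simp: uniformity_circle_def open_circle_def)

end

text \<open>
  The product type \<open>circle \<times> circle \<times> circle\<close> carries the library's Euclidean product metric.
  The functions below are meant for exponents \<open>s > 0\<close>, which avoids the convention for
  \<open>0\<close> to the power \<open>0\<close>; this does not affect the infimum defining the dimension.
\<close>

definition hausdorff_premeasure :: "real \<Rightarrow> real \<Rightarrow> 'a::metric_space set \<Rightarrow> ennreal" where
  "hausdorff_premeasure s \<delta> X =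
     Inf {\<Sum>i. ennreal (diameter (U i) powr s) | U :: nat \<Rightarrow> 'a set.
            X \<subseteq> (\<Union>i. U i) \<and> (\<forall>i. bounded (U i) \<and> diameter (U i) \<le> \<delta>)}"

definition hausdorff_measure :: "real \<Rightarrow> 'a::metric_space set \<Rightarrow> ennreal" where
  "hausdorff_measure s X = (SUP \<delta>\<in>{0<..}. hausdorff_premeasure s \<delta> X)"

definition hausdorff_dim :: "'a::metric_space set \<Rightarrow> ereal" where
  "hausdorff_dim X = Inf {ereal s | s. 0 < s \<and> hausdorff_measure s X = 0}"


section \<open>Sofic sets\<close>

text \<open>
  The vertex set is the whole finite type \<open>'n\<close>, so that the adjacency matrices have the library
  type \<open>real^'n^'n\<close>. A \<open>fin_digraph\<close> may have loops and multiple edges.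
\<close>

locale labeled_graph = fin_digraph G
  for G :: "('n::finite, 'e) pre_digraph" +
  fixes m1 m2 m3 :: nat and lab :: "'e \<Rightarrow> nat \<times> nat \<times> nat"
  assumes verts_UNIV: "verts G = UNIV"
    and m_bounds: "1 < m1" "m1 \<le> m2" "m2 \<le> m3"
    and labels: "lab ` arcs G \<subseteq> {..<m1} \<times> {..<m2} \<times> {..<m3}"
    and right_resolving:
      "\<lbrakk>e \<in> arcs G; e' \<in> arcs G; e \<noteq> e'; tail G e = tail G e'\<rbrakk> \<Longrightarrow> lab e \<noteq> lab e'"

definition sofic_system ::
    "('v, 'e) pre_digraph \<Rightarrow> ('e \<Rightarrow> nat \<times> nat \<times> nat) \<Rightarrow> (nat \<Rightarrow> nat \<times> nat \<times> nat) set" where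
  "sofic_system G lab =
     {lab \<circ> \<pi> | \<pi>. \<forall>k. \<pi> k \<in> arcs G \<and> head G (\<pi> k) = tail G (\<pi> (Suc k))}"

text \<open>Sequences are indexed from \<open>0\<close>, hence the exponent \<open>Suc k\<close>.\<close>

definition expansion :: "nat \<Rightarrow> (nat \<Rightarrow> nat) \<Rightarrow> circle" where
  "expansion m e = abs_circle (\<Sum>k. real (e k) / real m ^ Suc k)"

definition R_map ::
    "nat \<Rightarrow> nat \<Rightarrow> nat \<Rightarrow> (nat \<Rightarrow> nat \<times> nat \<times> nat) \<Rightarrow> circle \<times> circle \<times> circle" where
  "R_map m1 m2 m3 e =
     (expansion m1 (\<lambda>k. fst (e k)),
      expansion m2 (\<lambda>k. fst (snd (e k))),
      expansion m3 (\<lambda>k. snd (snd (e k))))"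

definition sofic_set ::
    "nat \<Rightarrow> nat \<Rightarrow> nat \<Rightarrow> ('v, 'e) pre_digraph \<Rightarrow> ('e \<Rightarrow> nat \<times> nat \<times> nat)
       \<Rightarrow> (circle \<times> circle \<times> circle) set" where
  "sofic_set m1 m2 m3 G lab = R_map m1 m2 m3 ` sofic_system G lab"

definition adjacency ::
    "nat \<Rightarrow> ('n::finite, 'e) pre_digraph \<Rightarrow> ('e \<Rightarrow> nat \<times> nat \<times> nat) \<Rightarrow> nat \<times> nat \<Rightarrow> real^'n^'n" where
  "adjacency m3 G lab st =
     (\<chi> p q. real (card {e \<in> arcs G. tail G e = p \<and> head G e = q \<and>
                          (\<exists>k<m3. lab e = (fst st, snd st, k))}))"

text \<open>The library's \<open>^\<close> on \<open>real^'n^'n\<close> would be the componentwise power.\<close>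

definition primitive_matrix :: "real^'n^'n \<Rightarrow> bool" where
  "primitive_matrix A \<longleftrightarrow> (\<exists>d\<ge>1. \<forall>p q. 0 < (((\<lambda>B. B ** A) ^^ d) (mat 1)) $ p $ q)"


section \<open>Recursive structure\<close>

definition row_image :: "real^'n^'n \<Rightarrow> (real^'n) set" where
  "row_image B = range (\<lambda>x. x v* B)"

definition recursive_structure ::
    "nat \<Rightarrow> nat \<Rightarrow> (nat \<times> nat \<Rightarrow> real^'n^'n) \<Rightarrow> real^'n \<Rightarrow> bool" where
  "recursive_structure m1 m2 A v \<longleftrightarrow>
     v \<noteq> 0 \<and> (\<forall>s<m1. \<exists>t<m2. row_image (A (s, t)) = span {v})"

definition P_set :: "nat \<Rightarrow> (nat \<times> nat \<Rightarrow> real^'n^'n) \<Rightarrow> real^'n \<Rightarrow> nat \<Rightarrow> nat set" where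
  "P_set m2 A v u = {t \<in> {..<m2}. A (u, t) = 0 \<or> row_image (A (u, t)) = span {v}}"

definition Q_set :: "nat \<Rightarrow> (nat \<times> nat \<Rightarrow> real^'n^'n) \<Rightarrow> real^'n \<Rightarrow> nat \<Rightarrow> (nat \<times> nat) set" where
  "Q_set m2 A v u = {u} \<times> P_set m2 A v u"

definition removable :: "nat \<Rightarrow> nat \<Rightarrow> (nat \<times> nat \<Rightarrow> real^'n^'n) \<Rightarrow> real^'n \<Rightarrow> nat \<Rightarrow> bool" where
  "removable m1 m2 A v u \<longleftrightarrow> u < m1 \<and> P_set m2 A v u = {..<m2}"

definition J_set :: "nat \<Rightarrow> nat \<Rightarrow> (nat \<times> nat \<Rightarrow> real^'n^'n) \<Rightarrow> real^'n \<Rightarrow> nat set" where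
  "J_set m1 m2 A v = {u \<in> {..<m1}. \<not> removable m1 m2 A v u}"

text \<open>Words are lists; the empty word needs no separate clause in the definitions below.\<close>

definition D_coeff ::
    "(nat \<times> nat \<Rightarrow> real^'n^'n) \<Rightarrow> real^'n \<Rightarrow> (nat \<times> nat) list \<Rightarrow> nat \<times> nat \<Rightarrow> real" where
  "D_coeff A v w p = (THE d. foldl (\<lambda>x q. x v* A q) v (w @ [p]) = d *\<^sub>R v)"

definition R_words ::
    "nat \<Rightarrow> nat \<Rightarrow> (nat \<times> nat \<Rightarrow> real^'n^'n) \<Rightarrow> real^'n \<Rightarrow> nat list \<Rightarrow> (nat \<times> nat) list set" where
  "R_words m1 m2 A v s =
     {w \<in> lists ({..<m1} \<times> {..<m2}). map fst w = s \<and> (\<forall>(a, t)\<in>set w. t \<notin> P_set m2 A v a)}"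

definition C_coeff ::
    "nat \<Rightarrow> nat \<Rightarrow> (nat \<times> nat \<Rightarrow> real^'n^'n) \<Rightarrow> real^'n \<Rightarrow> real \<Rightarrow> nat list \<Rightarrow> nat \<Rightarrow> real" where
  "C_coeff m1 m2 A v a2 s u =
     (\<Sum>p\<in>Q_set m2 A v u. \<Sum>w\<in>R_words m1 m2 A v s. D_coeff A v w p powr a2)"

abbreviation J_words :: "nat \<Rightarrow> nat \<Rightarrow> (nat \<times> nat \<Rightarrow> real^'n^'n) \<Rightarrow> real^'n \<Rightarrow> nat list set" where
  "J_words m1 m2 A v \<equiv> lists (J_set m1 m2 A v)"

text \<open>
  The direct sum of copies of \<open>\<real>\<close> indexed by \<open>\<Gamma>\<close>, as functions on all words that vanish
  outside a finite subset of \<open>\<Gamma>\<close>.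
\<close>

definition direct_sum :: "'a set \<Rightarrow> ('a \<Rightarrow> real) set" where
  "direct_sum \<Gamma> = {x. finite {l. x l \<noteq> 0} \<and> {l. x l \<noteq> 0} \<subseteq> \<Gamma>}"

definition l1_norm :: "('a \<Rightarrow> real) \<Rightarrow> real" where
  "l1_norm x = (\<Sum>l | x l \<noteq> 0. \<bar>x l\<bar>)"

definition M_op ::
    "nat \<Rightarrow> nat \<Rightarrow> (nat \<times> nat \<Rightarrow> real^'n^'n) \<Rightarrow> real^'n \<Rightarrow> real \<Rightarrow> nat
       \<Rightarrow> (nat list \<Rightarrow> real) \<Rightarrow> nat list \<Rightarrow> real" where
  "M_op m1 m2 A v a2 u x l =
     (if l = [] then \<Sum>s | s \<in> J_words m1 m2 A v \<and> x s \<noteq> 0. C_coeff m1 m2 A v a2 s u * x s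
      else if u \<in> J_set m1 m2 A v \<and> l \<in> J_words m1 m2 A v \<and> last l = u then x (butlast l)
      else 0)"

text \<open>The composition \<open>M\<^sub>u M\<^sub>t\<^sub>L \<cdots> M\<^sub>t\<^sub>1\<close> for \<open>ts = [t\<^sub>1, \<dots>, t\<^sub>L]\<close>.\<close>

definition M_word ::
    "nat \<Rightarrow> nat \<Rightarrow> (nat \<times> nat \<Rightarrow> real^'n^'n) \<Rightarrow> real^'n \<Rightarrow> real \<Rightarrow> nat \<Rightarrow> nat list
       \<Rightarrow> (nat list \<Rightarrow> real) \<Rightarrow> nat list \<Rightarrow> real" where
  "M_word m1 m2 A v a2 u ts x = M_op m1 m2 A v a2 u (fold (M_op m1 m2 A v a2) ts x)"

text \<open>
  ``Increasing'' refers to the cone of families with nonnegative entries, which is where the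
  operators \<open>M\<^sub>u\<close> are iterated. For families of arbitrary sign the condition could never hold for
  \<open>M\<^sub>u M\<^sub>t\<^sub>L \<cdots> M\<^sub>t\<^sub>1\<close> with \<open>u\<close> removable: this operator has rank at most one, while the direct sum
  is infinite-dimensional as soon as some index is not removable, so it has a nonzero kernel
  (see \<open>not_increasing_on_signed_families\<close> below).
\<close>

definition l1_increasing ::
    "'a set \<Rightarrow> (('a \<Rightarrow> real) \<Rightarrow> ('a \<Rightarrow> real)) \<Rightarrow> bool" where
  "l1_increasing \<Gamma> T \<longleftrightarrow>
     (\<forall>x\<in>direct_sum \<Gamma>. (\<forall>l. 0 \<le> x l) \<longrightarrow> l1_norm x \<le> l1_norm (T x))"

definition Phi0 :: "nat list \<Rightarrow> real" where
  "Phi0 l = (if l = [] then 1 else 0)"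

definition c_coeff ::
    "nat \<Rightarrow> nat \<Rightarrow> (nat \<times> nat \<Rightarrow> real^'n^'n) \<Rightarrow> real^'n \<Rightarrow> real \<Rightarrow> nat \<Rightarrow> nat list \<Rightarrow> real" where
  "c_coeff m1 m2 A v a2 u s = (THE c. M_word m1 m2 A v a2 u s Phi0 = (\<lambda>l. c * Phi0 l))"

definition b_coeff ::
    "nat \<Rightarrow> nat \<Rightarrow> (nat \<times> nat \<Rightarrow> real^'n^'n) \<Rightarrow> real^'n \<Rightarrow> real \<Rightarrow> real \<Rightarrow> nat \<Rightarrow> nat \<Rightarrow> real" where
  "b_coeff m1 m2 A v a1 a2 u k =
     (\<Sum>s | s \<in> lists ({..<m1} - {u}) \<and> length s = k. c_coeff m1 m2 A v a2 u s powr a1)"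

lemma direct_sum_lincomb:
  assumes "x \<in> direct_sum \<Gamma>" "y \<in> direct_sum \<Gamma>"
  shows "(\<lambda>l. a * x l + b * y l) \<in> direct_sum \<Gamma>"
proof -
  have "{l. a * x l + b * y l \<noteq> 0} \<subseteq> {l. x l \<noteq> 0} \<union> {l. y l \<noteq> 0}" by auto
  then show ?thesis
    using assms unfolding direct_sum_def by (blast intro: finite_subset)
qed

lemma M_op_direct_sum:
  assumes "x \<in> direct_sum (J_words m1 m2 A v)"
  shows "M_op m1 m2 A v a2 u x \<in> direct_sum (J_words m1 m2 A v)"
proof -
  let ?N = "{l. M_op m1 m2 A v a2 u x l \<noteq> 0}"
  have "?N \<subseteq> insert [] ((\<lambda>l. l @ [u]) ` {l. x l \<noteq> 0})"
  proof
    fix l assume "l \<in> ?N"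
    then show "l \<in> insert [] ((\<lambda>l. l @ [u]) ` {l. x l \<noteq> 0})"
      by (cases l rule: rev_cases) (auto simp: M_op_def split: if_splits)
  qed
  then have "finite ?N"
    using assms by (auto simp: direct_sum_def intro: finite_subset)
  then show ?thesis
    by (auto simp: direct_sum_def M_op_def split: if_splits)
qed

lemma M_op_lincomb:
  assumes "x \<in> direct_sum (J_words m1 m2 A v)" "y \<in> direct_sum (J_words m1 m2 A v)"
  shows "M_op m1 m2 A v a2 u (\<lambda>l. a * x l + b * y l) =
         (\<lambda>l. a * M_op m1 m2 A v a2 u x l + b * M_op m1 m2 A v a2 u y l)"
proof -
  let ?F = "{l. x l \<noteq> 0} \<union> {l. y l \<noteq> 0}"
  have F: "finite ?F" "?F \<subseteq> J_words m1 m2 A v"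
    using assms by (auto simp: direct_sum_def)
  have sum_F: "(\<Sum>s | s \<in> J_words m1 m2 A v \<and> z s \<noteq> 0. C_coeff m1 m2 A v a2 s u * z s) =
               (\<Sum>s\<in>?F. C_coeff m1 m2 A v a2 s u * z s)"
    if "{l. z l \<noteq> 0} \<subseteq> ?F" for z
    using that F by (intro sum.mono_neutral_left) auto
  show ?thesis
  proof
    fix l
    show "M_op m1 m2 A v a2 u (\<lambda>l. a * x l + b * y l) l =
          a * M_op m1 m2 A v a2 u x l + b * M_op m1 m2 A v a2 u y l"
    proof (cases "l = []")
      case True
      have "{l. a * x l + b * y l \<noteq> 0} \<subseteq> ?F" by auto
      note S = sum_F[OF this] sum_F[of x] sum_F[of y]
      show ?thesis
        unfolding M_op_def using S True
        by (simp add: sum_distrib_left sum.distrib[symmetric] algebra_simps)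
    qed (simp add: M_op_def)
  qed
qed

lemma fold_M_op:
  assumes "x \<in> direct_sum (J_words m1 m2 A v)" "y \<in> direct_sum (J_words m1 m2 A v)"
  shows "fold (M_op m1 m2 A v a2) ts x \<in> direct_sum (J_words m1 m2 A v)"
    and "fold (M_op m1 m2 A v a2) ts (\<lambda>l. a * x l + b * y l) =
         (\<lambda>l. a * fold (M_op m1 m2 A v a2) ts x l + b * fold (M_op m1 m2 A v a2) ts y l)"
  using assms by (induction ts arbitrary: x y) (auto simp: M_op_direct_sum M_op_lincomb)

lemma not_increasing_on_signed_families:
  assumes "removable m1 m2 A v u" and "j \<in> J_set m1 m2 A v"
  shows "\<not> (\<forall>x\<in>direct_sum (J_words m1 m2 A v). l1_norm x \<le> l1_norm (M_word m1 m2 A v a2 u ts x))"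
proof -
  let ?T = "M_word m1 m2 A v a2 u ts"
  define x y :: "nat list \<Rightarrow> real"
    where "x = (\<lambda>l. if l = [] then 1 else 0)" and "y = (\<lambda>l. if l = [j] then 1 else 0)"
  have xy: "x \<in> direct_sum (J_words m1 m2 A v)" "y \<in> direct_sum (J_words m1 m2 A v)"
    using assms(2) by (auto simp: x_def y_def direct_sum_def)
  define a b where "a = (if ?T x [] = 0 then 1 else ?T y [])"
    and "b = (if ?T x [] = 0 then 0 else - ?T x [])"
  define z where "z = (\<lambda>l. a * x l + b * y l)"
  have z: "z \<in> direct_sum (J_words m1 m2 A v)"
    unfolding z_def using xy by (rule direct_sum_lincomb)
  have "?T z [] = a * ?T x [] + b * ?T y []"
    unfolding M_word_def z_def using xy by (simp add: fold_M_op M_op_lincomb)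
  also have "\<dots> = 0" by (simp add: a_def b_def)
  finally have "?T z [] = 0" .
  moreover have "?T z l = 0" if "l \<noteq> []" for l
    using that assms(1) by (simp add: M_word_def M_op_def J_set_def)
  ultimately have "?T z l = 0" for l by (cases "l = []") auto
  then have "l1_norm (?T z) = 0" by (simp add: l1_norm_def)
  moreover have "z [] \<noteq> 0 \<or> z [j] \<noteq> 0"
    by (auto simp: z_def x_def y_def a_def b_def)
  then have "0 < l1_norm z"
    using z unfolding l1_norm_def direct_sum_def by (intro sum_pos) auto
  ultimately show ?thesis using z by force
qed

end

(*
  By the method of McMullen and of Kenyon and Peres, the sofic set is compared with self-affine
  sponges whose digits are blocks of length N: it is contained in the sponge of all words of length N
  and contains the sponges of loops at a vertex. A sponge is bounded above by a Bernoulli measure on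
  approximate cubes, and below by pigeonholing its fibres dyadically to a subsponge with uniform
  fibres, which loses only a factor polynomial in N. Hence the dimension is the base m1 logarithm of
  the growth rate of
    W N = sum over s of (sum over t of |A_(s,t)|^a2)^a1,  s and t ranging over words of length N.

  Up to a positive factor v is a nonnegative vector, and every occurrence of a letter of Q resets the
  row vector to a multiple of v. The operators M record the weight since the last reset, so that c(s)
  is the sum over t of (|v A_(su,t)| / |v|)^a2. These sums are multiplicative along occurrences of u,
  so the total weight Z N of the words of length N that end in u is the renewal sequence of b. By
  primitivity Z and W have the same growth rate, and submultiplicativity of W makes the generating
  function of b take the value 1 exactly at the inverse of that rate.
*)
theory Submission
  imports Defs "HOL-Probability.Probability"
begin


section \<open>Digit expansions on the circle\<close>

text \<open>The two bounds use different measures for a reason. Under the Bernoulli measure with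
  optimal weights, the mass of an approximate cube depends on the digits met along it. A cover only
  needs, for each point, infinitely many scales at which this mass is large enough, and an averaging
  with weights 1/k^2 finds them for every single sequence, so no ergodic theorem enters. The lower
  bound, in contrast, needs an estimate at every scale. With uniform fibres all cubes of one
  generation obey the same bound, so no law of large numbers enters either. The loss
  \<open>class_loss\<close> paid for uniformity is polylogarithmic in the bases; for the bases
  m_i^N, which have the same a1 and a2, it is beaten by any strict exponential gain. The graph
  enters only through counting: since the labels are right-resolving, the entries of matrix products
  count label words and not merely paths.\<close>

primrec digit_prefix :: "nat \<Rightarrow> nat \<Rightarrow> (nat \<Rightarrow> nat) \<Rightarrow> nat" where
  "digit_prefix m 0 e = 0"
| "digit_prefix m (Suc L) e = digit_prefix m L e * m + e L"

definition expansion_value :: "nat \<Rightarrow> (nat \<Rightarrow> nat) \<Rightarrow> real" where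
  "expansion_value m e = (\<Sum>k. real (e k) / real m ^ Suc k)"

lemma expansion_eq_abs: "expansion m e = abs_circle (expansion_value m e)"
  by (simp add: expansion_def expansion_value_def)

lemma digit_prefix_sum:
  assumes "0 < m"
  shows "(\<Sum>j<L. real (e j) / real m ^ Suc j) = real (digit_prefix m L e) / real m ^ L"
  using assms by (induction L) (auto simp: field_simps)

lemma digit_prefix_less:
  assumes "\<And>j. j < L \<Longrightarrow> e j < m"
  shows "digit_prefix m L e < m ^ L"
  using assms
proof (induction L)
  case (Suc L)
  then have "digit_prefix m L e + 1 \<le> m ^ L" "e L + 1 \<le> m"
    by (auto simp: Suc_le_eq)
  then have "(digit_prefix m L e + 1) * m \<le> m ^ L * m" "e L + 1 \<le> m"
    using mult_le_mono1 by blast+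
  then show ?case by (simp add: algebra_simps)
qed simp

lemma digit_prefix_cong:
  assumes "\<And>j. j < L \<Longrightarrow> e j = e' j"
  shows "digit_prefix m L e = digit_prefix m L e'"
  using assms by (induction L) auto

lemma digit_prefix_inject:
  assumes "\<And>j. j < L \<Longrightarrow> e j < m" "\<And>j. j < L \<Longrightarrow> e' j < m"
    and "digit_prefix m L e = digit_prefix m L e'" "j < L"
  shows "e j = e' j"
  using assms
proof (induction L arbitrary: j)
  case (Suc L)
  have lt: "e L < m" "e' L < m" using Suc.prems by auto
  have "(digit_prefix m L e * m + e L) mod m = (digit_prefix m L e' * m + e' L) mod m"
    "(digit_prefix m L e * m + e L) div m = (digit_prefix m L e' * m + e' L) div m"
    using Suc.prems by simp_all
  with lt have "e L = e' L" "digit_prefix m L e = digit_prefix m L e'" by simp_all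
  with Suc show ?case by (metis less_Suc_eq)
qed simp

lemma
  assumes m: "1 < m" and e: "\<And>j. e j < m"
  shows summable_expansion: "summable (\<lambda>k. real (e k) / real m ^ Suc k)"
    and expansion_value_nonneg: "0 \<le> expansion_value m e"
    and expansion_value_le_1: "expansion_value m e \<le> 1"
proof -
  have "(\<lambda>k. (1 / real m) ^ k) sums (1 / (1 - 1 / real m))"
    using m by (intro geometric_sums) simp
  then have "(\<lambda>k. (real m - 1) / real m * (1 / real m) ^ k) sums ((real m - 1) / real m * (1 / (1 - 1 / real m)))"
    by (rule sums_mult)
  also have "(real m - 1) / real m * (1 / (1 - 1 / real m)) = 1" using m by (simp add: field_simps)
  finally have g: "(\<lambda>k. (real m - 1) / real m * (1 / real m) ^ k) sums 1" .
  have le: "real (e k) / real m ^ Suc k \<le> (real m - 1) / real m * (1 / real m) ^ k" for k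
  proof -
    have "real (e k) \<le> real m - 1" using e[of k] by linarith
    then show ?thesis using m by (simp add: field_simps)
  qed
  show s: "summable (\<lambda>k. real (e k) / real m ^ Suc k)"
    using le by (intro summable_comparison_test[OF _ sums_summable[OF g]]) (auto intro!: exI[of _ 0])
  show "0 \<le> expansion_value m e" unfolding expansion_value_def by (intro suminf_nonneg s) simp
  show "expansion_value m e \<le> 1" unfolding expansion_value_def
    using suminf_le[OF le s sums_summable[OF g]] g by (simp add: sums_iff)
qed

lemma expansion_value_split:
  assumes m: "1 < m" and e: "\<And>j. e j < m"
  shows "expansion_value m e * real m ^ L = real (digit_prefix m L e) + expansion_value m (\<lambda>j. e (j + L))"
proof -
  have "expansion_value m e = (\<Sum>k. real (e (k + L)) / real m ^ Suc (k + L)) + (\<Sum>j<L. real (e j) / real m ^ Suc j)"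
    unfolding expansion_value_def by (intro suminf_split_initial_segment summable_expansion assms)
  also have "(\<Sum>k. real (e (k + L)) / real m ^ Suc (k + L)) = (\<Sum>k. (1 / real m ^ L) * (real (e (k + L)) / real m ^ Suc k))"
    by (intro suminf_cong) (simp add: power_add)
  also have "\<dots> = (1 / real m ^ L) * expansion_value m (\<lambda>j. e (j + L))"
    unfolding expansion_value_def by (intro suminf_mult summable_expansion assms)
  finally show ?thesis using m digit_prefix_sum[of m e L] by (simp add: field_simps del: power_Suc)
qed

lemma expansion_value_bounds:
  assumes m: "1 < m" and e: "\<And>j. e j < m"
  shows "real (digit_prefix m L e) \<le> expansion_value m e * real m ^ L"
    and "expansion_value m e * real m ^ L \<le> real (digit_prefix m L e) + 1"
  using expansion_value_split[OF m e, where L=L] expansion_value_nonneg[OF m, of "\<lambda>j. e (j + L)"]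
    expansion_value_le_1[OF m, of "\<lambda>j. e (j + L)"] e by auto

text \<open>The terms of a convergent series may be grouped N at a time. This is what lets words of
  length N act as single digits of the base \<open>m ^ N\<close>.\<close>

lemma expansion_block:
  assumes m: "1 < m" and e: "\<And>j. e j < m" and N: "0 < N"
  shows "expansion (m ^ N) (\<lambda>j. digit_prefix m N (\<lambda>i. e (j * N + i))) = expansion m e"
proof -
  have "(\<lambda>k. real (e k) / real m ^ Suc k) sums expansion_value m e"
    unfolding expansion_value_def by (intro summable_sums summable_expansion m e)
  then have "(\<lambda>n. \<Sum>k\<in>{n * N..<n * N + N}. real (e k) / real m ^ Suc k) sums expansion_value m e"
    by (rule sums_group[OF _ N])
  moreover have "(\<Sum>k\<in>{n * N..<n * N + N}. real (e k) / real m ^ Suc k)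
      = real (digit_prefix m N (\<lambda>i. e (n * N + i))) / real (m ^ N) ^ Suc n" for n
  proof -
    have "(\<Sum>k\<in>{n * N..<n * N + N}. real (e k) / real m ^ Suc k)
        = (\<Sum>i<N. real (e (n * N + i)) / real m ^ Suc (n * N + i))"
      by (intro sum.reindex_bij_witness[of _ "\<lambda>i. n * N + i" "\<lambda>k. k - n * N"]) auto
    also have "\<dots> = (1 / real (m ^ N) ^ n) * (\<Sum>i<N. real (e (n * N + i)) / real m ^ Suc i)"
      by (simp add: sum_distrib_left power_add power_mult[symmetric] ac_simps)
    also have "\<dots> = real (digit_prefix m N (\<lambda>i. e (n * N + i))) / real (m ^ N) ^ Suc n"
      using m by (subst digit_prefix_sum) (simp_all add: field_simps)
    finally show ?thesis .
  qed
  ultimately have "expansion_value (m ^ N) (\<lambda>j. digit_prefix m N (\<lambda>i. e (j * N + i))) = expansion_value m e"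
    unfolding expansion_value_def by (simp add: sums_iff)
  then show ?thesis by (simp add: expansion_eq_abs)
qed

lemma dist_abs_circle: "dist (abs_circle x) (abs_circle y) = infdist (x - y) \<int>"
  by (simp add: dist_circle.abs_eq)

lemma dist_expansion_le:
  assumes m: "1 < m" and e: "\<And>j. e j < m" "\<And>j. e' j < m" and eq: "\<And>j. j < L \<Longrightarrow> e j = e' j"
  shows "dist (expansion m e) (expansion m e') \<le> 1 / real m ^ L"
proof -
  have "digit_prefix m L e = digit_prefix m L e'" by (rule digit_prefix_cong) (rule eq)
  then have "\<bar>expansion_value m e * real m ^ L - expansion_value m e' * real m ^ L\<bar> \<le> 1"
    using expansion_value_bounds[of m e, where L=L] expansion_value_bounds[of m e', where L=L] m e by (auto simp: abs_le_iff)
  then have "\<bar>expansion_value m e - expansion_value m e'\<bar> * real m ^ L \<le> 1"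
    by (simp add: abs_mult flip: left_diff_distrib)
  then have "\<bar>expansion_value m e - expansion_value m e'\<bar> \<le> 1 / real m ^ L"
    using m by (simp add: field_simps)
  then show ?thesis
    using infdist_Ints_le[of "expansion_value m e - expansion_value m e'" 0]
    by (simp add: expansion_eq_abs dist_abs_circle)
qed

text \<open>Nearby points need not share digits, since expansions are not unique and the circle
  wraps around. Read as integers modulo \<open>m ^ L\<close>, however, the prefixes differ by at
  most 2, which leaves five candidates.\<close>

lemma digit_prefix_near:
  assumes m: "1 < m" and e: "\<And>j. e j < m" "\<And>j. e' j < m"
    and d: "dist (expansion m e) (expansion m e') \<le> 1 / real m ^ L"
  shows "digit_prefix m L e \<in> (\<lambda>n. nat ((int (digit_prefix m L e') + n) mod int (m ^ L))) ` {-2..2}"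
proof -
  let ?x = "expansion_value m e" and ?y = "expansion_value m e'"
  let ?p = "int (digit_prefix m L e)" and ?q = "int (digit_prefix m L e')"
  obtain k where "infdist (?x - ?y) \<int> = \<bar>?x - ?y - of_int k\<bar>"
    using infdist_Ints_attained by blast
  with d have "\<bar>?x - ?y - of_int k\<bar> \<le> 1 / real m ^ L"
    by (simp add: expansion_eq_abs dist_abs_circle)
  then have "\<bar>?x - ?y - of_int k\<bar> * real m ^ L \<le> 1" using m by (simp add: field_simps)
  then have "\<bar>(?x - ?y - of_int k) * real m ^ L\<bar> \<le> 1" by (simp add: abs_mult)
  then have "\<bar>?x * real m ^ L - ?y * real m ^ L - of_int (k * int (m ^ L))\<bar> \<le> 1"
    by (simp add: algebra_simps)
  \<comment> \<open>One unit comes from the distance, the other from the two tails, which both lie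
    between 0 and 1.\<close>
  then have "real_of_int (?p - ?q - k * int (m ^ L)) \<le> 2" "real_of_int (?p - ?q - k * int (m ^ L)) \<ge> -2"
    using expansion_value_bounds[of m e, where L=L] expansion_value_bounds[of m e', where L=L] m e
    by (auto simp: abs_le_iff)
  then have n: "?p - ?q - k * int (m ^ L) \<in> {-2..2}" by (simp only: atLeastAtMost_iff) linarith
  have "?p < int (m ^ L)" using digit_prefix_less[of L e m] e by (simp only: of_nat_less_iff)
  then have "(?q + (?p - ?q - k * int (m ^ L))) mod int (m ^ L) = ?p"
    using mod_mult_self1[of "?p" "-k" "int (m ^ L)"] by simp
  with n show ?thesis by (metis (no_types, lifting) image_eqI nat_int)
qed


section \<open>Approximate cubes\<close>

lemma hausdorff_premeasure_mono:
  "X \<subseteq> Y \<Longrightarrow> hausdorff_premeasure s d X \<le> hausdorff_premeasure s d Y"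
  unfolding hausdorff_premeasure_def by (rule Inf_superset_mono) blast

lemma hausdorff_measure_mono:
  "X \<subseteq> Y \<Longrightarrow> hausdorff_measure s X \<le> hausdorff_measure s Y"
  unfolding hausdorff_measure_def by (intro SUP_mono') (rule hausdorff_premeasure_mono)

definition sequences_over :: "'a set \<Rightarrow> (nat \<Rightarrow> 'a) set" where
  "sequences_over D = {x. \<forall>k. x k \<in> D}"

text \<open>The bases are parameters because the locale is used twice: with \<open>m1\<close>,
  \<open>m2\<close>, \<open>m3\<close> themselves and with their N-th powers, for the same
  \<open>a1\<close> and \<open>a2\<close>.\<close>

locale torus_bases =
  fixes M1 M2 M3 :: nat and a1 a2 :: real
  assumes M: "1 < M1" "M1 \<le> M2" "M2 \<le> M3"
    and a1: "a1 = log (real M2) (real M1)"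
    and a2: "a2 = log (real M3) (real M2)"
begin

lemma a1_bounds: "0 < a1" "a1 \<le> 1"
  using M by (auto simp: a1)

lemma a2_bounds: "0 < a2" "a2 \<le> 1"
  using M by (auto simp: a2)

lemma a12: "a1 * a2 = log (real M3) (real M1)"
  using M by (simp add: a1 a2 log_def)

text \<open>\<open>M2 powr a1\<close> and \<open>M3 powr (a1 * a2)\<close> both equal
  \<open>M1\<close>. So \<open>L2 k\<close> and \<open>L3 k\<close> are the numbers of digits that
  resolve the second and the third coordinate to the scale 1 / M1 ^ k, up to one digit.\<close>

definition L2 :: "nat \<Rightarrow> nat" where "L2 k = nat \<lfloor>a1 * real k\<rfloor>"
definition L3 :: "nat \<Rightarrow> nat" where "L3 k = nat \<lfloor>a1 * a2 * real k\<rfloor>"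

lemma L2_bounds: "real (L2 k) \<le> a1 * real k" "a1 * real k < real (L2 k) + 1"
  using a1_bounds by (auto simp: L2_def)

lemma L3_bounds: "real (L3 k) \<le> a1 * a2 * real k" "a1 * a2 * real k < real (L3 k) + 1"
  using a1_bounds a2_bounds by (auto simp: L3_def)

lemma L3_le_L2: "L3 k \<le> L2 k"
  unfolding L2_def L3_def using a1_bounds a2_bounds
  by (intro nat_mono floor_mono mult_right_mono) (auto simp: mult_le_cancel_left1)

lemma L2_le: "L2 k \<le> k"
proof -
  have "a1 * real k \<le> 1 * real k" using a1_bounds by (intro mult_right_mono) auto
  then show ?thesis using L2_bounds(1)[of k] by linarith
qed

lemma L2_mono: "k \<le> l \<Longrightarrow> L2 k \<le> L2 l"
  unfolding L2_def using a1_bounds by (intro nat_mono floor_mono mult_left_mono) auto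

lemma L3_mono: "k \<le> l \<Longrightarrow> L3 k \<le> L3 l"
  unfolding L3_def using a1_bounds a2_bounds by (intro nat_mono floor_mono mult_left_mono) auto

lemma powr_a1: "real M2 powr a1 = real M1"
  using M by (simp add: a1)

lemma powr_a12: "real M3 powr (a1 * a2) = real M1"
  using M by (simp add: a12)

lemma M2_pow: "real M2 ^ L2 k \<le> real M1 ^ k" "real M1 ^ k \<le> real M2 * real M2 ^ L2 k"
proof -
  have *: "real M1 ^ k = real M2 powr (a1 * real k)"
    using M powr_a1 by (simp add: powr_powr[symmetric] powr_realpow)
  have "real M2 ^ L2 k = real M2 powr real (L2 k)" "real M2 * real M2 ^ L2 k = real M2 powr (real (L2 k) + 1)"
    using M by (auto simp: powr_realpow powr_add)
  then show "real M2 ^ L2 k \<le> real M1 ^ k" "real M1 ^ k \<le> real M2 * real M2 ^ L2 k"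
    using L2_bounds[of k] M by (auto simp: * intro!: powr_mono)
qed

lemma M3_pow: "real M3 ^ L3 k \<le> real M1 ^ k" "real M1 ^ k \<le> real M3 * real M3 ^ L3 k"
proof -
  have *: "real M1 ^ k = real M3 powr (a1 * a2 * real k)"
    using M powr_a12 by (simp add: powr_powr[symmetric] powr_realpow)
  have "real M3 ^ L3 k = real M3 powr real (L3 k)" "real M3 * real M3 ^ L3 k = real M3 powr (real (L3 k) + 1)"
    using M by (auto simp: powr_realpow powr_add)
  then show "real M3 ^ L3 k \<le> real M1 ^ k" "real M1 ^ k \<le> real M3 * real M3 ^ L3 k"
    using L3_bounds[of k] M by (auto simp: * intro!: powr_mono)
qed

definition agree :: "nat \<Rightarrow> nat \<Rightarrow> nat \<times> nat \<times> nat \<Rightarrow> nat \<times> nat \<times> nat \<Rightarrow> bool" where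
  "agree k j d d' \<longleftrightarrow> fst d = fst d' \<and> (j < L2 k \<longrightarrow> fst (snd d) = fst (snd d'))
     \<and> (j < L3 k \<longrightarrow> snd (snd d) = snd (snd d'))"

text \<open>McMullen's approximate squares in three dimensions: fixing \<open>k\<close>,
  \<open>L2 k\<close> and \<open>L3 k\<close> digits gives a box whose sides are all comparable to 1
  / M1 ^ k. They are taken in sequence space, where cubes of different generations are nested or
  disjoint.\<close>

definition approx_cube :: "nat \<Rightarrow> (nat \<Rightarrow> nat \<times> nat \<times> nat) \<Rightarrow> (nat \<Rightarrow> nat \<times> nat \<times> nat) set" where
  "approx_cube k x = {y. \<forall>j<k. agree k j (y j) (x j)}"

lemma approx_cube_self: "x \<in> approx_cube k x"
  by (simp add: approx_cube_def agree_def)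

lemma approx_cube_eq: "y \<in> approx_cube k x \<Longrightarrow> approx_cube k y = approx_cube k x"
  by (auto simp: approx_cube_def agree_def)

lemma approx_cube_antimono:
  assumes "k \<le> l" shows "approx_cube l x \<subseteq> approx_cube k x"
  using assms L2_mono[OF assms] L3_mono[OF assms]
  by (auto simp: approx_cube_def agree_def)

definition digit_box :: "(nat \<times> nat \<times> nat) set" where
  "digit_box = {..<M1} \<times> {..<M2} \<times> {..<M3}"

lemma digit_boxD:
  "x \<in> sequences_over digit_box \<Longrightarrow> fst (x j) < M1"
  "x \<in> sequences_over digit_box \<Longrightarrow> fst (snd (x j)) < M2"
  "x \<in> sequences_over digit_box \<Longrightarrow> snd (snd (x j)) < M3"
  by (auto simp: sequences_over_def digit_box_def mem_Times_iff)

abbreviation R :: "(nat \<Rightarrow> nat \<times> nat \<times> nat) \<Rightarrow> circle \<times> circle \<times> circle" where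
  "R \<equiv> R_map M1 M2 M3"

text \<open>Each coordinate contributes at most \<open>M3 / M1 ^ k\<close>: rounding down to
  \<open>L2 k\<close> or \<open>L3 k\<close> loses at most one digit, that is, a factor
  \<open>M2\<close> or \<open>M3\<close>.\<close>

lemma dist_R_approx_cube:
  assumes x: "x \<in> sequences_over digit_box" and y: "y \<in> sequences_over digit_box"
    and xy: "y \<in> approx_cube k x"
  shows "dist (R x) (R y) \<le> 3 * real M3 / real M1 ^ k"
proof -
  have M0: "0 < real M1 ^ k" "0 < real M2 ^ L2 k" "0 < real M3 ^ L3 k" using M by simp_all
  have eq: "j < k \<Longrightarrow> fst (x j) = fst (y j)" "j < L2 k \<Longrightarrow> fst (snd (x j)) = fst (snd (y j))"
    "j < L3 k \<Longrightarrow> snd (snd (x j)) = snd (snd (y j))" for j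
    using xy L2_le[of k] L3_le_L2[of k] by (auto simp: approx_cube_def agree_def)
  have "dist (fst (R x)) (fst (R y)) \<le> 1 / real M1 ^ k"
    unfolding R_map_def using M digit_boxD[OF x] digit_boxD[OF y] eq by (auto intro!: dist_expansion_le)
  also have "\<dots> \<le> real M3 / real M1 ^ k" using M M0 by (intro divide_right_mono) auto
  finally have 1: "dist (fst (R x)) (fst (R y)) \<le> real M3 / real M1 ^ k" .
  have "dist (fst (snd (R x))) (fst (snd (R y))) \<le> 1 / real M2 ^ L2 k"
    unfolding R_map_def using M digit_boxD[OF x] digit_boxD[OF y] eq by (auto intro!: dist_expansion_le)
  also have "\<dots> \<le> real M2 / real M1 ^ k" using M2_pow[of k] M0 by (simp add: field_simps)
  also have "\<dots> \<le> real M3 / real M1 ^ k" using M M0 by (intro divide_right_mono) auto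
  finally have 2: "dist (fst (snd (R x))) (fst (snd (R y))) \<le> real M3 / real M1 ^ k" .
  have "dist (snd (snd (R x))) (snd (snd (R y))) \<le> 1 / real M3 ^ L3 k"
    unfolding R_map_def using M digit_boxD[OF x] digit_boxD[OF y] eq by (auto intro!: dist_expansion_le)
  also have "\<dots> \<le> real M3 / real M1 ^ k" using M3_pow[of k] M0 by (simp add: field_simps)
  finally have 3: "dist (snd (snd (R x))) (snd (snd (R y))) \<le> real M3 / real M1 ^ k" .
  have le: "dist p q \<le> dist (fst p) (fst q) + dist (snd p) (snd q)" for p q :: "'x::metric_space \<times> 'y::metric_space"
    unfolding dist_prod_def by (rule sqrt_sum_squares_le_sum) auto
  show ?thesis using le[of "R x" "R y"] le[of "snd (R x)" "snd (R y)"] 1 2 3 by simp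
qed

text \<open>A cube is determined by its three digit prefixes, and each prefix takes at most five
  values around that of a fixed point of \<open>T\<close>; hence 5 ^ 3.\<close>

lemma card_approx_cubes_le:
  assumes T: "T \<subseteq> sequences_over digit_box"
    and d: "\<And>x y. x \<in> T \<Longrightarrow> y \<in> T \<Longrightarrow> dist (R x) (R y) \<le> 1 / real M1 ^ k"
  shows "finite (approx_cube k ` T) \<and> card (approx_cube k ` T) \<le> 125"
proof (cases "T = {}")
  case False
  then obtain y where y: "y \<in> T" by blast
  define pre where "pre x = (digit_prefix M1 k (\<lambda>j. fst (x j)), digit_prefix M2 (L2 k) (\<lambda>j. fst (snd (x j))),
    digit_prefix M3 (L3 k) (\<lambda>j. snd (snd (x j))))" for x :: "nat \<Rightarrow> nat \<times> nat \<times> nat"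
  define g where "g m L e' n = nat ((int (digit_prefix m L e') + n) mod int (m ^ L))" for m L e' n
  define F where "F = g M1 k (\<lambda>j. fst (y j)) ` {-2..2} \<times> g M2 (L2 k) (\<lambda>j. fst (snd (y j))) ` {-2..2} \<times>
    g M3 (L3 k) (\<lambda>j. snd (snd (y j))) ` {-2..2}"
  have cardg: "card (g m L e' ` {-2..2}) \<le> 5" "finite (g m L e' ` {-2..2})" for m L e'
    using card_image_le[of "{-2..2::int}" "g m L e'"] by simp_all
  have F: "finite F" "card F \<le> 5 * (5 * 5)"
    unfolding F_def card_cartesian_product by (intro finite_cartesian_product mult_le_mono cardg)+
  have "pre ` T \<subseteq> F"
  proof (rule image_subsetI)
    fix x assume x: "x \<in> T"
    have xb: "x \<in> sequences_over digit_box" and yb: "y \<in> sequences_over digit_box" using x y T by auto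
    have pos: "0 < real M1 ^ k" "0 < real M2 ^ L2 k" "0 < real M3 ^ L3 k" using M by simp_all
    have "1 / real M1 ^ k \<le> 1 / real M2 ^ L2 k" "1 / real M1 ^ k \<le> 1 / real M3 ^ L3 k"
      using M2_pow(1)[of k] M3_pow(1)[of k] pos by (simp_all add: field_simps)
    moreover have "dist (fst (R x)) (fst (R y)) \<le> dist (R x) (R y)"
      "dist (fst (snd (R x))) (fst (snd (R y))) \<le> dist (R x) (R y)"
      "dist (snd (snd (R x))) (snd (snd (R y))) \<le> dist (R x) (R y)"
      by (rule dist_fst_le, rule order_trans[OF dist_fst_le dist_snd_le],
          rule order_trans[OF dist_snd_le dist_snd_le])
    ultimately have
      "dist (fst (R x)) (fst (R y)) \<le> 1 / real M1 ^ k"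
      "dist (fst (snd (R x))) (fst (snd (R y))) \<le> 1 / real M2 ^ L2 k"
      "dist (snd (snd (R x))) (snd (snd (R y))) \<le> 1 / real M3 ^ L3 k"
      using d[OF x y] by linarith+
    then show "pre x \<in> F" unfolding pre_def F_def g_def R_map_def fst_conv snd_conv
      using M digit_boxD[OF xb] digit_boxD[OF yb] by (intro SigmaI digit_prefix_near) auto
  qed
  then have P: "finite (pre ` T)" "card (pre ` T) \<le> 125"
    using F finite_subset card_mono[OF F(1), of "pre ` T"] by auto
  have pre_eq: "approx_cube k x = approx_cube k x'" if "x \<in> T" "x' \<in> T" "pre x = pre x'" for x x'
  proof -
    have xb: "x \<in> sequences_over digit_box" and yb: "x' \<in> sequences_over digit_box" using that T by auto
    have "fst (x j) = fst (x' j)" if "j < k" for j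
      using digit_prefix_inject[of k "\<lambda>j. fst (x j)" M1 "\<lambda>j. fst (x' j)" j] digit_boxD[OF xb] digit_boxD[OF yb] that \<open>pre x = pre x'\<close>
      by (auto simp: pre_def)
    moreover have "fst (snd (x j)) = fst (snd (x' j))" if "j < L2 k" for j
      using digit_prefix_inject[of "L2 k" "\<lambda>j. fst (snd (x j))" M2 "\<lambda>j. fst (snd (x' j))" j] digit_boxD[OF xb] digit_boxD[OF yb] that \<open>pre x = pre x'\<close>
      by (auto simp: pre_def)
    moreover have "snd (snd (x j)) = snd (snd (x' j))" if "j < L3 k" for j
      using digit_prefix_inject[of "L3 k" "\<lambda>j. snd (snd (x j))" M3 "\<lambda>j. snd (snd (x' j))" j] digit_boxD[OF xb] digit_boxD[OF yb] that \<open>pre x = pre x'\<close>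
      by (auto simp: pre_def)
    ultimately show ?thesis by (intro approx_cube_eq) (auto simp: approx_cube_def agree_def)
  qed
  have "approx_cube k ` T = (\<lambda>a. approx_cube k (inv_into T pre a)) ` pre ` T"
    unfolding image_image
  proof (intro image_cong refl)
    fix x assume "x \<in> T"
    then show "approx_cube k x = approx_cube k (inv_into T pre (pre x))"
      by (intro pre_eq) (auto simp: inv_into_into f_inv_into_f)
  qed
  then show ?thesis using P card_image_le[OF P(1), of "\<lambda>a. approx_cube k (inv_into T pre a)"] by simp
qed simp

lemma
  fixes p :: "(nat \<times> nat \<times> nat) pmf"
  shows sets_approx_cube: "approx_cube k x \<in> sets (PiM UNIV (\<lambda>_. measure_pmf p))"
    and emeasure_approx_cube: "emeasure (PiM UNIV (\<lambda>_. measure_pmf p)) (approx_cube k x)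
      = ennreal (\<Prod>j<k. measure_pmf.prob p {d. agree k j d (x j)})"
proof -
  interpret product_prob_space "\<lambda>_. measure_pmf p" "UNIV :: nat set" ..
  have eq: "approx_cube k x = {y \<in> space (PiM UNIV (\<lambda>_. measure_pmf p)). \<forall>j\<in>{..<k}. y j \<in> {d. agree k j d (x j)}}"
    by (auto simp: approx_cube_def space_PiM)
  show "emeasure (PiM UNIV (\<lambda>_. measure_pmf p)) (approx_cube k x)
      = ennreal (\<Prod>j<k. measure_pmf.prob p {d. agree k j d (x j)})"
    unfolding eq by (subst emeasure_PiM_Collect) (auto simp: measure_pmf.emeasure_eq_measure prod_ennreal)
  show "approx_cube k x \<in> sets (PiM UNIV (\<lambda>_. measure_pmf p))"
    unfolding eq by (intro sets.sets_Collect_finite_All sets_Collect_single') auto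
qed

end


section \<open>Sponges with uniform fibres: lower bound\<close>

text \<open>Frostman's argument. The hypothesis \<open>cover\<close> asks for a measurable superset
  because the sets of a cover are arbitrary, and for a positive \<delta>, so that sets of very small
  diameter have to be enlarged.\<close>

lemma mass_distribution_principle:
  fixes f :: "'a \<Rightarrow> 'b::metric_space"
  assumes "prob_space M" and Y: "AE x in M. x \<in> Y" and C: "1 \<le> C" and s: "0 < s"
    and cover: "\<And>U \<delta>. \<lbrakk>0 < \<delta>; \<delta> \<le> 1; \<And>p q. p \<in> U \<Longrightarrow> q \<in> U \<Longrightarrow> dist p q \<le> \<delta>\<rbrakk> \<Longrightarrow>
      \<exists>B\<in>sets M. {x\<in>Y. f x \<in> U} \<subseteq> B \<and> emeasure M B \<le> ennreal (C * \<delta> powr s)"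
  shows "hausdorff_measure s (f ` Y) \<noteq> 0"
proof -
  interpret prob_space M by fact
  have low: "ennreal (1 / (2 * C)) \<le> (\<Sum>i. ennreal (diameter (U i) powr s))"
    if U: "f ` Y \<subseteq> (\<Union>i. U i)" "\<And>i. bounded (U i)" "\<And>i. diameter (U i) \<le> 1" for U :: "nat \<Rightarrow> 'b set"
  proof -
    \<comment> \<open>The slack for enlarging the i-th set. It sums to 1 / (2 * C), so after
      multiplication by \<open>C\<close> it uses up half of the total mass 1.\<close>
    define e where "e i = 1 / (2 * C) * (1 / 2) ^ Suc i" for i
    define \<delta> where "\<delta> i = max (diameter (U i)) (e i powr (1 / s))" for i
    have e: "0 < e i" "e i \<le> 1" for i
    proof -
      have "(1 / 2 :: real) ^ Suc i \<le> 1" by (rule power_le_one) auto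
      then show "0 < e i" "e i \<le> 1" using C mult_mono[of "1 / (2 * C)" 1 "(1 / 2) ^ Suc i" 1]
        by (auto simp: e_def)
    qed
    have d1: "0 < \<delta> i" "\<delta> i \<le> 1" for i
      using e[of i] U(3)[of i] s powr_mono2[of "1 / s" "e i" 1] by (auto simp: \<delta>_def less_max_iff_disj)
    have d2: "\<delta> i powr s \<le> diameter (U i) powr s + e i" for i
      using e[of i] s by (auto simp: \<delta>_def max_def powr_powr)
    have "\<exists>B\<in>sets M. {x\<in>Y. f x \<in> U i} \<subseteq> B \<and> emeasure M B \<le> ennreal (C * \<delta> i powr s)" for i
    proof (rule cover[OF d1])
      fix p q assume "p \<in> U i" "q \<in> U i"
      then have "dist p q \<le> diameter (U i)" using U(2) by (rule diameter_bounded_bound[rotated])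
      then show "dist p q \<le> \<delta> i" by (simp add: \<delta>_def)
    qed
    then obtain B where B: "\<And>i. B i \<in> sets M" "\<And>i. {x\<in>Y. f x \<in> U i} \<subseteq> B i"
      "\<And>i. emeasure M (B i) \<le> ennreal (C * \<delta> i powr s)" by metis
    have "Y \<subseteq> (\<Union>i. B i)" using U(1) B(2) by blast
    then have "emeasure M (\<Union>i. B i) = 1"
      using Y B(1) by (intro emeasure_eq_1_AE sets.countable_UN) (auto elim!: eventually_mono)
    then have "1 \<le> (\<Sum>i. emeasure M (B i))"
      using emeasure_subadditive_countably[of B M] B(1) by auto
    also have "\<dots> \<le> (\<Sum>i. ennreal C * ennreal (diameter (U i) powr s) + ennreal C * ennreal (e i))"
    proof (intro suminf_le summableI)
      fix i
      have "C * \<delta> i powr s \<le> C * diameter (U i) powr s + C * e i"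
        using d2[of i] C by (simp flip: distrib_left)
      then have "ennreal (C * \<delta> i powr s) \<le> ennreal (C * diameter (U i) powr s + C * e i)"
        by (rule ennreal_leI)
      with B(3)[of i] show "emeasure M (B i) \<le> ennreal C * ennreal (diameter (U i) powr s) + ennreal C * ennreal (e i)"
        using C e[of i] by (auto simp: ennreal_mult ennreal_plus)
    qed
    also have "\<dots> = ennreal C * (\<Sum>i. ennreal (diameter (U i) powr s)) + ennreal C * (\<Sum>i. ennreal (e i))"
      by (subst suminf_add[symmetric]) auto
    also have "(\<Sum>i. ennreal (e i)) = ennreal (1 / (2 * C))"
    proof -
      have "e sums (1 / (2 * C) * 1)" unfolding e_def by (intro sums_mult power_half_series)
      then show ?thesis using e by (subst suminf_ennreal2) (auto simp: sums_iff less_imp_le)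
    qed
    also have "ennreal C * ennreal (1 / (2 * C)) = ennreal (1 / 2)"
      using C by (simp flip: ennreal_mult)
    finally have S: "1 \<le> ennreal C * (\<Sum>i. ennreal (diameter (U i) powr s)) + ennreal (1 / 2)" .
    show ?thesis
    proof (rule ccontr)
      assume *: "\<not> ?thesis"
      then obtain z where z: "(\<Sum>i. ennreal (diameter (U i) powr s)) = ennreal z" "0 \<le> z"
        by (metis ennreal_cases not_le top_greatest)
      with * have "z < 1 / (2 * C)" using C by (simp add: not_le ennreal_less_iff)
      then have "C * z + 1 / 2 < 1" using C by (simp add: field_simps)
      moreover have "ennreal 1 \<le> ennreal (C * z + 1 / 2)"
        using S z C by (simp add: ennreal_mult ennreal_plus del: ennreal_half)
      ultimately show False using z C by (subst (asm) ennreal_le_iff) auto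
    qed
  qed
  have "ennreal (1 / (2 * C)) \<le> hausdorff_premeasure s 1 (f ` Y)"
    unfolding hausdorff_premeasure_def using low by (intro Inf_greatest) auto
  also have "\<dots> \<le> hausdorff_measure s (f ` Y)"
    unfolding hausdorff_measure_def by (intro SUP_upper) auto
  finally show ?thesis using C by auto
qed

lemma prod_if_less:
  fixes c :: "'a::comm_monoid_mult"
  assumes "L \<le> k"
  shows "(\<Prod>j<k. if j < L then c else 1) = c ^ L"
proof -
  have "(\<Prod>j<k. if j < L then c else 1) = (\<Prod>j\<in>{..<k} \<inter> {j. j < L}. c)"
    by (simp add: prod.inter_filter[symmetric] Int_def)
  also have "{..<k} \<inter> {j. j < L} = {..<L}" using assms by auto
  finally show ?thesis by simp
qed

section \<open>Uniform measure on a sponge with uniform fibres\<close>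

context torus_bases begin

context
  fixes S :: "nat set" and T :: "nat \<Rightarrow> nat set" and K :: "nat \<Rightarrow> nat \<Rightarrow> nat set" and N1 N2 N3 :: nat
    and D :: "(nat \<times> nat \<times> nat) set"
  assumes D_def: "D = (SIGMA s:S. SIGMA t:T s. K s t)"
    and D_box: "D \<subseteq> digit_box"
    and N1: "card S = N1" "0 < N1"
    and N2: "\<And>s. s \<in> S \<Longrightarrow> card (T s) = N2" "0 < N2"
    and N3: "\<And>s t. s \<in> S \<Longrightarrow> t \<in> T s \<Longrightarrow> card (K s t) = N3" "0 < N3"
begin

lemma uniform_finite: "finite D" "finite S" "s \<in> S \<Longrightarrow> finite (T s)" "s \<in> S \<Longrightarrow> t \<in> T s \<Longrightarrow> finite (K s t)"
  using D_box N1 N2 N3 by (auto simp: digit_box_def intro: finite_subset card_ge_0_finite)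

lemma uniform_card: "card D = N1 * N2 * N3"
proof -
  have "card D = (\<Sum>s\<in>S. \<Sum>t\<in>T s. card (K s t))"
    unfolding D_def using uniform_finite by (simp add: card_SigmaI finite_SigmaI)
  also have "\<dots> = (\<Sum>s\<in>S. \<Sum>t\<in>T s. N3)" using N3 by (intro sum.cong) auto
  also have "\<dots> = N1 * N2 * N3" using N1 N2 by simp
  finally show ?thesis .
qed

lemma uniform_fibre_card:
  assumes "d0 \<in> D"
  shows "card (D \<inter> {d. agree k j d d0}) \<le> (if j < L2 k then 1 else N2) * (if j < L3 k then 1 else N3)"
proof -
  obtain s0 t0 k0 where d0: "d0 = (s0, t0, k0)" "s0 \<in> S" "t0 \<in> T s0" "k0 \<in> K s0 t0"
    using assms unfolding D_def by auto
  let ?T = "if j < L2 k then {t0} else T s0" and ?K = "\<lambda>t. if j < L3 k then {k0} else K s0 t"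
  have T: "?T \<subseteq> T s0" "finite ?T" using d0 uniform_finite by auto
  have K: "finite (?K t)" "card (?K t) = (if j < L3 k then 1 else N3)" if "t \<in> ?T" for t
    using that T(1) d0 uniform_finite N3 by auto
  have "card (D \<inter> {d. agree k j d d0}) \<le> card ({s0} \<times> (SIGMA t:?T. ?K t))"
    using T K L3_le_L2[of k] by (intro card_mono finite_cartesian_product finite_SigmaI) (auto simp: D_def agree_def d0)
  also have "\<dots> = (\<Sum>t\<in>?T. card (?K t))"
    unfolding card_cartesian_product using T K by (subst card_SigmaI) auto
  also have "\<dots> = (\<Sum>t\<in>?T. if j < L3 k then 1 else N3)" by (intro sum.cong K) auto
  also have "\<dots> = (if j < L2 k then 1 else N2) * (if j < L3 k then 1 else N3)"
    using d0 N2 by auto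
  finally show ?thesis .
qed

text \<open>A position j contributes at most 1 / (N1 * N2 * N3) below \<open>L3 k\<close>, 1 / (N1 *
  N2) from there up to \<open>L2 k\<close>, and 1 / N1 beyond. The rounding in \<open>L2 k\<close>
  and \<open>L3 k\<close> costs the factor \<open>N2 * N3\<close>.\<close>

lemma uniform_cube_weight:
  assumes x: "x \<in> sequences_over D" and s: "0 < s" "real M1 powr s \<le> real N1 * real N2 powr a1 * real N3 powr (a1 * a2)"
  shows "(\<Prod>j<k. measure_pmf.prob (pmf_of_set D) {d. agree k j d (x j)}) \<le> real N2 * real N3 * (1 / real M1 powr s) ^ k"
proof -
  have ne: "D \<noteq> {}" using x by (auto simp: sequences_over_def)
  have "(\<Prod>j<k. measure_pmf.prob (pmf_of_set D) {d. agree k j d (x j)})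
    \<le> (\<Prod>j<k. (1 / N1) * (if j < L2 k then 1 / N2 else 1) * (if j < L3 k then 1 / N3 else 1))"
  proof (intro prod_mono conjI measure_nonneg)
    fix j
    have "x j \<in> D" using x by (auto simp: sequences_over_def)
    from uniform_fibre_card[OF this, of k j]
    have "real (card (D \<inter> {d. agree k j d (x j)})) \<le> (if j < L2 k then 1 else N2) * (if j < L3 k then 1 else N3)"
      by (simp only: of_nat_le_iff)
    then have "real (card (D \<inter> {d. agree k j d (x j)})) / real (card D)
        \<le> ((if j < L2 k then 1 else N2) * (if j < L3 k then 1 else N3)) / (N1 * N2 * N3)"
      unfolding uniform_card by (simp add: divide_right_mono)
    also have "\<dots> = (1 / N1) * (if j < L2 k then 1 / N2 else 1) * (if j < L3 k then 1 / N3 else 1)"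
      using N1 N2 N3 by simp
    finally show "measure_pmf.prob (pmf_of_set D) {d. agree k j d (x j)}
        \<le> (1 / N1) * (if j < L2 k then 1 / N2 else 1) * (if j < L3 k then 1 / N3 else 1)"
      using uniform_finite(1) ne by (simp add: measure_pmf_of_set)
  qed
  also have "\<dots> = 1 / (real N1 ^ k * real N2 ^ L2 k * real N3 ^ L3 k)"
    unfolding prod.distrib using L2_le[of k] L3_le_L2[of k] by (simp add: prod_if_less power_divide)
  also have "\<dots> \<le> real N2 * real N3 * (1 / real M1 powr s) ^ k"
  proof -
    have P: "real N powr (a * real k) \<le> real N * real N ^ L" if "a * real k \<le> real L + 1" "0 < N" for N L a
    proof -
      have "real N powr (a * real k) \<le> real N powr (real L + 1)" using that by (intro powr_mono) auto
      then show ?thesis using that by (simp add: powr_add powr_realpow mult.commute)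
    qed
    have "(real M1 powr s) ^ k \<le> (real N1 * real N2 powr a1 * real N3 powr (a1 * a2)) ^ k"
      using s by (intro power_mono) auto
    also have "\<dots> = real N1 ^ k * real N2 powr (a1 * real k) * real N3 powr (a1 * a2 * real k)"
      using N2 N3 by (simp add: power_mult_distrib powr_power ac_simps)
    also have "\<dots> \<le> real N1 ^ k * (real N2 * real N2 ^ L2 k) * (real N3 * real N3 ^ L3 k)"
      using P[of a1 "L2 k" N2] P[of "a1 * a2" "L3 k" N3] L2_bounds[of k] L3_bounds[of k] N2 N3
      by (intro mult_mono) auto
    finally have "(real M1 powr s) ^ k \<le> real N2 * real N3 * (real N1 ^ k * real N2 ^ L2 k * real N3 ^ L3 k)"
      by (simp add: ac_simps)
    moreover have "0 < (real M1 powr s) ^ k" using M by simp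
    moreover have "0 < real N1 ^ k * real N2 ^ L2 k * real N3 ^ L3 k" using N1 N2 N3 by simp
    ultimately show ?thesis by (simp add: divide_simps power_divide ac_simps del: zero_less_power)
  qed
  finally show ?thesis .
qed

lemma hausdorff_measure_uniform_sponge:
  assumes s: "0 < s" "real M1 powr s \<le> real N1 * real N2 powr a1 * real N3 powr (a1 * a2)"
  shows "hausdorff_measure s (R ` sequences_over D) \<noteq> 0"
proof -
  have ne: "D \<noteq> {}" using uniform_card N1 N2 N3 by auto
  let ?p = "pmf_of_set D"
  let ?M = "PiM (UNIV :: nat set) (\<lambda>_. measure_pmf ?p)"
  interpret product_prob_space "\<lambda>_. measure_pmf ?p" "UNIV :: nat set" ..
  \<comment> \<open>At most 125 cubes meet a small set, \<open>N2 * N3\<close> is the rounding loss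
    of a single cube, and the power of \<open>M1\<close> comes from replacing the scale 1 / M1 ^ k
    by \<open>M1 * \<delta>\<close>.\<close>
  define C where "C = 125 * (real N2 * real N3) * real M1 powr s"
  have M1s: "1 \<le> real M1 powr s" using M s by (intro ge_one_powr_ge_zero) auto
  have N23: "1 \<le> real N2" "1 \<le> real N3" using N2 N3 by auto
  have C: "1 \<le> C"
  proof -
    have "1 * 1 \<le> real N2 * real N3" using N23 by (intro mult_mono) auto
    then have "1 * 1 * 1 \<le> 125 * (real N2 * real N3) * real M1 powr s" using M1s by (intro mult_mono) auto
    then show ?thesis by (simp add: C_def)
  qed
  show ?thesis
  proof (rule mass_distribution_principle[where M = ?M and C = C])
    show "prob_space ?M" by unfold_locales
    show "AE x in ?M. x \<in> sequences_over D"
      unfolding sequences_over_def mem_Collect_eq AE_all_countable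
    proof
      fix i :: nat
      show "AE x in ?M. x i \<in> D"
        using uniform_finite(1) ne by (intro AE_component) (auto simp: AE_measure_pmf_iff)
    qed
    fix U :: "(circle \<times> circle \<times> circle) set" and \<delta> :: real
    assume d: "0 < \<delta>" "\<delta> \<le> 1" and U: "\<And>p q. p \<in> U \<Longrightarrow> q \<in> U \<Longrightarrow> dist p q \<le> \<delta>"
    \<comment> \<open>The last generation with \<delta> \<le> 1 / M1 ^ k; then also 1 / M1 ^ k \<le>
      M1 * \<delta>.\<close>
    define k where "k = nat \<lfloor>log (real M1) (1 / \<delta>)\<rfloor>"
    have "0 \<le> log (real M1) (1 / \<delta>)" using M d by (subst zero_le_log_cancel_iff) auto
    then have k: "real k \<le> log (real M1) (1 / \<delta>)" "log (real M1) (1 / \<delta>) \<le> real k + 1"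
      unfolding k_def by (simp, linarith)
    have "real M1 powr real k \<le> 1 / \<delta>" using k(1) M d by (subst (asm) le_log_iff) auto
    then have k1: "\<delta> \<le> 1 / real M1 ^ k" using M d by (simp add: powr_realpow field_simps)
    have "1 / \<delta> \<le> real M1 powr (real k + 1)" using k(2) M d by (subst (asm) log_le_iff) auto
    then have k2: "1 / real M1 ^ k \<le> real M1 * \<delta>" using M d by (simp add: powr_add powr_realpow field_simps)
    let ?Y = "{x \<in> sequences_over D. R x \<in> U}"
    have Y: "?Y \<subseteq> sequences_over digit_box" using D_box by (auto simp: sequences_over_def)
    have "dist (R x) (R y) \<le> 1 / real M1 ^ k" if "x \<in> ?Y" "y \<in> ?Y" for x y
      using that U[of "R x" "R y"] k1 by simp
    then have card: "finite (approx_cube k ` ?Y)" "card (approx_cube k ` ?Y) \<le> 125"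
      using card_approx_cubes_le[OF Y, of k] by blast+
    let ?w = "real N2 * real N3 * (1 / real M1 powr s) ^ k"
    have w: "?w \<le> real N2 * real N3 * (real M1 powr s * \<delta> powr s)"
    proof -
      have "(1 / real M1 powr s) ^ k = (1 / real M1 ^ k) powr s"
        using M by (simp add: powr_divide power_divide powr_powr mult.commute flip: powr_realpow)
      also have "\<dots> \<le> (real M1 * \<delta>) powr s" using k2 s by (intro powr_mono2) auto
      also have "\<dots> = real M1 powr s * \<delta> powr s" using d by (simp add: powr_mult)
      finally show ?thesis by (intro mult_left_mono) auto
    qed
    let ?B = "\<Union>(approx_cube k ` ?Y)"
    have "emeasure ?M ?B \<le> (\<Sum>Q\<in>approx_cube k ` ?Y. emeasure ?M Q)"
      using emeasure_subadditive_finite[OF card(1), of "\<lambda>Q. Q" ?M] sets_approx_cube by auto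
    also have "\<dots> \<le> (\<Sum>Q\<in>approx_cube k ` ?Y. ennreal ?w)"
      using uniform_cube_weight[OF _ s] by (intro sum_mono) (auto simp: emeasure_approx_cube intro!: ennreal_leI)
    also have "\<dots> \<le> ennreal (125 * ?w)"
      using card(2) by (auto simp: ennreal_mult intro!: mult_right_mono simp flip: ennreal_of_nat_eq_real_of_nat)
    also have "\<dots> \<le> ennreal (C * \<delta> powr s)"
      using w by (intro ennreal_leI) (simp add: C_def)
    finally have "emeasure ?M ?B \<le> ennreal (C * \<delta> powr s)" .
    moreover have "?B \<in> sets ?M" using card(1) sets_approx_cube by (intro sets.finite_Union) auto
    moreover have "?Y \<subseteq> ?B" using approx_cube_self by blast
    ultimately show "\<exists>B\<in>sets ?M. ?Y \<subseteq> B \<and> emeasure ?M B \<le> ennreal (C * \<delta> powr s)" by blast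
  qed (use C s in auto)
qed

end

end


section \<open>Averaging over scales\<close>

text \<open>Telescoping: 1 / k^2 is at least 1 / k - 1 / (k + 1) and, for k > 1, at most 1 / (k - 1)
  - 1 / k.\<close>

lemma inverse_squares_sum_bounds:
  assumes "1 \<le> n" "n \<le> (m::nat)"
  shows "1 / real n - 1 / (real m + 1) \<le> (\<Sum>k=n..m. 1 / (real k)\<^sup>2)"
    and "(\<Sum>k=n..m. 1 / (real k)\<^sup>2) \<le> 1 / (real n)\<^sup>2 + 1 / real n - 1 / real m"
proof -
  have "1 / real n - 1 / (real m + 1) \<le> (\<Sum>k=n..m. 1 / (real k)\<^sup>2) \<and>
    (\<Sum>k=n..m. 1 / (real k)\<^sup>2) \<le> 1 / (real n)\<^sup>2 + 1 / real n - 1 / real m"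
    using assms(2)
  proof (induction m rule: dec_induct)
    case base
    show ?case using assms(1) by (simp add: power2_eq_square divide_simps)
  next
    case (step m)
    have m: "0 < real m" using step assms by simp
    have "1 / (real m + 1) - 1 / (real m + 2) \<le> 1 / (real m + 1)\<^sup>2"
      "1 / (real m + 1)\<^sup>2 \<le> 1 / real m - 1 / (real m + 1)"
      using m by (simp_all add: power2_eq_square divide_simps)
    moreover have "(\<Sum>k=n..Suc m. 1 / (real k)\<^sup>2) = (\<Sum>k=n..m. 1 / (real k)\<^sup>2) + 1 / (real m + 1)\<^sup>2"
      using step by (simp add: add.commute)
    ultimately show ?case using step.IH by (simp add: add.commute)
  qed
  then show "1 / real n - 1 / (real m + 1) \<le> (\<Sum>k=n..m. 1 / (real k)\<^sup>2)"
    "(\<Sum>k=n..m. 1 / (real k)\<^sup>2) \<le> 1 / (real n)\<^sup>2 + 1 / real n - 1 / real m" by auto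
qed

lemma inverse_squares_sum_le_2: "(\<Sum>j<m. 1 / (real j + 1)\<^sup>2) \<le> 2"
proof (cases m)
  case (Suc m')
  have "(\<Sum>j<m. 1 / (real j + 1)\<^sup>2) = (\<Sum>k=1..m. 1 / (real k)\<^sup>2)"
    by (intro sum.reindex_bij_witness[of _ "\<lambda>k. k - 1" Suc]) (auto simp: add.commute)
  also have "\<dots> \<le> 1 / (real 1)\<^sup>2 + 1 / real 1 - 1 / real m"
    using Suc by (intro inverse_squares_sum_bounds) auto
  also have "\<dots> \<le> 2" by simp
  finally show ?thesis .
qed simp

text \<open>This sum is the coefficient of \<open>x j\<close> once the double sum below is
  exchanged. The series of 1 / k^2 from (j + 1) / c on is about c / (j + 1), and cutting it at
  \<open>m\<close> costs at most 1 / m. If the range is empty, c / (j + 1) itself is at most 1 /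
  m.\<close>

lemma scaled_tail_sum:
  assumes c: "0 < c" "c \<le> 1" and j: "j < m"
  shows "\<bar>(\<Sum>k | k \<in> {1..m} \<and> real j + 1 \<le> c * real k. 1 / (real k)\<^sup>2) - c / (real j + 1)\<bar>
    \<le> 1 / (real j + 1)\<^sup>2 + 1 / real m"
proof (cases "real j + 1 \<le> c * real m")
  case True
  define y where "y = (real j + 1) / c"
  define n where "n = nat \<lceil>y\<rceil>"
  have "(real j + 1) * c \<le> (real j + 1) * 1" using c by (intro mult_left_mono) auto
  then have y: "real j + 1 \<le> y" using c by (simp add: y_def le_divide_eq)
  have n: "y \<le> real n" "real n < y + 1" using y unfolding n_def by linarith+
  have ym: "y \<le> real m" using True c by (simp add: y_def field_simps)
  have n1: "1 \<le> n" "n \<le> m" using y n ym by linarith+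
  have iff: "real j + 1 \<le> c * real k \<longleftrightarrow> n \<le> k" for k
  proof -
    have "real j + 1 \<le> c * real k \<longleftrightarrow> y \<le> real k" using c by (simp add: y_def field_simps)
    also have "\<dots> \<longleftrightarrow> n \<le> k" unfolding n_def using y by linarith
    finally show ?thesis .
  qed
  have "{k. k \<in> {1..m} \<and> real j + 1 \<le> c * real k} = {n..m}"
    unfolding iff using n1 by auto
  moreover have "c / (real j + 1) = 1 / y" using c by (simp add: y_def)
  moreover have "1 / real n \<le> 1 / y" using n y by (intro divide_left_mono) auto
  moreover have "1 / (real n)\<^sup>2 \<le> 1 / (real j + 1)\<^sup>2"
    using n y by (intro divide_left_mono power_mono) auto
  moreover have "1 / y - 1 / real n \<le> 1 / (real j + 1)\<^sup>2"
  proof -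
    have "1 / y - 1 / real n \<le> 1 / y - 1 / (y + 1)"
      using n y by (intro diff_left_mono divide_left_mono) auto
    also have "\<dots> \<le> 1 / y\<^sup>2" using y by (simp add: power2_eq_square divide_simps)
    also have "\<dots> \<le> 1 / (real j + 1)\<^sup>2" using y by (intro divide_left_mono power_mono) auto
    finally show ?thesis .
  qed
  moreover have "1 / (real m + 1) \<le> 1 / real m" using j by (intro divide_left_mono) auto
  moreover have "0 \<le> 1 / real m" by simp
  ultimately show ?thesis using inverse_squares_sum_bounds[OF n1] unfolding abs_le_iff by (simp only:) linarith
next
  case False
  have "\<not> real j + 1 \<le> c * real k" if "k \<le> m" for k
    using that False c mult_left_mono[of "real k" "real m" c] by linarith
  then have E: "{k. k \<in> {1..m} \<and> real j + 1 \<le> c * real k} = {}" by auto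
  have "c / (real j + 1) \<le> 1 / real m" using False j by (simp add: field_simps)
  moreover have "0 \<le> c / (real j + 1)" "0 \<le> 1 / (real j + 1)\<^sup>2" using c by simp_all
  ultimately show ?thesis unfolding E sum.empty by linarith
qed

text \<open>Exchanging the two summations shows that the sums on the left depend on \<open>c\<close> only through the
  factor \<open>c\<close>, up to a bounded error. This replaces logarithmic averaging over scales.\<close>

lemma scaled_partial_sums:
  fixes x :: "nat \<Rightarrow> real"
  assumes B: "\<And>j. \<bar>x j\<bar> \<le> B" and c: "0 < c" "c \<le> 1"
  shows "\<bar>(\<Sum>k=1..m. (\<Sum>j<nat \<lfloor>c * real k\<rfloor>. x j) / (real k)\<^sup>2) - c * (\<Sum>j<m. x j / (real j + 1))\<bar> \<le> 3 * B"
proof -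
  define h where "h j = (\<Sum>k | k \<in> {1..m} \<and> real j + 1 \<le> c * real k. 1 / (real k)\<^sup>2)" for j
  have B0: "0 \<le> B" using B[of 0] by linarith
  have "(\<Sum>k=1..m. (\<Sum>j<nat \<lfloor>c * real k\<rfloor>. x j) / (real k)\<^sup>2)
      = (\<Sum>k=1..m. \<Sum>j | j \<in> {..<m} \<and> real j + 1 \<le> c * real k. x j * (1 / (real k)\<^sup>2))"
  proof (intro sum.cong refl)
    fix k assume k: "k \<in> {1..m}"
    have "c * real k \<le> 1 * real k" using c by (intro mult_right_mono) auto
    then have "j < nat \<lfloor>c * real k\<rfloor> \<longleftrightarrow> j < m \<and> real j + 1 \<le> c * real k" for j
    proof -
      have "j < nat \<lfloor>c * real k\<rfloor> \<longleftrightarrow> real j + 1 \<le> c * real k"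
        unfolding zless_nat_eq_int_zless by linarith
      moreover have "j < m" if "real j + 1 \<le> c * real k"
        using that \<open>c * real k \<le> 1 * real k\<close> k by simp
      ultimately show ?thesis by blast
    qed
    then have "{..<nat \<lfloor>c * real k\<rfloor>} = {j. j \<in> {..<m} \<and> real j + 1 \<le> c * real k}" by auto
    then show "(\<Sum>j<nat \<lfloor>c * real k\<rfloor>. x j) / (real k)\<^sup>2 = (\<Sum>j | j \<in> {..<m} \<and> real j + 1 \<le> c * real k. x j * (1 / (real k)\<^sup>2))"
      by (simp add: sum_divide_distrib)
  qed
  also have "\<dots> = (\<Sum>j<m. \<Sum>k | k \<in> {1..m} \<and> real j + 1 \<le> c * real k. x j * (1 / (real k)\<^sup>2))"
    by (rule sum.swap_restrict) auto
  also have "\<dots> = (\<Sum>j<m. x j * h j)" by (simp add: h_def sum_distrib_left)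
  finally have "(\<Sum>k=1..m. (\<Sum>j<nat \<lfloor>c * real k\<rfloor>. x j) / (real k)\<^sup>2) - c * (\<Sum>j<m. x j / (real j + 1))
      = (\<Sum>j<m. x j * (h j - c / (real j + 1)))"
    by (simp add: sum_distrib_left right_diff_distrib sum_subtractf mult.commute)
  also have "\<bar>\<dots>\<bar> \<le> (\<Sum>j<m. B * (1 / (real j + 1)\<^sup>2 + 1 / real m))"
  proof (rule order_trans[OF sum_abs sum_mono])
    fix j assume "j \<in> {..<m}"
    then have "\<bar>h j - c / (real j + 1)\<bar> \<le> 1 / (real j + 1)\<^sup>2 + 1 / real m"
      unfolding h_def by (intro scaled_tail_sum c) auto
    then show "\<bar>x j * (h j - c / (real j + 1))\<bar> \<le> B * (1 / (real j + 1)\<^sup>2 + 1 / real m)"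
      unfolding abs_mult using B B0 by (intro mult_mono) auto
  qed
  also have "\<dots> = B * ((\<Sum>j<m. 1 / (real j + 1)\<^sup>2) + (\<Sum>j<m. 1 / real m))"
    by (simp add: sum.distrib flip: sum_distrib_left)
  also have "\<dots> \<le> B * (2 + 1)"
    using inverse_squares_sum_le_2[of m] B0 by (intro mult_left_mono add_mono) auto
  finally show ?thesis by simp
qed

lemma harmonic_tail_unbounded:
  assumes "0 < e"
  shows "\<exists>m\<ge>K. b < e * (\<Sum>k=Suc K..m. 1 / real k)"
proof (rule ccontr)
  assume "\<not> ?thesis"
  then have *: "e * (\<Sum>k=Suc K..m. 1 / real k) \<le> b" if "K \<le> m" for m using that by force
  have "summable (\<lambda>n. 1 / real (Suc (n + K)))"
  proof (rule summableI_nonneg_bounded)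
      fix n
      have "(\<Sum>i<n. 1 / real (Suc (i + K))) = (\<Sum>k=Suc K..n + K. 1 / real k)"
        by (intro sum.reindex_bij_witness[of _ "\<lambda>k. k - Suc K" "\<lambda>i. Suc (i + K)"]) auto
      also have "\<dots> \<le> b / e" using *[of "n + K"] assms by (simp add: field_simps)
      finally show "(\<Sum>i<n. 1 / real (Suc (i + K))) \<le> b / e" .
  qed simp
  then have "summable (\<lambda>n. 1 / real (Suc n))"
    using summable_iff_shift[of "\<lambda>n. 1 / real (Suc n)" K] by simp
  then have "summable (\<lambda>n. inverse (real n))"
    using summable_Suc_iff[of "\<lambda>n. inverse (real n)"] by (simp add: inverse_eq_divide)
  then show False using not_summable_harmonic[where 'a = real] by simp
qed

context torus_bases begin

text \<open>Weighting by 1 / k^2 turns the four partial sums into multiples of two common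
  logarithmic sums, with factors a1, a1, a1 * a2, a1 * a2 whose signs cancel. So the weighted sum of
  the expression is bounded below, whereas values below - e * k from \<open>K\<close> on would make
  it diverge like the harmonic series. This works for every bounded sequence, whether or not its
  averages converge.\<close>

lemma exists_good_scale:
  fixes x y :: "nat \<Rightarrow> real"
  assumes x: "\<And>j. \<bar>x j\<bar> \<le> B" and y: "\<And>j. \<bar>y j\<bar> \<le> B" and e: "0 < e"
  shows "\<exists>k\<ge>K. - e * real k \<le> a1 * (\<Sum>j<k. x j) - (\<Sum>j<L2 k. x j) + a2 * (\<Sum>j<L2 k. y j) - (\<Sum>j<L3 k. y j)"
    (is "\<exists>k\<ge>K. - e * real k \<le> ?g k")
proof (rule ccontr)
  assume "\<not> ?thesis"
  then have neg: "?g k < - e * real k" if "K \<le> k" for k using that by force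
  define W where "W c z m = (\<Sum>k=1..m. (\<Sum>j<nat \<lfloor>c * real k\<rfloor>. z j) / (real k)\<^sup>2)" for c :: real and z :: "nat \<Rightarrow> real" and m
  define H where "H z m = (\<Sum>j<m. z j / (real j + 1))" for z :: "nat \<Rightarrow> real" and m :: nat
  have B0: "0 \<le> B" using x[of 0] by linarith
  have a12: "0 < a1 * a2" "a1 * a2 \<le> 1" using a1_bounds a2_bounds by (auto simp: mult_le_one)
  have G: "(\<Sum>k=1..m. ?g k / (real k)\<^sup>2) = a1 * W 1 x m - W a1 x m + a2 * W a1 y m - W (a1 * a2) y m" for m
    unfolding W_def L2_def L3_def
    by (simp add: sum_distrib_left sum_subtractf sum.distrib add_divide_distrib diff_divide_distrib)
  \<comment> \<open>Four error terms of at most 3 * B each.\<close>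
  have low: "- (12 * B) \<le> (\<Sum>k=1..m. ?g k / (real k)\<^sup>2)" for m
  proof -
    have W: "\<bar>W c z m - c * H z m\<bar> \<le> 3 * B" if "0 < c" "c \<le> 1" "\<And>j. \<bar>z j\<bar> \<le> B" for c z
      unfolding W_def H_def by (rule scaled_partial_sums) fact+
    have "\<bar>a1 * (W 1 x m - 1 * H x m)\<bar> \<le> 1 * (3 * B)" "\<bar>a2 * (W a1 y m - a1 * H y m)\<bar> \<le> 1 * (3 * B)"
      unfolding abs_mult using a1_bounds a2_bounds x y by (intro mult_mono W; simp)+
    moreover have "\<bar>W a1 x m - a1 * H x m\<bar> \<le> 3 * B" "\<bar>W (a1 * a2) y m - a1 * a2 * H y m\<bar> \<le> 3 * B"
      using a1_bounds a12 x y by (intro W; simp)+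
    moreover have "a1 * W 1 x m - W a1 x m + a2 * W a1 y m - W (a1 * a2) y m
        = a1 * (W 1 x m - 1 * H x m) - (W a1 x m - a1 * H x m) + a2 * (W a1 y m - a1 * H y m) - (W (a1 * a2) y m - a1 * a2 * H y m)"
      by (simp add: algebra_simps)
    ultimately show ?thesis unfolding G by linarith
  qed
  obtain m where m: "K \<le> m" "(\<Sum>k=1..K. ?g k / (real k)\<^sup>2) + 12 * B < e * (\<Sum>k=Suc K..m. 1 / real k)"
    using harmonic_tail_unbounded[OF e] by blast
  have "(\<Sum>k=1..m. ?g k / (real k)\<^sup>2) = (\<Sum>k=1..K. ?g k / (real k)\<^sup>2) + (\<Sum>k=Suc K..m. ?g k / (real k)\<^sup>2)"
    using m(1) sum.ub_add_nat[of 1 K "\<lambda>k. ?g k / (real k)\<^sup>2" "m - K"] by simp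
  also have "(\<Sum>k=Suc K..m. ?g k / (real k)\<^sup>2) \<le> (\<Sum>k=Suc K..m. - (e * (1 / real k)))"
  proof (intro sum_mono)
    fix k assume "k \<in> {Suc K..m}"
    then have "?g k \<le> - e * real k" "0 < real k" using neg[of k] by auto
    then have "?g k / (real k)\<^sup>2 \<le> (- e * real k) / (real k)\<^sup>2" by (intro divide_right_mono) auto
    then show "?g k / (real k)\<^sup>2 \<le> - (e * (1 / real k))" using \<open>0 < real k\<close> by (simp add: power2_eq_square)
  qed
  also have "\<dots> = - (e * (\<Sum>k=Suc K..m. 1 / real k))" by (simp only: sum_negf sum_distrib_left)
  finally show False using m(2) low[of m] by linarith
qed

end


section \<open>General sponges: upper bound\<close>

context torus_bases begin

text \<open>A cube depends on a finite list of digits. Countability matters because covers are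
  sequences of sets.\<close>

lemma countable_approx_cubes: "countable (\<Union>k. range (approx_cube k))"
proof -
  define g where "g l = {y. \<forall>j<length l. agree (length l) j (y j) (l ! j)}" for l
  have "approx_cube k x = g (map x [0..<k])" for k x
    by (auto simp: g_def approx_cube_def)
  then have "(\<Union>k. range (approx_cube k)) \<subseteq> range g" by auto
  then show ?thesis by (rule countable_subset) simp
qed

text \<open>The cubes of the first good generation of each point are pairwise disjoint, because
  approximate cubes of different generations are nested or disjoint.\<close>

lemma hausdorff_measure_zero_if_good_cubes:
  fixes p :: "(nat \<times> nat \<times> nat) pmf"
  assumes Y: "Y \<subseteq> sequences_over digit_box" "Y \<noteq> {}" and s: "0 < s" and z: "0 < z" "z < real M1 powr s"
    and good: "\<And>x K. x \<in> Y \<Longrightarrow> \<exists>k\<ge>K. 1 / z ^ k \<le> (\<Prod>j<k. measure_pmf.prob p {d. agree k j d (x j)})"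
  shows "hausdorff_measure s (R ` Y) = 0"
proof -
  let ?M = "PiM (UNIV :: nat set) (\<lambda>_. measure_pmf p)"
  interpret product_prob_space "\<lambda>_. measure_pmf p" "UNIV :: nat set" ..
  define C where "C = (3 * real M3) powr s"
  define q where "q = z / real M1 powr s"
  have q: "0 < q" "q < 1" using z M by (auto simp: q_def)
  have C: "0 \<le> C" by (simp add: C_def)
  have bound: "hausdorff_premeasure s \<delta> (R ` Y) \<le> ennreal (C * q ^ K)" if K: "3 * real M3 / real M1 ^ K \<le> \<delta>" for \<delta> K
  proof -
    \<comment> \<open>A good cube has mass at least \<open>1 / z ^ k\<close>, and the bound
      \<open>K\<close> keeps its diameter small. Goodness depends on the cube only, not on the point
      \<open>x\<close> that names it.\<close>
    define gd where "gd k x \<longleftrightarrow> K \<le> k \<and> ennreal (1 / z ^ k) \<le> emeasure ?M (approx_cube k x)" for k x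
    define lev where "lev x = (LEAST k. gd k x)" for x
    have lev: "gd (lev x) x" if x: "x \<in> Y" for x
    proof -
      obtain k where "k \<ge> K" "1 / z ^ k \<le> (\<Prod>j<k. measure_pmf.prob p {d. agree k j d (x j)})"
        using good[OF x] by blast
      then have "gd k x" unfolding gd_def emeasure_approx_cube by (auto intro: ennreal_leI)
      then show ?thesis unfolding lev_def by (rule LeastI)
    qed
    define F where "F = (\<lambda>x. approx_cube (lev x) x) ` Y"
    have same: "approx_cube (lev x) x = approx_cube (lev y) y"
      if xy: "x \<in> Y" "y \<in> Y" "w \<in> approx_cube (lev x) x" "w \<in> approx_cube (lev y) y" "lev x \<le> lev y" for x y w
    proof -
      have "w \<in> approx_cube (lev x) y" using approx_cube_antimono[OF xy(5)] xy(4) by blast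
      then have e: "approx_cube (lev x) y = approx_cube (lev x) x"
        using approx_cube_eq xy(3) by metis
      \<comment> \<open>Both points lie in one cube of generation \<open>lev x\<close>, which is
        therefore good for \<open>y\<close> as well; minimality of \<open>lev y\<close> forces equal
        levels.\<close>
      then have "gd (lev x) y" using lev[OF xy(1)] by (simp add: gd_def)
      then have "lev y \<le> lev x" unfolding lev_def[of y] by (rule Least_le)
      then show ?thesis using xy(5) e by simp
    qed
    have disj: "disjoint F"
      unfolding disjoint_def F_def
    proof (intro ballI impI)
      fix a b assume "a \<in> (\<lambda>x. approx_cube (lev x) x) ` Y" "b \<in> (\<lambda>x. approx_cube (lev x) x) ` Y" "a \<noteq> b"
      then obtain x y where xy: "x \<in> Y" "y \<in> Y" "a = approx_cube (lev x) x" "b = approx_cube (lev y) y" by blast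
      show "a \<inter> b = {}"
      proof (rule ccontr)
        assume "a \<inter> b \<noteq> {}"
        then obtain w where "w \<in> a" "w \<in> b" by blast
        then have "a = b" using same[of x y w] same[of y x w] xy by (cases "lev x \<le> lev y") auto
        with \<open>a \<noteq> b\<close> show False by simp
      qed
    qed
    have count: "countable F"
      by (rule countable_subset[OF _ countable_approx_cubes]) (auto simp: F_def)
    have Fne: "F \<noteq> {}" using Y by (simp add: F_def)
    \<comment> \<open>An enumeration of \<open>F\<close>, padded with empty sets since
      \<open>F\<close> may be finite.\<close>
    define E where "E i = (if i \<in> to_nat_on F ` F then from_nat_into F i else {})" for i
    define U where "U i = R ` (E i \<inter> Y)" for i
    have Ein: "E i \<in> insert {} F" for i
      using from_nat_into[OF Fne] by (auto simp: E_def)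
    have Edisj: "disjoint_family E"
    proof (unfold disjoint_family_on_def, intro ballI impI)
      fix i j :: nat assume ij: "i \<noteq> j"
      show "E i \<inter> E j = {}"
      proof (cases "i \<in> to_nat_on F ` F \<and> j \<in> to_nat_on F ` F")
        case True
        then obtain a b where ab: "a \<in> F" "b \<in> F" "i = to_nat_on F a" "j = to_nat_on F b" by blast
        then have "a \<noteq> b" using ij by auto
        with ab show ?thesis using disj count by (simp add: E_def disjoint_def)
      qed (auto simp: E_def)
    qed
    have Esets: "E i \<in> sets ?M" for i
      using Ein[of i] sets_approx_cube by (auto simp: F_def)
    have cover: "R ` Y \<subseteq> (\<Union>i. U i)"
    proof (rule image_subsetI)
      fix x assume x: "x \<in> Y"
      let ?a = "approx_cube (lev x) x"
      have "?a \<in> F" using x by (simp add: F_def)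
      then have "E (to_nat_on F ?a) = ?a" using count by (simp add: E_def)
      then have "R x \<in> U (to_nat_on F ?a)" using x approx_cube_self by (auto simp: U_def)
      then show "R x \<in> (\<Union>i. U i)" by blast
    qed
    have diam: "bounded (U i) \<and> diameter (U i) \<le> \<delta> \<and> ennreal (diameter (U i) powr s) \<le> ennreal (C * q ^ K) * emeasure ?M (E i)" for i
    proof (cases "E i = {}")
      case True
      have "0 \<le> 3 * real M3 / real M1 ^ K" by simp
      with K have "0 \<le> \<delta>" by linarith
      then show ?thesis using True by (simp add: U_def)
    next
      case False
      then obtain x where x: "x \<in> Y" "E i = approx_cube (lev x) x" using Ein[of i] by (auto simp: F_def)
      let ?k = "lev x"
      have g: "K \<le> ?k" "ennreal (1 / z ^ ?k) \<le> emeasure ?M (E i)" using lev[OF x(1)] x(2) by (auto simp: gd_def)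
      have d: "dist a b \<le> 3 * real M3 / real M1 ^ ?k" if ab: "a \<in> U i" "b \<in> U i" for a b
      proof -
        obtain x' y' where xy: "x' \<in> E i \<inter> Y" "y' \<in> E i \<inter> Y" "a = R x'" "b = R y'" using ab by (auto simp: U_def)
        then have "y' \<in> approx_cube ?k x'" using approx_cube_eq[of x' ?k x] x(2) by auto
        then show ?thesis unfolding xy using xy Y by (intro dist_R_approx_cube) auto
      qed
      have b: "bounded (U i)" unfolding bounded_two_points using d by blast
      have "U i \<noteq> {}" using x approx_cube_self by (auto simp: U_def)
      then have dm: "diameter (U i) \<le> 3 * real M3 / real M1 ^ ?k"
        unfolding diameter_def using d by (auto intro!: cSUP_least)
      have "real M1 ^ K \<le> real M1 ^ ?k" using M g by (intro power_increasing) auto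
      then have "3 * real M3 / real M1 ^ ?k \<le> 3 * real M3 / real M1 ^ K"
        using M by (intro divide_left_mono) auto
      with dm K have "diameter (U i) \<le> \<delta>" by linarith
      \<comment> \<open>Since 1 / M1 powr s is q / z, the power of the diameter is at most
        \<open>C * q ^ ?k\<close> times the lower bound \<open>1 / z ^ ?k\<close> for the mass. As q
        < 1, the first factor is at most \<open>C * q ^ K\<close>, which tends to 0.\<close>
      moreover have "diameter (U i) powr s \<le> (C * q ^ K) * (1 / z ^ ?k)"
      proof -
        have "diameter (U i) powr s \<le> (3 * real M3 / real M1 ^ ?k) powr s"
          using dm s diameter_ge_0[OF b] by (intro powr_mono2) auto
        also have "\<dots> = C * q ^ ?k * (1 / z ^ ?k)"
          using z M by (simp add: C_def q_def powr_divide power_divide powr_powr mult.commute flip: powr_realpow)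
        also have "\<dots> \<le> C * q ^ K * (1 / z ^ ?k)"
          using q C g z by (intro mult_right_mono mult_left_mono power_decreasing) auto
        finally show ?thesis .
      qed
      then have "ennreal (diameter (U i) powr s) \<le> ennreal (C * q ^ K) * ennreal (1 / z ^ ?k)"
        using C q z by (subst ennreal_mult[symmetric]) (auto intro: ennreal_leI)
      then have "ennreal (diameter (U i) powr s) \<le> ennreal (C * q ^ K) * emeasure ?M (E i)"
        using g(2) by (rule order_trans[OF _ mult_left_mono]) auto
      ultimately show ?thesis using b by blast
    qed
    have "hausdorff_premeasure s \<delta> (R ` Y) \<le> (\<Sum>i. ennreal (diameter (U i) powr s))"
      unfolding hausdorff_premeasure_def using cover diam by (intro Inf_lower) auto
    also have "\<dots> \<le> (\<Sum>i. ennreal (C * q ^ K) * emeasure ?M (E i))"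
      using diam by (intro suminf_le) auto
    also have "\<dots> = ennreal (C * q ^ K) * emeasure ?M (\<Union>i. E i)"
      using Esets Edisj by (subst suminf_emeasure[symmetric]) auto
    also have "\<dots> \<le> ennreal (C * q ^ K) * 1"
      by (intro mult_left_mono emeasure_le_1) auto
    finally show ?thesis by simp
  qed
  have "hausdorff_premeasure s \<delta> (R ` Y) = 0" if d: "0 < \<delta>" for \<delta>
  proof -
    have "(\<lambda>K. 3 * real M3 * (1 / real M1) ^ K) \<longlonglongrightarrow> 3 * real M3 * 0"
      using M by (intro tendsto_mult tendsto_const LIMSEQ_power_zero) auto
    then have "eventually (\<lambda>K. 3 * real M3 * (1 / real M1) ^ K < \<delta>) sequentially"
      using d by (auto dest: order_tendstoD(2))
    then have ev: "eventually (\<lambda>K. hausdorff_premeasure s \<delta> (R ` Y) \<le> ennreal (C * q ^ K)) sequentially"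
      by eventually_elim (rule bound, simp add: power_divide)
    have "(\<lambda>K. ennreal (C * q ^ K)) \<longlonglongrightarrow> ennreal (C * 0)"
      using q by (intro tendsto_ennrealI tendsto_mult tendsto_const LIMSEQ_power_zero) auto
    from tendsto_lowerbound[OF this ev] show ?thesis by simp
  qed
  then show ?thesis unfolding hausdorff_measure_def by (auto intro!: antisym SUP_least)
qed

section \<open>Weights of a general sponge and its optimal Bernoulli measure\<close>

definition fibre_count :: "(nat \<times> nat \<times> nat) set \<Rightarrow> nat \<Rightarrow> nat \<Rightarrow> nat" where
  "fibre_count D s t = card {k. (s, t, k) \<in> D}"

definition fibre_weight :: "(nat \<times> nat \<times> nat) set \<Rightarrow> nat \<Rightarrow> real" where
  "fibre_weight D s = (\<Sum>t<M2. real (fibre_count D s t) powr a2)"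

text \<open>By Kenyon and Peres, the base \<open>M1\<close> logarithm of this number is the
  dimension of the sponge. The upper bound below attains it; the lower bound reaches it up to the
  factor \<open>class_loss\<close>.\<close>

definition digit_weight :: "(nat \<times> nat \<times> nat) set \<Rightarrow> real" where
  "digit_weight D = (\<Sum>s<M1. fibre_weight D s powr a1)"

context
  fixes D :: "(nat \<times> nat \<times> nat) set"
  assumes D_box: "D \<subseteq> digit_box" and D_ne: "D \<noteq> {}"
begin

lemma finite_D: "finite D"
  using D_box by (auto simp: digit_box_def intro: finite_subset)

lemma finite_fibre: "finite {k. (s, t, k) \<in> D}"
  by (rule finite_subset[of _ "(snd \<circ> snd) ` D"]) (use finite_D in \<open>force+\<close>)

lemma fibre_count_pos: "(s, t, k) \<in> D \<Longrightarrow> 0 < fibre_count D s t"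
  using finite_fibre by (auto simp: fibre_count_def card_gt_0_iff)

lemma fibre_weight_nonneg: "0 \<le> fibre_weight D s"
  unfolding fibre_weight_def by (intro sum_nonneg) auto

lemma fibre_weight_pos:
  assumes "(s, t, k) \<in> D" shows "0 < fibre_weight D s"
  unfolding fibre_weight_def
  using fibre_count_pos[OF assms] assms D_box by (intro sum_pos2[of _ t]) (auto simp: digit_box_def)

lemma digit_weight_pos: "0 < digit_weight D"
proof -
  obtain s t k where d: "(s, t, k) \<in> D" using D_ne by auto
  then show ?thesis unfolding digit_weight_def
    using fibre_weight_pos[OF d] D_box by (intro sum_pos2[of _ s]) (auto simp: digit_box_def)
qed

text \<open>The measure of maximal dimension, as three successive choices: \<open>s\<close> with
  weight \<open>fibre_weight D s powr a1\<close>, then \<open>t\<close> with weight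
  \<open>fibre_count D s t powr a2\<close>, then \<open>k\<close> uniformly in the fibre.\<close>

definition mcmullen :: "nat \<times> nat \<times> nat \<Rightarrow> real" where
  "mcmullen d = (if d \<in> D then case d of (s, t, k) \<Rightarrow>
     fibre_weight D s powr a1 / digit_weight D * (real (fibre_count D s t) powr a2 / fibre_weight D s)
       * (1 / real (fibre_count D s t)) else 0)"

lemma mcmullen_nonneg: "0 \<le> mcmullen d"
  using digit_weight_pos fibre_weight_nonneg by (auto simp: mcmullen_def split: prod.split)

lemma sum_mcmullen_fibre:
  "(\<Sum>k | (s, t, k) \<in> D. mcmullen (s, t, k))
    = fibre_weight D s powr a1 / digit_weight D * (real (fibre_count D s t) powr a2 / fibre_weight D s)"
proof (cases "fibre_count D s t = 0")
  \<comment> \<open>Empty fibre: 0 powr a2 is 0, so both sides vanish.\<close>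
  case True
  then have "{k. (s, t, k) \<in> D} = {}" using finite_fibre by (auto simp: fibre_count_def)
  then show ?thesis using True by simp
next
  case False
  have "(\<Sum>k | (s, t, k) \<in> D. mcmullen (s, t, k)) = (\<Sum>k | (s, t, k) \<in> D.
     fibre_weight D s powr a1 / digit_weight D * (real (fibre_count D s t) powr a2 / fibre_weight D s)
       * (1 / real (fibre_count D s t)))"
    by (intro sum.cong) (auto simp: mcmullen_def)
  also have "\<dots> = fibre_weight D s powr a1 / digit_weight D * (real (fibre_count D s t) powr a2 / fibre_weight D s)"
    using False by (simp flip: fibre_count_def)
  finally show ?thesis .
qed

lemma sum_mcmullen_column:
  "(\<Sum>t<M2. \<Sum>k | (s, t, k) \<in> D. mcmullen (s, t, k)) = fibre_weight D s powr a1 / digit_weight D"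
proof (cases "fibre_weight D s = 0")
  case False
  have "(\<Sum>t<M2. \<Sum>k | (s, t, k) \<in> D. mcmullen (s, t, k))
      = fibre_weight D s powr a1 / digit_weight D * (fibre_weight D s / fibre_weight D s)"
    unfolding sum_mcmullen_fibre fibre_weight_def[of D s] sum_distrib_left sum_divide_distrib ..
  then show ?thesis using False by simp
qed (simp add: sum_mcmullen_fibre)

lemma D_Sigma: "D = (SIGMA s:{..<M1}. SIGMA t:{..<M2}. {k. (s, t, k) \<in> D})"
  using D_box by (auto simp: digit_box_def)

lemma sum_mcmullen: "(\<Sum>d\<in>D. mcmullen d) = 1"
proof -
  have "(\<Sum>d\<in>D. mcmullen d) = (\<Sum>s<M1. \<Sum>t<M2. \<Sum>k | (s, t, k) \<in> D. mcmullen (s, t, k))"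
    by (subst D_Sigma) (use finite_fibre in \<open>simp add: sum.Sigma finite_SigmaI split_def\<close>)
  also have "\<dots> = digit_weight D / digit_weight D"
    unfolding sum_mcmullen_column sum_divide_distrib[symmetric] digit_weight_def[symmetric] ..
  finally show ?thesis using digit_weight_pos by simp
qed

definition mcmullen_pmf :: "(nat \<times> nat \<times> nat) pmf" where
  "mcmullen_pmf = embed_pmf mcmullen"

lemma pmf_mcmullen: "pmf mcmullen_pmf d = mcmullen d"
proof -
  have "(\<integral>\<^sup>+d. ennreal (mcmullen d) \<partial>count_space UNIV) = (\<Sum>d\<in>D. ennreal (mcmullen d))"
    using finite_D by (intro nn_integral_count_space') (auto simp: mcmullen_def)
  also have "\<dots> = 1" using sum_mcmullen mcmullen_nonneg by (simp add: sum_ennreal)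
  finally show ?thesis unfolding mcmullen_pmf_def using mcmullen_nonneg by (intro pmf_embed_pmf) auto
qed

lemma prob_mcmullen_ge:
  assumes "finite A" "A \<subseteq> B"
  shows "(\<Sum>d\<in>A. mcmullen d) \<le> measure_pmf.prob mcmullen_pmf B"
  using assms by (simp add: measure_measure_pmf_finite pmf_mcmullen[symmetric] measure_pmf.finite_measure_mono flip: measure_measure_pmf_finite)

text \<open>Agreement leaves later components of the digit free, and summing them out removes the
  last factors of \<open>mcmullen\<close>: all three factors remain below \<open>L3 k\<close>, two
  up to \<open>L2 k\<close>, one beyond. The estimate is from below, as the covering cubes must be
  heavy.\<close>

lemma prob_agree_ge:
  assumes "(s, t, i) \<in> D"
  shows "fibre_weight D s powr a1 / digit_weight D
    * (if j < L2 k then real (fibre_count D s t) powr a2 / fibre_weight D s else 1)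
    * (if j < L3 k then 1 / real (fibre_count D s t) else 1)
    \<le> measure_pmf.prob mcmullen_pmf {d. agree k j d (s, t, i)}"
proof -
  consider "j < L3 k" "j < L2 k" | "\<not> j < L3 k" "j < L2 k" | "\<not> j < L3 k" "\<not> j < L2 k"
    using L3_le_L2[of k] by linarith
  then show ?thesis
  proof cases
    case 1
    then show ?thesis using prob_mcmullen_ge[of "{(s, t, i)}" "{d. agree k j d (s, t, i)}"] assms
      by (simp add: mcmullen_def agree_def)
  next
    case 2
    have "(\<Sum>d\<in>(\<lambda>k. (s, t, k)) ` {k. (s, t, k) \<in> D}. mcmullen d) \<le> measure_pmf.prob mcmullen_pmf {d. agree k j d (s, t, i)}"
      using 2 finite_fibre by (intro prob_mcmullen_ge) (auto simp: agree_def)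
    also have "(\<Sum>d\<in>(\<lambda>k. (s, t, k)) ` {k. (s, t, k) \<in> D}. mcmullen d) = (\<Sum>k | (s, t, k) \<in> D. mcmullen (s, t, k))"
      by (subst sum.reindex) (auto simp: inj_on_def)
    finally show ?thesis using 2 by (simp add: sum_mcmullen_fibre)
  next
    case 3
    let ?A = "SIGMA t:{..<M2}. {k. (s, t, k) \<in> D}"
    have "(\<Sum>d\<in>Pair s ` ?A. mcmullen d) \<le> measure_pmf.prob mcmullen_pmf {d. agree k j d (s, t, i)}"
      using 3 finite_fibre by (intro prob_mcmullen_ge) (auto simp: agree_def)
    also have "(\<Sum>d\<in>Pair s ` ?A. mcmullen d) = (\<Sum>t<M2. \<Sum>k | (s, t, k) \<in> D. mcmullen (s, t, k))"
      using finite_fibre by (subst sum.reindex) (auto simp: inj_on_def sum.Sigma split_def)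
    finally show ?thesis using 3 by (simp add: sum_mcmullen_column)
  qed
qed

lemma hausdorff_measure_sponge_eq_0:
  assumes s: "0 < s" "digit_weight D < real M1 powr s"
  shows "hausdorff_measure s (R ` sequences_over D) = 0"
proof -
  \<comment> \<open>Half the logarithmic gap, which makes \<open>z\<close> the geometric mean of
    \<open>digit_weight D\<close> and \<open>M1 powr s\<close>.\<close>
  define e where "e = ln (real M1 powr s / digit_weight D) / 2"
  have "1 < real M1 powr s / digit_weight D" using s digit_weight_pos by simp
  then have e: "0 < e" by (simp add: e_def)
  define z where "z = digit_weight D * exp e"
  have "e < ln (real M1 powr s / digit_weight D)" using e by (simp add: e_def)
  then have "exp e < real M1 powr s / digit_weight D"
  proof -
    assume "e < ln (real M1 powr s / digit_weight D)"
    then have "exp e < exp (ln (real M1 powr s / digit_weight D))" by (simp only: exp_less_cancel_iff)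
    moreover have "0 < real M1 powr s / digit_weight D"
      using \<open>1 < real M1 powr s / digit_weight D\<close> by linarith
    ultimately show ?thesis by (simp only: exp_ln)
  qed
  then have z: "0 < z" "z < real M1 powr s" using digit_weight_pos by (auto simp: z_def field_simps)
  obtain d0 where d0: "d0 \<in> D" using D_ne by blast
  define B where "B = (\<Sum>s<M1. \<bar>ln (fibre_weight D s)\<bar>) + (\<Sum>(s, t)\<in>{..<M1} \<times> {..<M2}. \<bar>ln (real (fibre_count D s t))\<bar>)"
  show ?thesis
  proof (rule hausdorff_measure_zero_if_good_cubes[where p = mcmullen_pmf and z = z])
    show "sequences_over D \<subseteq> sequences_over digit_box" using D_box by (auto simp: sequences_over_def)
    show "sequences_over D \<noteq> {}" using d0 by (auto simp: sequences_over_def)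
    fix w K assume w: "w \<in> sequences_over D"
    \<comment> \<open>In terms of \<open>x\<close> and \<open>y\<close>, the logarithm of the mass
      of a cube is at least the expression of \<open>exists_good_scale\<close> minus
      \<open>k * ln (digit_weight D)\<close>.\<close>
    define x where "x j = ln (fibre_weight D (fst (w j)))" for j
    define y where "y j = ln (real (fibre_count D (fst (w j)) (fst (snd (w j)))))" for j
    have wD: "(fst (w j), fst (snd (w j)), snd (snd (w j))) \<in> D" for j
      using w by (auto simp: sequences_over_def)
    have wb: "fst (w j) < M1" "fst (snd (w j)) < M2" for j using wD[of j] D_box by (auto simp: digit_box_def)
    have xB: "\<bar>x j\<bar> \<le> B" for j
    proof -
      have "\<bar>x j\<bar> \<le> (\<Sum>s<M1. \<bar>ln (fibre_weight D s)\<bar>)"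
        unfolding x_def by (rule member_le_sum) (use wb in auto)
      moreover have "0 \<le> (\<Sum>(s, t)\<in>{..<M1} \<times> {..<M2}. \<bar>ln (real (fibre_count D s t))\<bar>)"
        by (intro sum_nonneg) auto
      ultimately show ?thesis unfolding B_def by linarith
    qed
    have yB: "\<bar>y j\<bar> \<le> B" for j
    proof -
      have "\<bar>y j\<bar> \<le> (\<Sum>(s, t)\<in>{..<M1} \<times> {..<M2}. \<bar>ln (real (fibre_count D s t))\<bar>)"
        unfolding y_def using member_le_sum[of "(fst (w j), fst (snd (w j)))" "{..<M1} \<times> {..<M2}"
            "\<lambda>(s, t). \<bar>ln (real (fibre_count D s t))\<bar>"] wb by auto
      moreover have "0 \<le> (\<Sum>s<M1. \<bar>ln (fibre_weight D s)\<bar>)" by (intro sum_nonneg) auto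
      ultimately show ?thesis unfolding B_def by linarith
    qed
    obtain k where k: "K \<le> k"
      "- e * real k \<le> a1 * (\<Sum>j<k. x j) - (\<Sum>j<L2 k. x j) + a2 * (\<Sum>j<L2 k. y j) - (\<Sum>j<L3 k. y j)"
      using exists_good_scale[of x B y e, OF xB yB e] by blast
    have if_sum: "(\<Sum>j<k. if j < L then f j else 0) = (\<Sum>j<L. f j)" if "L \<le> k" for L and f :: "nat \<Rightarrow> real"
    proof -
      have "(\<Sum>j<k. if j < L then f j else 0) = (\<Sum>j\<in>{..<k} \<inter> {j. j < L}. f j)"
        by (simp add: sum.inter_filter[symmetric] Int_def)
      also have "{..<k} \<inter> {j. j < L} = {..<L}" using that by auto
      finally show ?thesis .
    qed
    have "1 / z ^ k = exp (- e * real k - real k * ln (digit_weight D))"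
    proof -
      have "z = exp (e + ln (digit_weight D))" using digit_weight_pos by (simp add: z_def exp_add)
      then have "1 / z ^ k = exp (- (real k * (e + ln (digit_weight D))))"
        by (simp add: exp_of_nat_mult exp_minus inverse_eq_divide)
      then show ?thesis by (simp add: algebra_simps)
    qed
    also have "\<dots> \<le> exp (a1 * (\<Sum>j<k. x j) - (\<Sum>j<L2 k. x j) + a2 * (\<Sum>j<L2 k. y j) - (\<Sum>j<L3 k. y j) - real k * ln (digit_weight D))"
      using k(2) by simp
    also have "\<dots> = exp (\<Sum>j<k. a1 * x j - ln (digit_weight D) + (if j < L2 k then a2 * y j - x j else 0) + (if j < L3 k then - y j else 0))"
      using L2_le[of k] L3_le_L2[of k] by (simp add: sum.distrib sum_subtractf if_sum sum_distrib_left sum_negf)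
    also have "\<dots> = (\<Prod>j<k. exp (a1 * x j - ln (digit_weight D) + (if j < L2 k then a2 * y j - x j else 0) + (if j < L3 k then - y j else 0)))"
      by (simp add: exp_sum)
    also have "\<dots> \<le> (\<Prod>j<k. measure_pmf.prob mcmullen_pmf {d. agree k j d (w j)})"
    proof (intro prod_mono conjI)
      fix j
      have pos: "0 < fibre_weight D (fst (w j))" "0 < fibre_count D (fst (w j)) (fst (snd (w j)))"
        using fibre_weight_pos[OF wD] fibre_count_pos[OF wD] by auto
      have "exp (a1 * x j - ln (digit_weight D) + (if j < L2 k then a2 * y j - x j else 0) + (if j < L3 k then - y j else 0))
        = fibre_weight D (fst (w j)) powr a1 / digit_weight D
        * (if j < L2 k then real (fibre_count D (fst (w j)) (fst (snd (w j)))) powr a2 / fibre_weight D (fst (w j)) else 1)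
        * (if j < L3 k then 1 / real (fibre_count D (fst (w j)) (fst (snd (w j)))) else 1)"
        using pos digit_weight_pos by (simp add: exp_add exp_diff x_def y_def powr_def exp_minus inverse_eq_divide)
      also have "\<dots> \<le> measure_pmf.prob mcmullen_pmf {d. agree k j d (w j)}"
        using prob_agree_ge[OF wD[of j], of j k] by simp
      finally show "exp (a1 * x j - ln (digit_weight D) + (if j < L2 k then a2 * y j - x j else 0) + (if j < L3 k then - y j else 0))
        \<le> measure_pmf.prob mcmullen_pmf {d. agree k j d (w j)}" .
    qed simp
    finally show "\<exists>k\<ge>K. 1 / z ^ k \<le> (\<Prod>j<k. measure_pmf.prob mcmullen_pmf {d. agree k j d (w j)})"
      using k(1) by blast
  qed (use s z in auto)
qed

end

end


section \<open>General sponges: lower bound\<close>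

definition lg :: "nat \<Rightarrow> nat" where "lg n = nat \<lfloor>log 2 (real n)\<rfloor>"

lemma
  assumes "1 \<le> n"
  shows lg_le: "2 ^ lg n \<le> n" and lg_less: "n < 2 * 2 ^ lg n"
proof -
  have "0 \<le> log 2 (real n)" using assms by simp
  then have l: "real (lg n) \<le> log 2 (real n)" "log 2 (real n) < real (lg n) + 1"
    unfolding lg_def by linarith+
  have "2 powr real (lg n) \<le> real n" using l(1) assms by (subst (asm) le_log_iff) auto
  then have "real (2 ^ lg n) \<le> real n" by (simp add: powr_realpow)
  then show "2 ^ lg n \<le> n" by (simp only: of_nat_le_iff)
  have "real n < 2 powr (real (lg n) + 1)" using l(2) assms by (subst (asm) log_less_iff) auto
  then have "real n < real (2 * 2 ^ lg n)" by (simp add: powr_add powr_realpow)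
  then show "n < 2 * 2 ^ lg n" by (simp only: of_nat_less_iff)
qed

lemma lg_mono: "1 \<le> n \<Longrightarrow> n \<le> m \<Longrightarrow> lg n \<le> lg m"
  unfolding lg_def by (intro nat_mono floor_mono) auto

lemma pigeonhole_sum:
  fixes f :: "'a \<Rightarrow> real"
  assumes "finite S" "finite I" "I \<noteq> {}" "g ` S \<subseteq> I"
  shows "\<exists>i\<in>I. sum f S \<le> real (card I) * (\<Sum>x | x \<in> S \<and> g x = i. f x)"
proof -
  let ?h = "\<lambda>i. \<Sum>x | x \<in> S \<and> g x = i. f x"
  have m: "Max (?h ` I) \<in> ?h ` I" using assms by (intro Max_in) auto
  then obtain i where i: "i \<in> I" "Max (?h ` I) = ?h i" by auto
  have "sum f S = sum ?h I" by (rule sum.group[symmetric]) (use assms in auto)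
  also have "\<dots> \<le> real (card I) * ?h i"
  proof (rule sum_bounded_above)
    fix x assume "x \<in> I"
    then show "?h x \<le> ?h i" unfolding i(2)[symmetric] using assms(2) by (intro Max_ge) auto
  qed
  finally show ?thesis using i(1) by blast
qed

context torus_bases begin

text \<open>Two factors 2 come from rounding the fibre sizes and the column sizes to powers of 2.
  One factor \<open>lg M3 + 1\<close> is the number of dyadic classes within a column, and
  \<open>(lg M3 + 1) * (lg M2 + 1)\<close> is the number of classes of columns.\<close>

definition class_loss :: real where
  "class_loss = 4 * (real (lg M3) + 1)\<^sup>2 * (real (lg M2) + 1)"

text \<open>In each column a heaviest dyadic class of fibres is kept, and among the columns a
  heaviest class with common exponents \<open>i\<close> and \<open>j\<close>. Trimming to exactly 2
  ^ i and 2 ^ j elements gives a subsponge with uniform fibres, whose measure bounds that of the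
  whole sponge from below.\<close>

lemma hausdorff_measure_sponge_ne_0:
  assumes D: "D \<subseteq> digit_box" "D \<noteq> {}"
    and s: "0 < \<sigma>" "class_loss * real M1 powr \<sigma> \<le> digit_weight D"
  shows "hausdorff_measure \<sigma> (R ` sequences_over D) \<noteq> 0"
proof -
  let ?n = "fibre_count D" and ?z = "fibre_weight D"
  have a01: "x powr a \<le> x" if "1 \<le> x" "a \<le> 1" for x a :: real
    using powr_mono[of a 1 x] that by simp
  have n_le: "?n s t \<le> M3" for s t
    unfolding fibre_count_def using D card_mono[of "{..<M3}" "{k. (s, t, k) \<in> D}"]
    by (force simp: digit_box_def)
  have "\<exists>i\<in>{..lg M3}. ?z s \<le> (real (lg M3) + 1) * (\<Sum>t | t \<in> {t. t < M2 \<and> 1 \<le> ?n s t} \<and> lg (?n s t) = i. real (?n s t) powr a2)" for s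
  proof -
    have "?z s = (\<Sum>t | t < M2 \<and> 1 \<le> ?n s t. real (?n s t) powr a2)"
      unfolding fibre_weight_def by (intro sum.mono_neutral_right) (auto simp: not_le)
    moreover have "\<exists>i\<in>{..lg M3}. (\<Sum>t | t < M2 \<and> 1 \<le> ?n s t. real (?n s t) powr a2)
      \<le> real (card {..lg M3}) * (\<Sum>t | t \<in> {t. t < M2 \<and> 1 \<le> ?n s t} \<and> lg (?n s t) = i. real (?n s t) powr a2)"
      using n_le by (intro pigeonhole_sum) (auto intro!: lg_mono)
    ultimately show ?thesis by (simp add: add.commute)
  qed
  then have "\<forall>s. \<exists>i. i \<le> lg M3 \<and> ?z s \<le> (real (lg M3) + 1) * (\<Sum>t | t \<in> {t. t < M2 \<and> 1 \<le> ?n s t} \<and> lg (?n s t) = i. real (?n s t) powr a2)"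
    unfolding atMost_iff Bex_def by blast
  from choice[OF this] obtain ci where ci: "\<And>s. ci s \<le> lg M3"
    "\<And>s. ?z s \<le> (real (lg M3) + 1) * (\<Sum>t | t \<in> {t. t < M2 \<and> 1 \<le> ?n s t} \<and> lg (?n s t) = ci s. real (?n s t) powr a2)"
    by blast
  define T where "T s = {t. t \<in> {t. t < M2 \<and> 1 \<le> ?n s t} \<and> lg (?n s t) = ci s}" for s
  have Tfin: "finite (T s)" "card (T s) \<le> M2" for s
    using card_mono[of "{..<M2}" "T s"] by (auto simp: T_def)
  define S0 where "S0 = {s. s < M1 \<and> 0 < ?z s}"
  have z1: "?z s \<le> (real (lg M3) + 1) * (real (card (T s)) * (2 * (2 ^ ci s) powr a2))" for s
  proof -
    have "(\<Sum>t\<in>T s. real (?n s t) powr a2) \<le> (\<Sum>t\<in>T s. 2 * (2 ^ ci s) powr a2)"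
    proof (intro sum_mono)
      fix t assume t: "t \<in> T s"
      then have "?n s t < 2 * 2 ^ ci s" using lg_less[of "?n s t"] by (auto simp: T_def)
      then have "real (?n s t) \<le> real (2 * 2 ^ ci s)" by (simp only: of_nat_le_iff)
      then have "real (?n s t) powr a2 \<le> (2 * 2 ^ ci s) powr a2" using a2_bounds by (intro powr_mono2) auto
      also have "\<dots> = 2 powr a2 * (2 ^ ci s) powr a2" by (simp add: powr_mult)
      also have "\<dots> \<le> 2 * (2 ^ ci s) powr a2" using a01[of 2 a2] a2_bounds by (intro mult_right_mono) auto
      finally show "real (?n s t) powr a2 \<le> 2 * (2 ^ ci s) powr a2" .
    qed
    then have "(\<Sum>t\<in>T s. real (?n s t) powr a2) \<le> real (card (T s)) * (2 * (2 ^ ci s) powr a2)" by simp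
    then have "(real (lg M3) + 1) * (\<Sum>t\<in>T s. real (?n s t) powr a2)
      \<le> (real (lg M3) + 1) * (real (card (T s)) * (2 * (2 ^ ci s) powr a2))" by (intro mult_left_mono) auto
    then show ?thesis using ci(2)[of s] unfolding T_def[symmetric] by linarith
  qed
  have T1: "1 \<le> card (T s)" if "s \<in> S0" for s
    using z1[of s] that by (cases "card (T s)") (auto simp: S0_def)
  define cj where "cj s = lg (card (T s))" for s
  have z2: "?z s powr a1 \<le> 4 * (real (lg M3) + 1) * (real (2 ^ cj s) powr a1 * real (2 ^ ci s) powr (a1 * a2))"
    if s: "s \<in> S0" for s
  proof -
    have "card (T s) < 2 * 2 ^ cj s" unfolding cj_def using T1[OF s] by (rule lg_less)
    then have "real (card (T s)) \<le> real (2 * 2 ^ cj s)" by (simp only: of_nat_le_iff)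
    then have "(real (lg M3) + 1) * (real (card (T s)) * (2 * (2 ^ ci s) powr a2))
        \<le> (real (lg M3) + 1) * (real (2 * 2 ^ cj s) * (2 * (2 ^ ci s) powr a2))"
      by (intro mult_left_mono mult_right_mono) auto
    also have "\<dots> = (4 * (real (lg M3) + 1)) * (2 ^ cj s * (2 ^ ci s) powr a2)" by simp
    finally have "?z s \<le> (4 * (real (lg M3) + 1)) * (2 ^ cj s * (2 ^ ci s) powr a2)"
      using z1[of s] by linarith
    then have "?z s powr a1 \<le> ((4 * (real (lg M3) + 1)) * (2 ^ cj s * (2 ^ ci s) powr a2)) powr a1"
      using a1_bounds s by (intro powr_mono2) (auto simp: S0_def)
    also have "\<dots> = (4 * (real (lg M3) + 1)) powr a1 * ((2 ^ cj s) powr a1 * (2 ^ ci s) powr (a1 * a2))"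
      by (simp add: powr_mult powr_powr mult.commute)
    also have "\<dots> \<le> (4 * (real (lg M3) + 1)) * ((2 ^ cj s) powr a1 * (2 ^ ci s) powr (a1 * a2))"
      using a1_bounds by (intro mult_right_mono a01) auto
    finally show ?thesis by simp
  qed
  have "digit_weight D = (\<Sum>s\<in>S0. ?z s powr a1)"
    unfolding digit_weight_def S0_def using fibre_weight_nonneg[OF D]
    by (intro sum.mono_neutral_right) (auto simp: less_le)
  moreover have "\<exists>ij\<in>{..lg M3} \<times> {..lg M2}. (\<Sum>s\<in>S0. ?z s powr a1) \<le> real (card ({..lg M3} \<times> {..lg M2})) *
      (\<Sum>s | s \<in> S0 \<and> (ci s, cj s) = ij. ?z s powr a1)"
    using ci(1) T1 Tfin by (intro pigeonhole_sum) (auto simp: S0_def cj_def intro!: lg_mono)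
  ultimately obtain i j where ij:
    "digit_weight D \<le> real ((lg M3 + 1) * (lg M2 + 1)) * (\<Sum>s | s \<in> S0 \<and> (ci s, cj s) = (i, j). ?z s powr a1)"
    by (auto simp: card_cartesian_product)
  define S where "S = {s. s \<in> S0 \<and> (ci s, cj s) = (i, j)}"
  let ?b = "real (2 ^ j) powr a1 * real (2 ^ i) powr (a1 * a2)"
  have "(\<Sum>s\<in>S. ?z s powr a1) \<le> (\<Sum>s\<in>S. 4 * (real (lg M3) + 1) * ?b)"
    using z2 by (intro sum_mono) (auto simp: S_def)
  then have "digit_weight D \<le> real ((lg M3 + 1) * (lg M2 + 1)) * (\<Sum>s\<in>S. 4 * (real (lg M3) + 1) * ?b)"
    by (intro order_trans[OF ij[folded S_def]] mult_left_mono) auto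
  also have "\<dots> = class_loss * (real (card S) * ?b)"
    by (simp add: class_loss_def power2_eq_square algebra_simps)
  finally have dw: "digit_weight D \<le> class_loss * (real (card S) * ?b)" .
  have cl: "0 < class_loss" unfolding class_loss_def by (intro mult_pos_pos) auto
  have "class_loss * real M1 powr \<sigma> \<le> class_loss * (real (card S) * ?b)" using dw s(2) by linarith
  then have s': "real M1 powr \<sigma> \<le> real (card S) * real (2 ^ j) powr a1 * real (2 ^ i) powr (a1 * a2)"
    using cl by simp
  have "0 < digit_weight D" using D by (rule digit_weight_pos)
  with dw have S_pos: "0 < card S" by (cases "card S") auto
  \<comment> \<open>Because \<open>lg\<close> rounds down, every class contains at least the power
    of 2 that is to be selected from it.\<close>
  have Sprop: "s < M1" "2 ^ j \<le> card (T s)" "t \<in> T s \<Longrightarrow> 2 ^ i \<le> ?n s t" if "s \<in> S" for s t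
  proof -
    have s: "s \<in> S0" "ci s = i" "cj s = j" using that by (auto simp: S_def)
    show "s < M1" using s(1) by (simp add: S0_def)
    show "2 ^ j \<le> card (T s)" using lg_le[OF T1[OF s(1)]] s(3) by (simp add: cj_def)
    show "2 ^ i \<le> ?n s t" if "t \<in> T s" using lg_le[of "?n s t"] that s(2) by (simp add: T_def)
  qed
  have "\<exists>X. s \<in> S \<longrightarrow> X \<subseteq> T s \<and> card X = 2 ^ j" for s
  proof (cases "s \<in> S")
    case True
    obtain X where "X \<subseteq> T s" "card X = 2 ^ j"
      by (rule obtain_subset_with_card_n[OF Sprop(2)[OF True]])
    then show ?thesis by (intro exI[of _ X]) simp
  qed simp
  then have "\<forall>s. \<exists>X. s \<in> S \<longrightarrow> X \<subseteq> T s \<and> card X = 2 ^ j" ..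
  from choice[OF this] obtain T' where T': "\<And>s. s \<in> S \<Longrightarrow> T' s \<subseteq> T s" "\<And>s. s \<in> S \<Longrightarrow> card (T' s) = 2 ^ j"
    by blast
  have "\<exists>X. s \<in> S \<and> t \<in> T s \<longrightarrow> X \<subseteq> {k. (s, t, k) \<in> D} \<and> card X = 2 ^ i" for s t
  proof (cases "s \<in> S \<and> t \<in> T s")
    case True
    then have "2 ^ i \<le> card {k. (s, t, k) \<in> D}" using Sprop(3)[of s t] by (simp add: fibre_count_def)
    then obtain X where "X \<subseteq> {k. (s, t, k) \<in> D}" "card X = 2 ^ i"
      by (rule obtain_subset_with_card_n)
    then show ?thesis by (intro exI[of _ X]) simp
  next
    case False
    then show ?thesis by (intro exI[of _ "{}"]) simp
  qed
  then have "\<forall>s t. \<exists>X. s \<in> S \<and> t \<in> T s \<longrightarrow> X \<subseteq> {k. (s, t, k) \<in> D} \<and> card X = 2 ^ i" by iprover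
  then have "\<exists>K. \<forall>s t. s \<in> S \<and> t \<in> T s \<longrightarrow> K s t \<subseteq> {k. (s, t, k) \<in> D} \<and> card (K s t) = 2 ^ i"
    unfolding choice_iff .
  then obtain K where K: "\<And>s t. s \<in> S \<Longrightarrow> t \<in> T s \<Longrightarrow> K s t \<subseteq> {k. (s, t, k) \<in> D}"
    "\<And>s t. s \<in> S \<Longrightarrow> t \<in> T s \<Longrightarrow> card (K s t) = 2 ^ i" by blast
  define D' where "D' = (SIGMA s:S. SIGMA t:T' s. K s t)"
  have D': "D' \<subseteq> D" using T' K by (force simp: D'_def)
  have "hausdorff_measure \<sigma> (R ` sequences_over D') \<noteq> 0"
    by (rule hausdorff_measure_uniform_sponge[where S = S and T = T' and K = K and ?N1.0 = "card S" and ?N2.0 = "2 ^ j" and ?N3.0 = "2 ^ i"])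
      (use D' D T' K S_pos s s' in \<open>auto simp: D'_def[symmetric] subset_iff\<close>)
  moreover have "hausdorff_measure \<sigma> (R ` sequences_over D') \<le> hausdorff_measure \<sigma> (R ` sequences_over D)"
    using D' by (intro hausdorff_measure_mono image_mono) (auto simp: sequences_over_def)
  ultimately show ?thesis by auto
qed

end


section \<open>Submultiplicative sequences and renewal\<close>

text \<open>For submultiplicative sequences this is also the limit of the roots, by Fekete. The
  infimum directly gives \<open>growth W ^ N \<le> W N\<close> for all N and, above the growth rate,
  one N with the opposite strict inequality.\<close>

definition growth :: "(nat \<Rightarrow> real) \<Rightarrow> real" where
  "growth W = (INF N\<in>{1..}. W N powr (1 / real N))"

locale submultiplicative =
  fixes W :: "nat \<Rightarrow> real"
  assumes W_ge_1: "\<And>N. 1 \<le> W N"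
    and W_add: "\<And>M N. W (M + N) \<le> W M * W N"
begin

lemma bdd_below_roots: "bdd_below ((\<lambda>N. W N powr (1 / real N)) ` {1..})"
  by (rule bdd_belowI2[of _ 0]) simp

lemma growth_ge_1: "1 \<le> growth W"
  unfolding growth_def by (rule cINF_greatest) (auto intro!: ge_one_powr_ge_zero W_ge_1)

lemma growth_power_le: "growth W ^ N \<le> W N"
proof (cases "N = 0")
  case False
  then have "growth W \<le> W N powr (1 / real N)"
    unfolding growth_def by (intro cINF_lower bdd_below_roots) auto
  then have "growth W ^ N \<le> (W N powr (1 / real N)) ^ N"
    using growth_ge_1 by (intro power_mono) auto
  also have "\<dots> = W N" using False W_ge_1[of N] by (simp add: powr_power)
  finally show ?thesis .
qed (use W_ge_1 in simp)

lemma growth_less: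
  assumes "growth W < \<mu>"
  shows "\<exists>N\<ge>1. W N < \<mu> ^ N"
proof -
  obtain N where N: "N \<ge> 1" "W N powr (1 / real N) < \<mu>"
    using assms cINF_less_iff[OF _ bdd_below_roots, of \<mu>] unfolding growth_def by auto
  have "W N = (W N powr (1 / real N)) ^ N" using N W_ge_1[of N] by (simp add: powr_power)
  also have "\<dots> < \<mu> ^ N" using N by (intro power_strict_mono) auto
  finally show ?thesis using N(1) by blast
qed

text \<open>Writing n = q * p + r with a single good \<open>p\<close> gives
  \<open>W n \<le> C * \<mu> ^ n\<close> for any \<mu> above the growth rate, and \<mu> can be taken
  with \<mu> * x < 1.\<close>

lemma summable_below_growth:
  assumes "0 < x" "x * growth W < 1"
  shows "summable (\<lambda>N. W N * x ^ N)"
proof -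
  have "growth W < 1 / x" using assms by (simp add: field_simps)
  then obtain \<mu> where \<mu>: "growth W < \<mu>" "\<mu> < 1 / x" using dense by blast
  have \<mu>0: "0 < \<mu>" using growth_ge_1 \<mu> by linarith
  obtain p where p: "1 \<le> p" "W p < \<mu> ^ p" using growth_less[OF \<mu>(1)] by blast
  have W0: "0 \<le> W n" for n using W_ge_1[of n] by linarith
  define C where "C = (\<Sum>r<p. W r / \<mu> ^ r)"
  have mult: "W (q * p + r) \<le> \<mu> ^ (q * p) * W r" for q r
  proof (induction q)
    case (Suc q)
    have "W (Suc q * p + r) \<le> W p * W (q * p + r)" using W_add[of p "q * p + r"] by (simp add: add.assoc)
    also have "\<dots> \<le> \<mu> ^ p * (\<mu> ^ (q * p) * W r)" using p Suc W0 \<mu>0 by (intro mult_mono) auto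
    finally show ?case by (simp add: power_add mult.assoc)
  qed simp
  have bound: "W n \<le> C * \<mu> ^ n" for n
  proof -
    have "W n \<le> \<mu> ^ (n div p * p) * W (n mod p)" using mult[of "n div p" "n mod p"] by simp
    also have "\<dots> = \<mu> ^ n * (W (n mod p) / \<mu> ^ (n mod p))"
    proof -
      have "\<mu> ^ n = \<mu> ^ (n div p * p) * \<mu> ^ (n mod p)" by (simp flip: power_add)
      then show ?thesis using \<mu>0 by simp
    qed
    also have "\<dots> \<le> \<mu> ^ n * C"
      unfolding C_def using \<mu>0 p W0 by (intro mult_left_mono member_le_sum) auto
    finally show ?thesis by (simp add: mult.commute)
  qed
  have "summable (\<lambda>n. C * (\<mu> * x) ^ n)"
    using \<mu> \<mu>0 assms by (intro summable_mult summable_geometric) (simp add: field_simps)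
  then show ?thesis
  proof (rule summable_comparison_test[rotated], intro exI allI impI)
    fix n
    show "norm (W n * x ^ n) \<le> C * (\<mu> * x) ^ n"
      using mult_right_mono[OF bound[of n], of "x ^ n"] W0[of n] assms(1) by (simp add: power_mult_distrib mult.assoc)
  qed
qed

end

text \<open>With \<open>x = 1 / growth W\<close>, the generating function of \<open>b\<close> takes the value \<open>1\<close> at \<open>x\<close>: a larger
  value would make \<open>Z\<close> grow faster than \<open>W\<close>, a smaller one would make \<open>\<Sum>N. Z N * x ^ N\<close> converge.\<close>

locale renewal = submultiplicative W for W :: "nat \<Rightarrow> real" +
  fixes b Z :: "nat \<Rightarrow> real" and C :: real and c :: nat
  assumes b_nonneg: "\<And>k. 0 \<le> b k"
    and Z_0: "Z 0 = 1"
    and Z_Suc: "\<And>N. Z (Suc N) = (\<Sum>k\<le>N. b k * Z (N - k))"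
    and Z_le: "\<And>N. Z N \<le> W N"
    and W_le: "\<And>N. W N \<le> C * Z (N + c)"
begin

lemma Z_nonneg: "0 \<le> Z N"
proof (induction N rule: less_induct)
  case (less N)
  then show ?case by (cases N) (auto simp: Z_0 Z_Suc intro!: sum_nonneg mult_nonneg_nonneg b_nonneg)
qed

text \<open>The identity Z(x) = 1 + B(x) * Z(x) of generating functions, with B(x) the sum of
  \<open>b k * x ^ Suc k\<close>, in a form for partial sums that presupposes no convergence. The
  triangle k + n < M is later compared with a rectangle inside it and with one around it.\<close>

lemma partial_sum_renewal:
  "(\<Sum>N<Suc M. Z N * x ^ N) = 1 + (\<Sum>(k, n) | k + n < M. (b k * x ^ Suc k) * (Z n * x ^ n))"
proof -
  have "(\<Sum>N<Suc M. Z N * x ^ N) = 1 + (\<Sum>N<M. Z (Suc N) * x ^ Suc N)"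
    by (simp add: sum.lessThan_Suc_shift Z_0 del: sum.lessThan_Suc power_Suc)
  also have "(\<Sum>N<M. Z (Suc N) * x ^ Suc N) = (\<Sum>N<M. \<Sum>k\<le>N. (b k * x ^ Suc k) * (Z (N - k) * x ^ (N - k)))"
  proof (intro sum.cong refl)
    fix N
    have "b k * Z (N - k) * x ^ Suc N = (b k * x ^ Suc k) * (Z (N - k) * x ^ (N - k))" if "k \<le> N" for k
    proof -
      have "x ^ Suc N = x ^ Suc k * x ^ (N - k)" using that by (simp flip: power_add)
      then show ?thesis by (simp only: mult_ac)
    qed
    then have "(\<Sum>k\<le>N. b k * Z (N - k) * x ^ Suc N) = (\<Sum>k\<le>N. (b k * x ^ Suc k) * (Z (N - k) * x ^ (N - k)))"
      by (intro sum.cong) auto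
    then show "Z (Suc N) * x ^ Suc N = (\<Sum>k\<le>N. (b k * x ^ Suc k) * (Z (N - k) * x ^ (N - k)))"
      by (simp add: Z_Suc sum_distrib_right del: power_Suc)
  qed
  also have "\<dots> = (\<Sum>(k, n) | k + n < M. (b k * x ^ Suc k) * (Z n * x ^ n))"
    by (rule sum.triangle_reindex[symmetric])
  finally show ?thesis .
qed

lemma finite_triangle: "finite {(k, n). k + n < (M::nat)}"
  by (rule finite_subset[of _ "{..<M} \<times> {..<M}"]) auto

lemma sum_b_le_1:
  assumes x: "x = 1 / growth W"
  shows "(\<Sum>k<K. b k * x ^ Suc k) \<le> 1"
proof (rule ccontr)
  assume "\<not> ?thesis"
  then have gt: "1 < (\<Sum>k<K. b k * x ^ Suc k)" by simp
  have x0: "0 < x" using growth_ge_1 x by simp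
  \<comment> \<open>Some y < x keeps the sum above 1 and makes the series of
    \<open>W N * y ^ N\<close> converge, in contradiction to the unbounded partial sums
    \<open>Y\<close>.\<close>
  have "continuous (at_left x) (\<lambda>y. \<Sum>k<K. b k * y ^ Suc k)"
    by (intro continuous_intros)
  then have "((\<lambda>y. \<Sum>k<K. b k * y ^ Suc k) \<longlongrightarrow> (\<Sum>k<K. b k * x ^ Suc k)) (at_left x)"
    by (simp add: continuous_within)
  then have "eventually (\<lambda>y. 1 < (\<Sum>k<K. b k * y ^ Suc k)) (at_left x)"
    using gt by (rule order_tendstoD)
  moreover have "eventually (\<lambda>y. y \<in> {0<..<x}) (at_left x)"
    using x0 by (rule eventually_at_left_real)
  ultimately have "eventually (\<lambda>y. 1 < (\<Sum>k<K. b k * y ^ Suc k) \<and> y \<in> {0<..<x}) (at_left x)"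
    by (rule eventually_conj)
  then obtain y where y: "1 < (\<Sum>k<K. b k * y ^ Suc k)" "0 < y" "y < x"
    using eventually_happens[of _ "at_left x"] trivial_limit_at_left_real by auto
  define Y where "Y M = (\<Sum>N<M. Z N * y ^ N)" for M
  have Y0: "0 \<le> Y M" for M unfolding Y_def using Z_nonneg y by (intro sum_nonneg) auto
  have step: "1 + Y M \<le> Y (Suc (M + K))" for M
  proof -
    have "1 * Y M \<le> (\<Sum>k<K. b k * y ^ Suc k) * Y M" using y Y0 by (intro mult_right_mono) auto
    also have "\<dots> = (\<Sum>(k, n)\<in>{..<K} \<times> {..<M}. (b k * y ^ Suc k) * (Z n * y ^ n))"
      unfolding Y_def by (simp add: sum_product sum.cartesian_product del: power_Suc)
    also have "\<dots> \<le> (\<Sum>(k, n) | k + n < M + K. (b k * y ^ Suc k) * (Z n * y ^ n))"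
      using b_nonneg Z_nonneg y by (intro sum_mono2 finite_triangle) auto
    finally show ?thesis unfolding Y_def partial_sum_renewal by simp
  qed
  have unb: "real j \<le> Y (j * Suc K)" for j
  proof (induction j)
    case (Suc j)
    then show ?case using step[of "j * Suc K"] by (simp add: ac_simps)
  qed (simp add: Y_def)
  have "y * growth W < 1" using y x growth_ge_1 by (simp add: field_simps)
  then have sW: "summable (\<lambda>N. W N * y ^ N)" by (rule summable_below_growth[OF y(2)])
  have "Y M \<le> (\<Sum>N. W N * y ^ N)" for M
  proof -
    have "Y M \<le> (\<Sum>N<M. W N * y ^ N)" unfolding Y_def using Z_le y by (intro sum_mono mult_right_mono) auto
    also have "\<dots> \<le> (\<Sum>N. W N * y ^ N)"
      using sW y order_trans[OF zero_le_one W_ge_1] by (intro sum_le_suminf) auto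
    finally show ?thesis .
  qed
  then have "real j \<le> (\<Sum>N. W N * y ^ N)" for j using unb[of j] order_trans by blast
  then show False using reals_Archimedean2[of "\<Sum>N. W N * y ^ N"] by (meson not_le)
qed

lemma renewal_sums: "(\<lambda>k. b k / growth W ^ k) sums growth W"
proof -
  define x where "x = 1 / growth W"
  have g: "0 < growth W" using growth_ge_1 by linarith
  have x0: "0 < x" using g by (simp add: x_def)
  let ?\<beta> = "\<lambda>k. b k * x ^ Suc k"
  have \<beta>0: "0 \<le> ?\<beta> k" for k using b_nonneg x0 by (intro mult_nonneg_nonneg) auto
  have sm: "summable ?\<beta>"
    using \<beta>0 sum_b_le_1[OF x_def] by (rule summableI_nonneg_bounded)
  have le1: "suminf ?\<beta> \<le> 1" using sm sum_b_le_1[OF x_def] by (intro suminf_le_const) auto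
  have "suminf ?\<beta> = 1"
  proof (rule ccontr)
    assume "suminf ?\<beta> \<noteq> 1"
    then have lt: "suminf ?\<beta> < 1" using le1 by simp
    define Y where "Y M = (\<Sum>N<M. Z N * x ^ N)" for M
    have Y0: "0 \<le> Y M" for M unfolding Y_def using Z_nonneg x0 by (intro sum_nonneg) auto
    have Ymono: "Y M \<le> Y (Suc M)" for M unfolding Y_def using Z_nonneg x0 by simp
    have Yb: "Y M \<le> 1 / (1 - suminf ?\<beta>)" for M
    proof -
      have "(\<Sum>(k, n) | k + n < M. ?\<beta> k * (Z n * x ^ n)) \<le> (\<Sum>(k, n)\<in>{..<M} \<times> {..<M}. ?\<beta> k * (Z n * x ^ n))"
        using b_nonneg Z_nonneg x0 by (intro sum_mono2) auto
      also have "\<dots> = (\<Sum>k<M. ?\<beta> k) * Y M"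
        unfolding Y_def by (simp add: sum_product sum.cartesian_product del: power_Suc)
      also have "\<dots> \<le> suminf ?\<beta> * Y M"
        using sm \<beta>0 Y0 by (intro mult_right_mono sum_le_suminf) auto
      finally have "Y (Suc M) \<le> 1 + suminf ?\<beta> * Y M" unfolding Y_def partial_sum_renewal by simp
      with Ymono[of M] have "Y M * (1 - suminf ?\<beta>) \<le> 1" by (simp add: algebra_simps)
      then show ?thesis using lt by (simp add: field_simps)
    qed
    have C0: "0 < C"
    proof -
      have "0 < C * Z (0 + c)" using W_le[of 0] W_ge_1[of 0] by linarith
      then show ?thesis using Z_nonneg[of c] by (auto simp: zero_less_mult_iff)
    qed
    \<comment> \<open>Since \<open>growth W ^ N \<le> W N \<le> C * Z (N + c)\<close>, the terms of
      the series stay away from 0 and its partial sums are unbounded.\<close>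
    have tm: "x ^ c / C \<le> Z (N + c) * x ^ (N + c)" for N
    proof -
      have "1 = growth W ^ N * x ^ N" using g by (simp add: x_def power_divide)
      also have "\<dots> \<le> C * Z (N + c) * x ^ N"
        using growth_power_le[of N] W_le[of N] x0 by (intro mult_right_mono) auto
      finally have "1 * x ^ c \<le> C * Z (N + c) * x ^ N * x ^ c" using x0 by (intro mult_right_mono) auto
      then show ?thesis using C0 by (simp add: power_add field_simps)
    qed
    have "real M * (x ^ c / C) \<le> 1 / (1 - suminf ?\<beta>)" for M
    proof -
      have "real M * (x ^ c / C) = (\<Sum>N<M. x ^ c / C)" by simp
      also have "\<dots> \<le> (\<Sum>N<M. Z (N + c) * x ^ (N + c))" by (intro sum_mono tm)
      also have "\<dots> = (\<Sum>N\<in>{c..<M + c}. Z N * x ^ N)"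
        by (rule sum.reindex_bij_witness[of _ "\<lambda>N. N - c" "\<lambda>N. N + c"]) auto
      also have "\<dots> \<le> Y (M + c)" unfolding Y_def using Z_nonneg x0 by (intro sum_mono2) auto
      finally show ?thesis using Yb[of "M + c"] by linarith
    qed
    moreover have "0 < x ^ c / C" using x0 C0 by simp
    then obtain M :: nat where "1 / (1 - suminf ?\<beta>) < real M * (x ^ c / C)"
      using reals_Archimedean3 by blast
    ultimately show False using not_le by blast
  qed
  with sm have "?\<beta> sums 1" by (simp add: sums_iff)
  then have "(\<lambda>k. growth W * ?\<beta> k) sums (growth W * 1)" by (rule sums_mult)
  then show ?thesis using g by (simp add: x_def power_divide)
qed

end

text \<open>As r grows, the series decreases weakly, its coefficients being nonnegative, while the
  value r that it should have increases strictly.\<close>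

lemma positive_solution_unique:
  fixes b :: "nat \<Rightarrow> real"
  assumes b: "\<And>k. 0 \<le> b k" and r: "0 < r" "(\<lambda>k. b k / r ^ k) sums r"
    and r': "0 < r'" "(\<lambda>k. b k / r' ^ k) sums r'"
  shows "r' = r"
proof -
  have *: False if s: "0 < s" "(\<lambda>k. b k / s ^ k) sums s" "(\<lambda>k. b k / t ^ k) sums t" "s < t" for s t
  proof -
    have "b k / t ^ k \<le> b k / s ^ k" for k
      using b s by (intro divide_left_mono power_mono mult_pos_pos) auto
    then have "t \<le> s" by (rule sums_le[OF _ s(3,2)])
    then show False using s(4) by simp
  qed
  show ?thesis using *[OF r r'(2)] *[OF r' r(2)] by (rule_tac linorder_cases[of r r']) auto
qed


section \<open>Weighted sums over words\<close>

text \<open>After division by the sum the terms lie in [0, 1], where p \<le> p powr a. This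
  subadditivity is what allows words to be extended by a bounded number of letters at bounded
  cost.\<close>

lemma powr_sum_le:
  fixes f :: "'a \<Rightarrow> real"
  assumes f: "\<And>i. i \<in> I \<Longrightarrow> 0 \<le> f i" and a: "0 < a" "a \<le> 1"
  shows "sum f I powr a \<le> (\<Sum>i\<in>I. f i powr a)"
proof (cases "sum f I = 0")
  case True
  then show ?thesis by (simp add: sum_nonneg)
next
  case False
  let ?S = "sum f I"
  have S: "0 < ?S" using False sum_nonneg[of I f] f by (simp add: less_le)
  have fin: "finite I" using False sum.infinite by blast
  have "1 = (\<Sum>i\<in>I. f i / ?S)" using S by (simp flip: sum_divide_distrib)
  also have "\<dots> \<le> (\<Sum>i\<in>I. (f i / ?S) powr a)"
  proof (intro sum_mono)
    fix i assume i: "i \<in> I"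
    have "f i / ?S \<le> 1" using member_le_sum[OF i, of f] f fin S by (auto simp: divide_le_eq)
    moreover have "0 \<le> f i / ?S" using f i S by auto
    moreover have "x \<le> x powr a" if "0 \<le> x" "x \<le> 1" for x :: real
      using powr_mono'[of a 1 x] a that by simp
    ultimately show "f i / ?S \<le> (f i / ?S) powr a" by blast
  qed
  also have "\<dots> = (\<Sum>i\<in>I. f i powr a) / ?S powr a"
    using f S by (simp add: powr_divide sum_divide_distrib)
  finally show ?thesis using S by (simp add: le_divide_eq)
qed

definition digit_words :: "nat \<Rightarrow> nat \<Rightarrow> nat list set" where
  "digit_words m N = {xs. set xs \<subseteq> {..<m} \<and> length xs = N}"

lemma finite_digit_words [simp]: "finite (digit_words m N)"
  unfolding digit_words_def by (rule finite_lists_length_eq) simp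

lemma digit_words_0 [simp]: "digit_words m 0 = {[]}"
  by (auto simp: digit_words_def)

lemma length_digit_words: "xs \<in> digit_words m N \<Longrightarrow> length xs = N"
  by (simp add: digit_words_def)

lemma card_digit_words: "card (digit_words m N) = m ^ N"
  unfolding digit_words_def by (simp add: card_lists_length_eq)

lemma sum_digit_words_Suc:
  "(\<Sum>xs\<in>digit_words m (Suc N). g xs) = (\<Sum>x<m. \<Sum>xs\<in>digit_words m N. g (x # xs))"
proof -
  have "(\<Sum>xs\<in>digit_words m (Suc N). g xs) = (\<Sum>(x, xs)\<in>{..<m} \<times> digit_words m N. g (x # xs))"
    by (rule sum.reindex_bij_witness[of _ "\<lambda>(x, xs). x # xs" "\<lambda>xs. (hd xs, tl xs)"])
      (auto simp: digit_words_def length_Suc_conv)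
  then show ?thesis by (simp add: sum.cartesian_product)
qed

lemma sum_digit_words_add:
  "(\<Sum>xs\<in>digit_words m (M + N). g xs) = (\<Sum>xs\<in>digit_words m M. \<Sum>ys\<in>digit_words m N. g (xs @ ys))"
  by (induction M arbitrary: g) (simp_all add: sum_digit_words_Suc)

lemma sum_digit_words_snoc:
  "(\<Sum>xs\<in>digit_words m (Suc N). g xs) = (\<Sum>xs\<in>digit_words m N. \<Sum>x<m. g (xs @ [x]))"
  using sum_digit_words_add[of g m N 1] by (simp add: sum_digit_words_Suc)

locale word_sums =
  fixes m1 m2 :: nat and a1 a2 :: real
  assumes a1_bounds: "0 < a1" "a1 \<le> 1" and a2_bounds: "0 < a2" "a2 \<le> 1"
begin

text \<open>The weight \<phi> of a word is a parameter: it will be an entry sum, a diagonal entry,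
  the normalised mass of a row vector, or that mass after one further letter.\<close>

definition column :: "((nat \<times> nat) list \<Rightarrow> real) \<Rightarrow> nat list \<Rightarrow> real" where
  "column \<phi> s = (\<Sum>t\<in>digit_words m2 (length s). \<phi> (zip s t) powr a2)"

definition total :: "((nat \<times> nat) list \<Rightarrow> real) \<Rightarrow> nat \<Rightarrow> real" where
  "total \<phi> N = (\<Sum>s\<in>digit_words m1 N. column \<phi> s powr a1)"

lemma column_nonneg [simp]: "0 \<le> column \<phi> s"
  unfolding column_def by (intro sum_nonneg) auto

lemma total_nonneg [simp]: "0 \<le> total \<phi> N"
  unfolding total_def by (intro sum_nonneg) auto

lemma column_append:
  "column \<phi> (s @ s') = (\<Sum>t\<in>digit_words m2 (length s). \<Sum>t'\<in>digit_words m2 (length s'). \<phi> (zip s t @ zip s' t') powr a2)"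
  unfolding column_def length_append sum_digit_words_add
  by (intro sum.cong refl) (simp add: length_digit_words)

lemma column_mono:
  assumes "\<And>t. t \<in> digit_words m2 (length s) \<Longrightarrow> 0 \<le> \<phi> (zip s t) \<and> \<phi> (zip s t) \<le> \<psi> (zip s t)"
  shows "column \<phi> s \<le> column \<psi> s"
  unfolding column_def using assms a2_bounds by (intro sum_mono powr_mono2) auto

lemma total_mono:
  assumes "\<And>s t. s \<in> digit_words m1 N \<Longrightarrow> t \<in> digit_words m2 N \<Longrightarrow> 0 \<le> \<phi> (zip s t) \<and> \<phi> (zip s t) \<le> \<psi> (zip s t)"
  shows "total \<phi> N \<le> total \<psi> N"
  unfolding total_def using assms a1_bounds
  by (intro sum_mono powr_mono2 column_mono) (auto simp: length_digit_words)

lemma total_submult: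
  assumes nonneg: "\<And>w. 0 \<le> \<phi> w" and mult: "\<And>w w'. \<phi> (w @ w') \<le> \<phi> w * \<phi> w'"
  shows "total \<phi> (M + N) \<le> total \<phi> M * total \<phi> N"
proof -
  have col: "column \<phi> (s @ s') \<le> column \<phi> s * column \<phi> s'" for s s'
  proof -
    have "column \<phi> (s @ s') \<le> (\<Sum>t\<in>digit_words m2 (length s). \<Sum>t'\<in>digit_words m2 (length s'). \<phi> (zip s t) powr a2 * \<phi> (zip s' t') powr a2)"
      unfolding column_append using nonneg mult a2_bounds
      by (intro sum_mono) (simp add: powr_mono2 flip: powr_mult)
    also have "\<dots> = column \<phi> s * column \<phi> s'" unfolding column_def by (simp add: sum_product)
    finally show ?thesis .
  qed
  have "total \<phi> (M + N) = (\<Sum>s\<in>digit_words m1 M. \<Sum>s'\<in>digit_words m1 N. column \<phi> (s @ s') powr a1)"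
    unfolding total_def by (rule sum_digit_words_add)
  also have "\<dots> \<le> (\<Sum>s\<in>digit_words m1 M. \<Sum>s'\<in>digit_words m1 N. column \<phi> s powr a1 * column \<phi> s' powr a1)"
    using col a1_bounds by (intro sum_mono) (simp add: powr_mono2 flip: powr_mult)
  also have "\<dots> = total \<phi> M * total \<phi> N" unfolding total_def by (simp add: sum_product)
  finally show ?thesis .
qed

text \<open>Both powers are subadditive, so the sums over the added letters can be pulled out of
  each of them. The constant is independent of N, hence a fixed number of added letters does not
  affect growth rates.\<close>

lemma total_le_extension:
  assumes nonneg: "\<And>w. 0 \<le> \<phi> w" "\<And>w. 0 \<le> \<psi> w" and C: "0 \<le> C"
    and ext: "\<And>w. \<phi> w \<le> C * (\<Sum>s'\<in>digit_words m1 d. \<Sum>s''\<in>digit_words m1 e.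
      \<Sum>t'\<in>digit_words m2 d. \<Sum>t''\<in>digit_words m2 e. \<psi> (zip s' t' @ w @ zip s'' t''))"
  shows "total \<phi> N \<le> (C powr a2) powr a1 * total \<psi> (d + (N + e))"
proof -
  have pw: "\<phi> w powr a2 \<le> C powr a2 * (\<Sum>s'\<in>digit_words m1 d. \<Sum>s''\<in>digit_words m1 e.
      \<Sum>t'\<in>digit_words m2 d. \<Sum>t''\<in>digit_words m2 e. \<psi> (zip s' t' @ w @ zip s'' t'') powr a2)" for w
  proof -
    have "\<phi> w powr a2 \<le> (C * (\<Sum>s'\<in>digit_words m1 d. \<Sum>s''\<in>digit_words m1 e.
      \<Sum>t'\<in>digit_words m2 d. \<Sum>t''\<in>digit_words m2 e. \<psi> (zip s' t' @ w @ zip s'' t''))) powr a2"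
      using ext nonneg a2_bounds by (intro powr_mono2) auto
    also have "\<dots> \<le> C powr a2 * (\<Sum>s'\<in>digit_words m1 d. \<Sum>s''\<in>digit_words m1 e.
      \<Sum>t'\<in>digit_words m2 d. \<Sum>t''\<in>digit_words m2 e. \<psi> (zip s' t' @ w @ zip s'' t'') powr a2)"
      using C nonneg a2_bounds unfolding powr_mult
      by (intro mult_left_mono order_trans[OF powr_sum_le sum_mono] powr_sum_le sum_nonneg) auto
    finally show ?thesis .
  qed
  have col: "column \<phi> s \<le> C powr a2 * (\<Sum>s'\<in>digit_words m1 d. \<Sum>s''\<in>digit_words m1 e. column \<psi> (s' @ s @ s''))"
    if s: "s \<in> digit_words m1 N" for s
  proof -
    have "column \<phi> s \<le> (\<Sum>t\<in>digit_words m2 N. C powr a2 * (\<Sum>s'\<in>digit_words m1 d. \<Sum>s''\<in>digit_words m1 e.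
      \<Sum>t'\<in>digit_words m2 d. \<Sum>t''\<in>digit_words m2 e. \<psi> (zip s' t' @ zip s t @ zip s'' t'') powr a2))"
      unfolding column_def length_digit_words[OF s] by (intro sum_mono pw)
    also have "\<dots> = C powr a2 * (\<Sum>t\<in>digit_words m2 N. \<Sum>s'\<in>digit_words m1 d. \<Sum>s''\<in>digit_words m1 e.
      \<Sum>t'\<in>digit_words m2 d. \<Sum>t''\<in>digit_words m2 e. \<psi> (zip s' t' @ zip s t @ zip s'' t'') powr a2)"
      by (simp add: sum_distrib_left)
    also have "(\<Sum>t\<in>digit_words m2 N. \<Sum>s'\<in>digit_words m1 d. \<Sum>s''\<in>digit_words m1 e.
        \<Sum>t'\<in>digit_words m2 d. \<Sum>t''\<in>digit_words m2 e. \<psi> (zip s' t' @ zip s t @ zip s'' t'') powr a2)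
      = (\<Sum>s'\<in>digit_words m1 d. \<Sum>s''\<in>digit_words m1 e. \<Sum>t\<in>digit_words m2 N.
        \<Sum>t'\<in>digit_words m2 d. \<Sum>t''\<in>digit_words m2 e. \<psi> (zip s' t' @ zip s t @ zip s'' t'') powr a2)"
      by (rule trans[OF sum.swap sum.cong[OF refl sum.swap]])
    also have "\<dots> = (\<Sum>s'\<in>digit_words m1 d. \<Sum>s''\<in>digit_words m1 e. column \<psi> (s' @ s @ s''))"
    proof (intro sum.cong refl)
      fix s' s'' assume s': "s' \<in> digit_words m1 d" "s'' \<in> digit_words m1 e"
      have "column \<psi> (s' @ s @ s'') = (\<Sum>t'\<in>digit_words m2 d. \<Sum>t\<in>digit_words m2 N. \<Sum>t''\<in>digit_words m2 e. \<psi> (zip s' t' @ zip s t @ zip s'' t'') powr a2)"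
        unfolding column_append length_append length_digit_words[OF s'(1)] length_digit_words[OF s'(2)] length_digit_words[OF s] sum_digit_words_add
        using s s' by (intro sum.cong refl) (simp add: length_digit_words)
      also have "\<dots> = (\<Sum>t\<in>digit_words m2 N. \<Sum>t'\<in>digit_words m2 d. \<Sum>t''\<in>digit_words m2 e. \<psi> (zip s' t' @ zip s t @ zip s'' t'') powr a2)"
        by (rule sum.swap)
      finally show "(\<Sum>t\<in>digit_words m2 N. \<Sum>t'\<in>digit_words m2 d. \<Sum>t''\<in>digit_words m2 e. \<psi> (zip s' t' @ zip s t @ zip s'' t'') powr a2)
        = column \<psi> (s' @ s @ s'')" by simp
    qed
    finally show ?thesis .
  qed
  have "total \<phi> N \<le> (\<Sum>s\<in>digit_words m1 N. (C powr a2) powr a1 * (\<Sum>s'\<in>digit_words m1 d. \<Sum>s''\<in>digit_words m1 e. column \<psi> (s' @ s @ s'') powr a1))"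
    unfolding total_def
  proof (intro sum_mono)
    fix s assume s: "s \<in> digit_words m1 N"
    have "column \<phi> s powr a1 \<le> (C powr a2 * (\<Sum>s'\<in>digit_words m1 d. \<Sum>s''\<in>digit_words m1 e. column \<psi> (s' @ s @ s''))) powr a1"
      using col[OF s] a1_bounds by (intro powr_mono2) auto
    also have "\<dots> = (C powr a2) powr a1 * (\<Sum>s'\<in>digit_words m1 d. \<Sum>s''\<in>digit_words m1 e. column \<psi> (s' @ s @ s'')) powr a1"
      by (rule powr_mult)
    also have "\<dots> \<le> (C powr a2) powr a1 * (\<Sum>s'\<in>digit_words m1 d. \<Sum>s''\<in>digit_words m1 e. column \<psi> (s' @ s @ s'') powr a1)"
      using a1_bounds by (intro mult_left_mono order_trans[OF powr_sum_le sum_mono] powr_sum_le sum_nonneg) auto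
    finally show "column \<phi> s powr a1 \<le> (C powr a2) powr a1 * (\<Sum>s'\<in>digit_words m1 d. \<Sum>s''\<in>digit_words m1 e. column \<psi> (s' @ s @ s'') powr a1)" .
  qed
  also have "\<dots> = (C powr a2) powr a1 * (\<Sum>s\<in>digit_words m1 N. \<Sum>s'\<in>digit_words m1 d. \<Sum>s''\<in>digit_words m1 e. column \<psi> (s' @ s @ s'') powr a1)"
    by (simp add: sum_distrib_left)
  also have "(\<Sum>s\<in>digit_words m1 N. \<Sum>s'\<in>digit_words m1 d. \<Sum>s''\<in>digit_words m1 e. column \<psi> (s' @ s @ s'') powr a1) = total \<psi> (d + (N + e))"
    unfolding total_def sum_digit_words_add by (rule sum.swap)
  finally show ?thesis .
qed

end

section \<open>Products of nonnegative matrices along words\<close>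

definition matrix_word :: "(nat \<times> nat \<Rightarrow> real^'n^'n) \<Rightarrow> (nat \<times> nat) list \<Rightarrow> real^'n^'n" where
  "matrix_word A w = foldr (\<lambda>q B. A q ** B) w (mat 1)"

lemma matrix_word_Nil [simp]: "matrix_word A [] = mat 1"
  and matrix_word_Cons [simp]: "matrix_word A (q # w) = A q ** matrix_word A w"
  by (simp_all add: matrix_word_def)

lemma matrix_word_append: "matrix_word A (w @ w') = matrix_word A w ** matrix_word A w'"
  by (induction w) (simp_all add: matrix_mul_assoc)

lemma foldl_vector_matrix: "foldl (\<lambda>x q. x v* A q) x w = x v* matrix_word A w"
  by (induction w arbitrary: x) (simp_all add: vector_matrix_mul_assoc)

text \<open>On nonnegative matrices this is the entrywise l1 norm, which is submultiplicative and
  dominates every entry.\<close>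

definition entry_sum :: "real^'n^'n \<Rightarrow> real" where
  "entry_sum B = (\<Sum>p\<in>UNIV. \<Sum>q\<in>UNIV. B $ p $ q)"

definition nonneg_matrix :: "real^'n^'n \<Rightarrow> bool" where
  "nonneg_matrix B \<longleftrightarrow> (\<forall>p q. 0 \<le> B $ p $ q)"

lemma nonneg_matrix_mult: "nonneg_matrix B \<Longrightarrow> nonneg_matrix C \<Longrightarrow> nonneg_matrix (B ** C)"
  by (auto simp: nonneg_matrix_def matrix_matrix_mult_def intro!: sum_nonneg)

lemma nonneg_matrix_word: "(\<And>q. nonneg_matrix (A q)) \<Longrightarrow> nonneg_matrix (matrix_word A w)"
  by (induction w) (simp_all add: nonneg_matrix_mult, simp add: nonneg_matrix_def mat_def)

lemma entry_sum_nonneg: "nonneg_matrix B \<Longrightarrow> 0 \<le> entry_sum B"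
  by (auto simp: nonneg_matrix_def entry_sum_def intro!: sum_nonneg)

lemma entry_le_entry_sum: "nonneg_matrix B \<Longrightarrow> B $ p $ q \<le> entry_sum B"
  unfolding nonneg_matrix_def entry_sum_def
  by (rule order_trans[OF member_le_sum[of q] member_le_sum[of p UNIV "\<lambda>p. \<Sum>q\<in>UNIV. B $ p $ q"]]) (auto intro!: sum_nonneg)

lemma entry_sum_mult_le:
  assumes "nonneg_matrix B" "nonneg_matrix C"
  shows "entry_sum (B ** C) \<le> entry_sum B * entry_sum C"
proof -
  have "entry_sum (B ** C) = (\<Sum>p\<in>UNIV. \<Sum>q\<in>UNIV. \<Sum>r\<in>UNIV. B $ p $ r * C $ r $ q)"
    by (simp add: entry_sum_def matrix_matrix_mult_def)
  also have "\<dots> = (\<Sum>p\<in>UNIV. \<Sum>r\<in>UNIV. B $ p $ r * (\<Sum>q\<in>UNIV. C $ r $ q))"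
    by (subst sum.swap) (simp add: sum_distrib_left)
  also have "\<dots> \<le> (\<Sum>p\<in>UNIV. \<Sum>r\<in>UNIV. B $ p $ r * entry_sum C)"
    using assms unfolding entry_sum_def nonneg_matrix_def
    by (intro sum_mono mult_left_mono member_le_sum[of _ UNIV "\<lambda>r. \<Sum>q\<in>UNIV. C $ r $ q"]) (auto intro!: sum_nonneg)
  also have "\<dots> = entry_sum B * entry_sum C"
    by (simp add: entry_sum_def[of B] sum_distrib_right)
  finally show ?thesis .
qed

lemma matrix_mult_sum_right:
  fixes B :: "real^'n^'n" and f :: "'i \<Rightarrow> real^'n^'n"
  shows "B ** (\<Sum>i\<in>I. f i) = (\<Sum>i\<in>I. B ** f i)"
  by (induction I rule: infinite_finite_induct) (auto simp: matrix_add_ldistrib)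

lemma matrix_mult_sum_left:
  fixes B :: "real^'n^'n" and f :: "'i \<Rightarrow> real^'n^'n"
  shows "(\<Sum>i\<in>I. f i) ** B = (\<Sum>i\<in>I. f i ** B)"
  by (induction I rule: infinite_finite_induct) (auto simp: matrix_matrix_mult_def vec_eq_iff sum.distrib distrib_right)

lemma matrix_power_sum:
  "((\<lambda>B. B ** (\<Sum>w\<in>{..<m1} \<times> {..<m2}. A w)) ^^ d) (mat 1) = (\<Sum>s\<in>digit_words m1 d. \<Sum>t\<in>digit_words m2 d. matrix_word A (zip s t))"
proof (induction d)
  case (Suc d)
  have "((\<lambda>B. B ** (\<Sum>w\<in>{..<m1} \<times> {..<m2}. A w)) ^^ Suc d) (mat 1)
      = (\<Sum>s\<in>digit_words m1 d. \<Sum>t\<in>digit_words m2 d. matrix_word A (zip s t)) ** (\<Sum>w\<in>{..<m1} \<times> {..<m2}. A w)"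
    by (simp add: Suc.IH)
  also have "\<dots> = (\<Sum>s\<in>digit_words m1 d. \<Sum>t\<in>digit_words m2 d. matrix_word A (zip s t) ** (\<Sum>w\<in>{..<m1} \<times> {..<m2}. A w))"
    by (simp only: matrix_mult_sum_left)
  also have "\<dots> = (\<Sum>s\<in>digit_words m1 d. \<Sum>t\<in>digit_words m2 d. \<Sum>x<m1. \<Sum>y<m2. matrix_word A (zip s t) ** A (x, y))"
    by (simp add: matrix_mult_sum_right sum.cartesian_product')
  also have "\<dots> = (\<Sum>s\<in>digit_words m1 d. \<Sum>x<m1. \<Sum>t\<in>digit_words m2 d. \<Sum>y<m2. matrix_word A (zip (s @ [x]) (t @ [y])))"
    by (subst sum.swap, intro sum.cong refl) (auto simp: length_digit_words matrix_word_append intro!: sum.cong)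
  finally show ?case by (simp add: sum_digit_words_snoc)
qed simp


section \<open>Blocks of a sofic system\<close>

definition word_code :: "nat \<Rightarrow> nat list \<Rightarrow> nat" where
  "word_code m xs = digit_prefix m (length xs) (\<lambda>i. xs ! i)"

lemma nth_digit_words:
  assumes "xs \<in> digit_words m N" "i < N"
  shows "xs ! i < m"
proof -
  have "xs ! i \<in> set xs" using assms by (simp add: digit_words_def)
  moreover have "set xs \<subseteq> {..<m}" using assms by (simp add: digit_words_def)
  ultimately show ?thesis by blast
qed

lemma word_code_bij: "bij_betw (word_code m) (digit_words m N) {..<m ^ N}"
proof -
  have inj: "inj_on (word_code m) (digit_words m N)"
  proof (rule inj_onI)
    fix xs ys assume xy: "xs \<in> digit_words m N" "ys \<in> digit_words m N" "word_code m xs = word_code m ys"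
    have "xs ! i < m" "ys ! i < m" if "i < N" for i
      by (rule nth_digit_words[OF xy(1) that], rule nth_digit_words[OF xy(2) that])
    note lt = this
    have len: "length xs = N" "length ys = N" using xy(1,2) by (auto simp: length_digit_words)
    then have eq: "digit_prefix m N (\<lambda>i. xs ! i) = digit_prefix m N (\<lambda>i. ys ! i)"
      using xy(3) by (simp add: word_code_def)
    show "xs = ys"
    proof (rule nth_equalityI)
      fix i assume "i < length xs"
      then have "i < N" using len by simp
      then show "xs ! i = ys ! i" using digit_prefix_inject[OF lt eq] by blast
    qed (use len in simp)
  qed
  have sub: "word_code m ` digit_words m N \<subseteq> {..<m ^ N}"
  proof (rule image_subsetI)
    fix xs assume xs: "xs \<in> digit_words m N"
    have "xs ! i < m" if "i < N" for i using xs that by (rule nth_digit_words)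
    then show "word_code m xs \<in> {..<m ^ N}"
      using xs digit_prefix_less[of N "\<lambda>i. xs ! i" m] by (simp add: word_code_def length_digit_words)
  qed
  have "word_code m ` digit_words m N = {..<m ^ N}"
    using sub inj by (intro card_subset_eq) (auto simp: card_image card_digit_words)
  with inj show ?thesis by (simp add: bij_betw_def)
qed

definition block_digits :: "nat \<Rightarrow> nat \<Rightarrow> nat \<Rightarrow> (nat list \<times> nat list \<times> nat list) set \<Rightarrow> (nat \<times> nat \<times> nat) set" where
  "block_digits m1 m2 m3 L = (\<lambda>(s, t, k). (word_code m1 s, word_code m2 t, word_code m3 k)) ` L"

locale block_bases = torus_bases m1 m2 m3 a1 a2 for m1 m2 m3 :: nat and a1 a2 :: real +
  fixes N :: nat and L :: "(nat list \<times> nat list \<times> nat list) set"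
  assumes N: "1 \<le> N"
    and L: "L \<subseteq> digit_words m1 N \<times> digit_words m2 N \<times> digit_words m3 N"
begin

text \<open>Raising base and argument of a logarithm to the same power does not change it, so blocks
  have the same exponents \<open>a1\<close> and \<open>a2\<close>.\<close>

lemma block_torus_bases: "torus_bases (m1 ^ N) (m2 ^ N) (m3 ^ N) a1 a2"
proof
  show "1 < m1 ^ N" using M N by (intro one_less_power) auto
  show "m1 ^ N \<le> m2 ^ N" "m2 ^ N \<le> m3 ^ N" using M by (auto intro: power_mono)
  show "a1 = log (real (m2 ^ N)) (real (m1 ^ N))" "a2 = log (real (m3 ^ N)) (real (m2 ^ N))"
    using M N by (auto simp: a1 a2 log_def ln_realpow)
qed

sublocale block: torus_bases "m1 ^ N" "m2 ^ N" "m3 ^ N" a1 a2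
  by (rule block_torus_bases)

lemma block_digits_box: "block_digits m1 m2 m3 L \<subseteq> block.digit_box"
  using L word_code_bij[of m1 N] word_code_bij[of m2 N] word_code_bij[of m3 N]
  unfolding block.digit_box_def block_digits_def bij_betw_def by force

lemma fibre_count_block:
  assumes s: "s \<in> digit_words m1 N" and t: "t \<in> digit_words m2 N"
  shows "block.fibre_count (block_digits m1 m2 m3 L) (word_code m1 s) (word_code m2 t) = card {k. (s, t, k) \<in> L}"
proof -
  have inj: "inj_on (word_code m) (digit_words m N)" for m using word_code_bij[of m N] by (rule bij_betw_imp_inj_on)
  have "{k. (word_code m1 s, word_code m2 t, k) \<in> block_digits m1 m2 m3 L} = word_code m3 ` {k. (s, t, k) \<in> L}"
  proof (intro equalityI subsetI)
    fix x assume "x \<in> {k. (word_code m1 s, word_code m2 t, k) \<in> block_digits m1 m2 m3 L}"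
    then obtain s' t' k where k: "(s', t', k) \<in> L" "word_code m1 s = word_code m1 s'" "word_code m2 t = word_code m2 t'" "x = word_code m3 k"
      by (auto simp: block_digits_def)
    then have "s' = s" "t' = t" using L s t inj_onD[OF inj] by blast+
    then show "x \<in> word_code m3 ` {k. (s, t, k) \<in> L}" using k by blast
  qed (force simp: block_digits_def)
  moreover have "inj_on (word_code m3) {k. (s, t, k) \<in> L}" using inj[of m3] L by (auto intro: inj_on_subset)
  ultimately show ?thesis unfolding block.fibre_count_def by (simp add: card_image)
qed

lemma digit_weight_block:
  "block.digit_weight (block_digits m1 m2 m3 L)
    = (\<Sum>s\<in>digit_words m1 N. (\<Sum>t\<in>digit_words m2 N. real (card {k. (s, t, k) \<in> L}) powr a2) powr a1)"
proof -
  have "block.fibre_weight (block_digits m1 m2 m3 L) (word_code m1 s)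
      = (\<Sum>t\<in>digit_words m2 N. real (card {k. (s, t, k) \<in> L}) powr a2)" if "s \<in> digit_words m1 N" for s
    unfolding block.fibre_weight_def
    by (subst sum.reindex_bij_betw[OF word_code_bij, symmetric]) (simp add: fibre_count_block that)
  then show ?thesis unfolding block.digit_weight_def
    by (subst sum.reindex_bij_betw[OF word_code_bij, symmetric]) simp
qed

end

definition block_sequence :: "nat \<Rightarrow> nat \<Rightarrow> nat \<Rightarrow> nat \<Rightarrow> (nat \<Rightarrow> nat \<times> nat \<times> nat) \<Rightarrow> nat \<Rightarrow> nat \<times> nat \<times> nat" where
  "block_sequence m1 m2 m3 N e j =
     (word_code m1 (map (\<lambda>i. fst (e (j * N + i))) [0..<N]),
      word_code m2 (map (\<lambda>i. fst (snd (e (j * N + i)))) [0..<N]),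
      word_code m3 (map (\<lambda>i. snd (snd (e (j * N + i)))) [0..<N]))"

lemma R_map_block_sequence:
  assumes "1 < m1" "1 < m2" "1 < m3" "0 < N"
    and "\<And>j. fst (e j) < m1" "\<And>j. fst (snd (e j)) < m2" "\<And>j. snd (snd (e j)) < m3"
  shows "R_map (m1 ^ N) (m2 ^ N) (m3 ^ N) (block_sequence m1 m2 m3 N e) = R_map m1 m2 m3 e"
proof -
  have "word_code m (map f [0..<N]) = digit_prefix m N f" for m f
    unfolding word_code_def by (auto intro: digit_prefix_cong)
  then show ?thesis unfolding R_map_def block_sequence_def
    using assms expansion_block[of m1 "\<lambda>j. fst (e j)" N] expansion_block[of m2 "\<lambda>j. fst (snd (e j))" N]
      expansion_block[of m3 "\<lambda>j. snd (snd (e j))" N] by simp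
qed

section \<open>Paths in the graph and their label words\<close>

context labeled_graph begin

primrec reach :: "'n \<Rightarrow> (nat \<times> nat \<times> nat) list \<Rightarrow> 'n \<Rightarrow> bool" where
  "reach p [] q \<longleftrightarrow> p = q"
| "reach p (l # ls) q \<longleftrightarrow> (\<exists>e\<in>arcs G. tail G e = p \<and> lab e = l \<and> reach (head G e) ls q)"

definition fibre :: "'n \<Rightarrow> 'n \<Rightarrow> nat list \<Rightarrow> nat list \<Rightarrow> nat list set" where
  "fibre p q s t = {k \<in> digit_words m3 (length s). reach p (zip s (zip t k)) q}"

abbreviation A :: "nat \<times> nat \<Rightarrow> real^'n^'n" where "A \<equiv> adjacency m3 G lab"

lemma finite_fibre_words [simp]: "finite (fibre p q s t)"
  unfolding fibre_def by simp

text \<open>Distinct edges from p to q carry distinct labels, so counting edges amounts to counting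
  third components of labels.\<close>

lemma adjacency_eq_card: "A (x, y) $ p $ q = real (card {k. k < m3 \<and> (\<exists>e\<in>arcs G. tail G e = p \<and> head G e = q \<and> lab e = (x, y, k))})"
proof -
  have "bij_betw (\<lambda>e. snd (snd (lab e))) {e \<in> arcs G. tail G e = p \<and> head G e = q \<and> (\<exists>k<m3. lab e = (x, y, k))}
     {k. k < m3 \<and> (\<exists>e\<in>arcs G. tail G e = p \<and> head G e = q \<and> lab e = (x, y, k))}"
    unfolding bij_betw_def
  proof
    show "inj_on (\<lambda>e. snd (snd (lab e))) {e \<in> arcs G. tail G e = p \<and> head G e = q \<and> (\<exists>k<m3. lab e = (x, y, k))}"
    proof (rule inj_onI)
      fix e e' assume "e \<in> {e \<in> arcs G. tail G e = p \<and> head G e = q \<and> (\<exists>k<m3. lab e = (x, y, k))}"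
        "e' \<in> {e \<in> arcs G. tail G e = p \<and> head G e = q \<and> (\<exists>k<m3. lab e = (x, y, k))}" "snd (snd (lab e)) = snd (snd (lab e'))"
      then have "e \<in> arcs G" "e' \<in> arcs G" "tail G e = tail G e'" "lab e = lab e'" by auto
      then show "e = e'" using right_resolving by blast
    qed
  qed force
  then show ?thesis by (simp add: adjacency_def bij_betw_same_card)
qed

text \<open>Matrix products count paths. By right resolution a path is determined by its first
  vertex and its labels, so the same entries count words without multiplicity.\<close>

lemma card_fibre:
  assumes "length s = length t"
  shows "real (card (fibre p q s t)) = matrix_word A (zip s t) $ p $ q"
  using assms
proof (induction s t arbitrary: p rule: list_induct2)
  case Nil
  have "fibre p q [] [] = (if p = q then {[]} else {})" by (auto simp: fibre_def)
  then show ?case by (simp add: mat_def)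
next
  case (Cons x s y t)
  define E where "E r = {k. k < m3 \<and> (\<exists>e\<in>arcs G. tail G e = p \<and> head G e = r \<and> lab e = (x, y, k))}" for r
  have finE: "finite (E r)" for r unfolding E_def by simp
  let ?S = "SIGMA r:UNIV. E r \<times> fibre r q s t"
  have "fibre p q (x # s) (y # t) = (\<lambda>(r, i, k). i # k) ` ?S"
  proof (intro equalityI subsetI)
    fix k assume "k \<in> fibre p q (x # s) (y # t)"
    then obtain i k' where k: "k = i # k'" "i < m3" "k' \<in> digit_words m3 (length s)" and
      r: "reach p ((x, y, i) # zip s (zip t k')) q"
      by (cases k) (auto simp: fibre_def digit_words_def)
    then obtain e where "e \<in> arcs G" "tail G e = p" "lab e = (x, y, i)" "reach (head G e) (zip s (zip t k')) q" by auto
    then have "(head G e, i, k') \<in> ?S" using k by (auto simp: E_def fibre_def)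
    then show "k \<in> (\<lambda>(r, i, k). i # k) ` ?S" using k(1) by force
  qed (auto simp: E_def fibre_def digit_words_def)
  moreover have "inj_on (\<lambda>(r, i, k). i # k) ?S"
  proof (rule inj_onI, clarsimp)
    fix r r' i k assume "i \<in> E r" "i \<in> E r'"
    then show "r = r'" unfolding E_def using right_resolving by force
  qed
  ultimately have "card (fibre p q (x # s) (y # t)) = card ?S" by (simp add: card_image)
  also have "\<dots> = (\<Sum>r\<in>UNIV. card (E r) * card (fibre r q s t))"
    using finE by (subst card_SigmaI) (auto simp: card_cartesian_product)
  finally show ?case
    using Cons.IH by (simp add: matrix_matrix_mult_def adjacency_eq_card E_def)
qed

lemma nonneg_adjacency: "nonneg_matrix (A q)"
  by (simp add: nonneg_matrix_def adjacency_def)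

lemma reach_path:
  assumes "\<And>k. \<pi> k \<in> arcs G \<and> head G (\<pi> k) = tail G (\<pi> (Suc k))"
  shows "reach (tail G (\<pi> n)) (map (\<lambda>i. lab (\<pi> (n + i))) [0..<N]) (tail G (\<pi> (n + N)))"
proof (induction N arbitrary: n)
  case (Suc N)
  have "map (\<lambda>i. lab (\<pi> (n + i))) [0..<Suc N] = lab (\<pi> n) # map (\<lambda>i. lab (\<pi> (Suc n + i))) [0..<N]"
    by (simp only: map_upt_Suc) simp
  moreover have "reach (head G (\<pi> n)) (map (\<lambda>i. lab (\<pi> (Suc n + i))) [0..<N]) (tail G (\<pi> (n + Suc N)))"
    using Suc.IH[of "Suc n"] assms[of n] by simp
  ultimately show ?case using assms[of n] by auto
qed simp

lemma reach_arcs: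
  assumes "reach p ls q"
  shows "\<exists>es. length es = length ls \<and> (\<forall>i<length ls. es ! i \<in> arcs G \<and> lab (es ! i) = ls ! i \<and>
    tail G (es ! i) = (if i = 0 then p else head G (es ! (i - 1)))) \<and> (if ls = [] then p else head G (last es)) = q"
  using assms
proof (induction ls arbitrary: p)
  case (Cons l ls)
  then obtain e where e: "e \<in> arcs G" "tail G e = p" "lab e = l" "reach (head G e) ls q" by auto
  from Cons.IH[OF e(4)] obtain es where es: "length es = length ls"
    "\<And>i. i < length ls \<Longrightarrow> es ! i \<in> arcs G \<and> lab (es ! i) = ls ! i \<and> tail G (es ! i) = (if i = 0 then head G e else head G (es ! (i - 1)))"
    "(if ls = [] then head G e else head G (last es)) = q" by blast
  show ?case
  proof (intro exI[of _ "e # es"] conjI allI impI)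
    fix i assume "i < length (l # ls)"
    then show "(e # es) ! i \<in> arcs G" "lab ((e # es) ! i) = (l # ls) ! i"
      "tail G ((e # es) ! i) = (if i = 0 then p else head G ((e # es) ! (i - 1)))"
      using e es(2)[of "i - 1"] by (auto simp: nth_Cons split: nat.split)
  qed (use es in auto)
qed simp

definition language :: "nat \<Rightarrow> (nat list \<times> nat list \<times> nat list) set" where
  "language N = {(s, t, k). s \<in> digit_words m1 N \<and> t \<in> digit_words m2 N \<and> k \<in> digit_words m3 N
     \<and> (\<exists>p q. reach p (zip s (zip t k)) q)}"

definition loops :: "'n \<Rightarrow> nat \<Rightarrow> (nat list \<times> nat list \<times> nat list) set" where
  "loops p N = {(s, t, k). s \<in> digit_words m1 N \<and> t \<in> digit_words m2 N \<and> k \<in> digit_words m3 N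
     \<and> reach p (zip s (zip t k)) p}"

lemma label_less:
  assumes "e \<in> arcs G"
  shows "fst (lab e) < m1" "fst (snd (lab e)) < m2" "snd (snd (lab e)) < m3"
  using labels assms by (auto simp: mem_Times_iff image_subset_iff)

lemma m_gt_1: "1 < m1" "1 < m2" "1 < m3"
  using m_bounds by auto

lemma zip3_map: "zip (map f xs) (zip (map g xs) (map h xs)) = map (\<lambda>i. (f i, g i, h i)) xs"
  by (induction xs) auto

text \<open>A path is cut at the multiples of N; each piece spells a word of the language, whatever
  vertices it joins.\<close>

lemma sofic_set_subset_language:
  assumes N: "1 \<le> N"
  shows "sofic_set m1 m2 m3 G lab \<subseteq> R_map (m1 ^ N) (m2 ^ N) (m3 ^ N) ` sequences_over (block_digits m1 m2 m3 (language N))"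
  unfolding sofic_set_def
proof (rule image_subsetI)
  fix e assume "e \<in> sofic_system G lab"
  then obtain \<pi> where e: "e = lab \<circ> \<pi>" and \<pi>: "\<And>k. \<pi> k \<in> arcs G \<and> head G (\<pi> k) = tail G (\<pi> (Suc k))"
    unfolding sofic_system_def by blast
  have less: "fst (e j) < m1" "fst (snd (e j)) < m2" "snd (snd (e j)) < m3" for j
    using label_less \<pi> by (auto simp: e)
  have "block_sequence m1 m2 m3 N e j \<in> block_digits m1 m2 m3 (language N)" for j
  proof -
    let ?s = "map (\<lambda>i. fst (e (j * N + i))) [0..<N]" and ?t = "map (\<lambda>i. fst (snd (e (j * N + i)))) [0..<N]"
      and ?k = "map (\<lambda>i. snd (snd (e (j * N + i)))) [0..<N]"
    have "zip ?s (zip ?t ?k) = map (\<lambda>i. lab (\<pi> (j * N + i))) [0..<N]"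
      unfolding zip3_map by (simp add: e)
    then have "reach (tail G (\<pi> (j * N))) (zip ?s (zip ?t ?k)) (tail G (\<pi> (j * N + N)))"
      using reach_path[where \<pi> = \<pi>, OF \<pi>] by simp
    then have "(?s, ?t, ?k) \<in> language N" using less by (auto simp: language_def digit_words_def)
    then show ?thesis by (force simp: block_digits_def block_sequence_def)
  qed
  moreover have "R_map m1 m2 m3 e = R_map (m1 ^ N) (m2 ^ N) (m3 ^ N) (block_sequence m1 m2 m3 N e)"
    using m_gt_1 N less by (intro R_map_block_sequence[symmetric]) auto
  ultimately show "R_map m1 m2 m3 e \<in> R_map (m1 ^ N) (m2 ^ N) (m3 ^ N) ` sequences_over (block_digits m1 m2 m3 (language N))"
    by (auto simp: sequences_over_def)
qed

text \<open>Loops at one vertex can be concatenated in any order, so every sequence of such blocks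
  is spelled by a path.\<close>

lemma loops_subset_sofic_set:
  assumes N: "1 \<le> N"
  shows "R_map (m1 ^ N) (m2 ^ N) (m3 ^ N) ` sequences_over (block_digits m1 m2 m3 (loops p N)) \<subseteq> sofic_set m1 m2 m3 G lab"
proof (rule image_subsetI)
  fix x assume "x \<in> sequences_over (block_digits m1 m2 m3 (loops p N))"
  then have "\<forall>j. \<exists>w. w \<in> loops p N \<and> x j = (word_code m1 (fst w), word_code m2 (fst (snd w)), word_code m3 (snd (snd w)))"
    by (force simp: sequences_over_def block_digits_def)
  from choice[OF this] obtain w where w: "\<And>j. w j \<in> loops p N"
    "\<And>j. x j = (word_code m1 (fst (w j)), word_code m2 (fst (snd (w j))), word_code m3 (snd (snd (w j))))" by blast
  define ls where "ls j = zip (fst (w j)) (zip (fst (snd (w j))) (snd (snd (w j))))" for j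
  have len: "length (fst (w j)) = N" "length (fst (snd (w j))) = N" "length (snd (snd (w j))) = N" for j
    using w(1)[of j] by (auto simp: loops_def digit_words_def)
  have ls: "length (ls j) = N" "reach p (ls j) p" for j
    using w(1)[of j] len[of j] by (auto simp: ls_def loops_def)
  have "\<forall>j. \<exists>es. length es = N \<and> (\<forall>i<N. es ! i \<in> arcs G \<and> lab (es ! i) = ls j ! i \<and>
    tail G (es ! i) = (if i = 0 then p else head G (es ! (i - 1)))) \<and> head G (es ! (N - 1)) = p"
  proof
    fix j
    obtain es where es: "length es = N" "\<forall>i<N. es ! i \<in> arcs G \<and> lab (es ! i) = ls j ! i \<and>
      tail G (es ! i) = (if i = 0 then p else head G (es ! (i - 1)))" "(if ls j = [] then p else head G (last es)) = p"
      using reach_arcs[OF ls(2)[of j]] ls(1)[of j] by auto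
    moreover have "head G (es ! (N - 1)) = p"
    proof -
      have "ls j \<noteq> []" "es \<noteq> []" using ls(1)[of j] es(1) N by auto
      then show ?thesis using es(1,3) by (simp add: last_conv_nth)
    qed
    ultimately show "\<exists>es. length es = N \<and> (\<forall>i<N. es ! i \<in> arcs G \<and> lab (es ! i) = ls j ! i \<and>
      tail G (es ! i) = (if i = 0 then p else head G (es ! (i - 1)))) \<and> head G (es ! (N - 1)) = p" by blast
  qed
  from choice[OF this] obtain es where es: "\<And>j i. i < N \<Longrightarrow> es j ! i \<in> arcs G" "\<And>j i. i < N \<Longrightarrow> lab (es j ! i) = ls j ! i"
    "\<And>j i. i < N \<Longrightarrow> tail G (es j ! i) = (if i = 0 then p else head G (es j ! (i - 1)))" "\<And>j. head G (es j ! (N - 1)) = p"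
    by blast
  \<comment> \<open>The chosen paths of the blocks, strung together. At the seams, the end
    \<open>p\<close> of one block is the start of the next.\<close>
  define \<pi> where "\<pi> n = es (n div N) ! (n mod N)" for n
  have \<pi>: "\<pi> n \<in> arcs G \<and> head G (\<pi> n) = tail G (\<pi> (Suc n))" for n
  proof -
    have "n mod N < N" "Suc n mod N < N" using N by simp_all
    moreover have "head G (\<pi> n) = tail G (\<pi> (Suc n))"
    proof (cases "Suc (n mod N) = N")
      case True
      then have "Suc n mod N = 0" "n mod N = N - 1" by (simp_all add: mod_Suc)
      then show ?thesis unfolding \<pi>_def using es(3)[of "Suc n mod N" "Suc n div N"] es(4)[of "n div N"] N by simp
    next
      case False
      then have "Suc n mod N = Suc (n mod N)" "Suc n div N = n div N" by (simp_all add: mod_Suc div_Suc)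
      then show ?thesis unfolding \<pi>_def using es(3)[of "Suc n mod N" "Suc n div N"] \<open>Suc n mod N < N\<close> by simp
    qed
    ultimately show ?thesis using es(1) by (simp add: \<pi>_def)
  qed
  define e where "e = lab \<circ> \<pi>"
  have eS: "e \<in> sofic_system G lab" unfolding sofic_system_def e_def using \<pi> by blast
  have less: "fst (e j) < m1" "fst (snd (e j)) < m2" "snd (snd (e j)) < m3" for j
    using label_less \<pi> by (auto simp: e_def)
  have eb: "e (j * N + i) = (fst (w j) ! i, fst (snd (w j)) ! i, snd (snd (w j)) ! i)" if "i < N" for i j
    using that es(2)[OF that, of j] len[of j] by (simp add: e_def \<pi>_def ls_def)
  have "block_sequence m1 m2 m3 N e j = x j" for j
  proof -
    have "map (\<lambda>i. fst (e (j * N + i))) [0..<N] = fst (w j)" "map (\<lambda>i. fst (snd (e (j * N + i)))) [0..<N] = fst (snd (w j))"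
      "map (\<lambda>i. snd (snd (e (j * N + i)))) [0..<N] = snd (snd (w j))"
      using eb len[of j] by (auto intro!: nth_equalityI)
    then show ?thesis by (simp add: block_sequence_def w(2))
  qed
  then have "block_sequence m1 m2 m3 N e = x" by blast
  then have "R_map (m1 ^ N) (m2 ^ N) (m3 ^ N) x = R_map m1 m2 m3 e"
    using m_gt_1 N less R_map_block_sequence[of m1 m2 m3 N e] by auto
  then show "R_map (m1 ^ N) (m2 ^ N) (m3 ^ N) x \<in> sofic_set m1 m2 m3 G lab"
    using eS by (simp add: sofic_set_def)
qed

end


section \<open>The dimension of a primitive sofic set\<close>

text \<open>The expression is the cube of (N * m + 1) * y ^ N, where y is the cube root of x, and N
  * y ^ N tends to 0.\<close>

lemma cubic_times_power_tendsto_0: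
  assumes x: "0 < x" "x < (1::real)"
  shows "(\<lambda>N. (real N * m + 1) ^ 3 * x ^ N) \<longlonglongrightarrow> 0"
proof -
  define y where "y = x powr (1 / 3)"
  have y: "0 < y" "y < 1" using x powr_less_mono2[of "1 / 3" x 1] by (auto simp: y_def)
  have "(\<lambda>N. m * (real N * y ^ N) + y ^ N) \<longlonglongrightarrow> m * 0 + 0"
    using y by (intro tendsto_intros powser_times_n_limit_0 LIMSEQ_power_zero) auto
  then have "(\<lambda>N. (m * (real N * y ^ N) + y ^ N) ^ 3) \<longlonglongrightarrow> (m * 0 + 0) ^ 3"
    by (rule tendsto_power)
  moreover have "(m * (real N * y ^ N) + y ^ N) ^ 3 = (real N * m + 1) ^ 3 * x ^ N" for N
  proof -
    have "y ^ 3 = x" using x by (simp add: y_def powr_power)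
    then have "(y ^ N) ^ 3 = x ^ N" by (metis power_mult mult.commute)
    moreover have "m * (real N * y ^ N) + y ^ N = (real N * m + 1) * y ^ N" by (simp add: algebra_simps)
    ultimately show ?thesis by (simp add: power_mult_distrib)
  qed
  ultimately show ?thesis by simp
qed

lemma (in word_sums) total_eq:
  "total \<phi> N = (\<Sum>s\<in>digit_words m1 N. (\<Sum>t\<in>digit_words m2 N. \<phi> (zip s t) powr a2) powr a1)"
  unfolding total_def column_def by (intro sum.cong refl) (simp add: length_digit_words)

lemma one_le_if_natural: "x = real n \<Longrightarrow> x \<noteq> 0 \<Longrightarrow> 1 \<le> x"
  by simp

locale primitive_sofic = labeled_graph G m1 m2 m3 lab
  for G :: "('n::finite, 'e) pre_digraph" and m1 m2 m3 lab +
  fixes a1 a2 :: real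
  assumes a1: "a1 = log (real m2) (real m1)"
    and a2: "a2 = log (real m3) (real m2)"
    and primitive: "primitive_matrix (\<Sum>w\<in>{..<m1} \<times> {..<m2}. A w)"
begin

sublocale bases: torus_bases m1 m2 m3 a1 a2
  using m_bounds a1 a2 by unfold_locales

sublocale word_sums m1 m2 a1 a2
  using bases.a1_bounds bases.a2_bounds by unfold_locales

abbreviation mw :: "(nat \<times> nat) list \<Rightarrow> real^'n^'n" where "mw \<equiv> matrix_word A"

definition W :: "nat \<Rightarrow> real" where "W = total (\<lambda>w. entry_sum (mw w))"

lemma nonneg_mw: "nonneg_matrix (mw w)"
  by (rule nonneg_matrix_word) (rule nonneg_adjacency)

lemma mw_entry_nonneg [simp]: "0 \<le> mw w $ p $ q"
  using nonneg_mw[of w] by (simp add: nonneg_matrix_def)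

definition power_sum :: "nat \<Rightarrow> real^'n^'n" where
  "power_sum d = (\<Sum>s\<in>digit_words m1 d. \<Sum>t\<in>digit_words m2 d. mw (zip s t))"

lemma power_sum_entry: "power_sum d $ p $ q = (\<Sum>s\<in>digit_words m1 d. \<Sum>t\<in>digit_words m2 d. mw (zip s t) $ p $ q)"
  by (simp add: power_sum_def)

text \<open>The entries are numbers of words, so a positive entry is at least 1.\<close>

lemma primitive_power: "\<exists>d\<ge>1. \<forall>p q. 1 \<le> power_sum d $ p $ q"
proof -
  obtain d where d: "d \<ge> 1" "\<And>p q. 0 < power_sum d $ p $ q"
    using primitive unfolding primitive_matrix_def matrix_power_sum power_sum_def by blast
  have "1 \<le> power_sum d $ p $ q" for p q
  proof -
    have "power_sum d $ p $ q = real (\<Sum>s\<in>digit_words m1 d. \<Sum>t\<in>digit_words m2 d. card (fibre p q s t))"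
      unfolding power_sum_entry of_nat_sum by (intro sum.cong refl) (simp add: card_fibre length_digit_words)
    then show ?thesis by (rule one_le_if_natural) (use d(2)[of p q] in linarith)
  qed
  with d(1) show ?thesis by blast
qed

text \<open>With P = \<open>power_sum d\<close>, the (i, j) entry of the product of P,
  \<open>mw w\<close> and P is a sum of all entries of \<open>mw w\<close> with coefficients at
  least 1. In other words, \<open>d\<close> letters on either side connect any path to prescribed
  end vertices.\<close>

lemma entry_sum_le_sandwich:
  assumes d: "\<forall>p q. 1 \<le> power_sum d $ p $ q"
  shows "entry_sum (mw w) \<le> (\<Sum>s'\<in>digit_words m1 d. \<Sum>s''\<in>digit_words m1 d.
    \<Sum>t'\<in>digit_words m2 d. \<Sum>t''\<in>digit_words m2 d. mw (zip s' t' @ w @ zip s'' t'') $ i $ j)"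
proof -
  let ?P = "power_sum d"
  have "entry_sum (mw w) \<le> (\<Sum>q\<in>UNIV. \<Sum>p\<in>UNIV. ?P $ i $ p * mw w $ p $ q * ?P $ q $ j)"
    unfolding entry_sum_def
  proof (subst sum.swap, intro sum_mono)
    fix p q
    have "1 * mw w $ p $ q * 1 \<le> ?P $ i $ p * mw w $ p $ q * ?P $ q $ j"
      using d by (intro mult_mono mult_nonneg_nonneg) (auto intro: order_trans[OF zero_le_one])
    then show "mw w $ p $ q \<le> ?P $ i $ p * mw w $ p $ q * ?P $ q $ j" by simp
  qed
  also have "\<dots> = ((?P ** mw w) ** ?P) $ i $ j"
    by (simp add: matrix_matrix_mult_def sum_distrib_right)
  also have "(?P ** mw w) ** ?P = (\<Sum>s'\<in>digit_words m1 d. \<Sum>t'\<in>digit_words m2 d. (mw (zip s' t') ** mw w) ** ?P)"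
    by (subst (1) power_sum_def) (simp only: matrix_mult_sum_left)
  also have "\<dots> = (\<Sum>s'\<in>digit_words m1 d. \<Sum>t'\<in>digit_words m2 d. \<Sum>s''\<in>digit_words m1 d. \<Sum>t''\<in>digit_words m2 d. mw (zip s' t' @ w @ zip s'' t''))"
    unfolding power_sum_def by (simp add: matrix_mult_sum_right matrix_word_append matrix_mul_assoc)
  also have "\<dots> = (\<Sum>s'\<in>digit_words m1 d. \<Sum>s''\<in>digit_words m1 d. \<Sum>t'\<in>digit_words m2 d. \<Sum>t''\<in>digit_words m2 d. mw (zip s' t' @ w @ zip s'' t''))"
    by (intro sum.cong refl sum.swap)
  finally show ?thesis by simp
qed

lemma W_le_loops:
  assumes d: "\<forall>p q. 1 \<le> power_sum d $ p $ q"
  shows "W N \<le> total (\<lambda>w. mw w $ i $ i) (d + (N + d))"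
  using total_le_extension[of "\<lambda>w. entry_sum (mw w)" "\<lambda>w. mw w $ i $ i" 1 d d N] entry_sum_le_sandwich[OF d]
  by (simp add: W_def entry_sum_nonneg nonneg_mw)

text \<open>Primitivity provides words leading from \<open>p\<close> back to \<open>p\<close>; the
  first letter of such a word is the step.\<close>

lemma exists_step: "\<exists>x<m1. \<exists>y<m2. \<exists>q. 1 \<le> A (x, y) $ p $ q"
proof -
  obtain d where d: "d \<ge> 1" "\<forall>p q. 1 \<le> power_sum d $ p $ q" using primitive_power by blast
  then obtain d' where d': "d = Suc d'" by (cases d) auto
  have "power_sum d $ p $ p \<noteq> 0" using d(2)[rule_format, of p p] by linarith
  then obtain s t where st: "s \<in> digit_words m1 d" "t \<in> digit_words m2 d" "mw (zip s t) $ p $ p \<noteq> 0"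
    unfolding power_sum_entry by (meson sum.neutral)
  obtain x s' where s: "s = x # s'" "x < m1" using st(1) d' by (cases s) (auto simp: digit_words_def)
  obtain y t' where t: "t = y # t'" "y < m2" using st(2) d' by (cases t) (auto simp: digit_words_def)
  have "(\<Sum>q\<in>UNIV. A (x, y) $ p $ q * mw (zip s' t') $ q $ p) \<noteq> 0"
    using st(3) by (simp add: s t matrix_matrix_mult_def)
  then obtain q where "A (x, y) $ p $ q \<noteq> 0" by (metis (no_types, lifting) mult_zero_left sum.neutral)
  then have "1 \<le> A (x, y) $ p $ q" by (rule one_le_if_natural[OF adjacency_eq_card])
  with s t show ?thesis by blast
qed

lemma exists_word: "\<exists>s\<in>digit_words m1 N. \<exists>t\<in>digit_words m2 N. \<exists>q. 1 \<le> mw (zip s t) $ p $ q"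
proof (induction N arbitrary: p)
  case 0
  show ?case by (simp add: mat_def)
next
  case (Suc N)
  obtain x y r where x: "x < m1" "y < m2" "1 \<le> A (x, y) $ p $ r" using exists_step by blast
  obtain s t q where s: "s \<in> digit_words m1 N" "t \<in> digit_words m2 N" "1 \<le> mw (zip s t) $ r $ q" using Suc by blast
  have "1 * 1 \<le> A (x, y) $ p $ r * mw (zip s t) $ r $ q" using x s by (intro mult_mono) auto
  also have "\<dots> \<le> (\<Sum>r\<in>UNIV. A (x, y) $ p $ r * mw (zip s t) $ r $ q)"
    by (rule member_le_sum) (auto simp: adjacency_def)
  finally have "1 \<le> mw (zip (x # s) (y # t)) $ p $ q" by (simp add: matrix_matrix_mult_def)
  moreover have "x # s \<in> digit_words m1 (Suc N)" "y # t \<in> digit_words m2 (Suc N)"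
    using x s by (auto simp: digit_words_def)
  ultimately show ?case by blast
qed

sublocale submultiplicative W
proof
  fix M N
  show "W (M + N) \<le> W M * W N"
    unfolding W_def by (rule total_submult) (auto simp: entry_sum_nonneg nonneg_mw matrix_word_append entry_sum_mult_le)
  obtain s t p q where s: "s \<in> digit_words m1 N" "t \<in> digit_words m2 N" "1 \<le> mw (zip s t) $ p $ q"
    using exists_word by blast
  have "1 \<le> entry_sum (mw (zip s t))" using s(3) entry_le_entry_sum[OF nonneg_mw] by (rule order_trans)
  then have "1 \<le> entry_sum (mw (zip s t)) powr a2" using a2_bounds by (simp add: ge_one_powr_ge_zero)
  also have "\<dots> \<le> column (\<lambda>w. entry_sum (mw w)) s"
    unfolding column_def using s by (intro member_le_sum[of t]) (auto simp: length_digit_words)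
  finally have "1 \<le> column (\<lambda>w. entry_sum (mw w)) s powr a1" using a1_bounds by (simp add: ge_one_powr_ge_zero)
  also have "\<dots> \<le> W N" unfolding W_def total_def using s by (intro member_le_sum[of s]) auto
  finally show "1 \<le> W N" .
qed

lemma hausdorff_measure_sofic_eq_0:
  assumes s: "0 < \<sigma>" "growth W < real m1 powr \<sigma>"
  shows "hausdorff_measure \<sigma> (sofic_set m1 m2 m3 G lab) = 0"
proof -
  obtain N where N: "N \<ge> 1" "W N < (real m1 powr \<sigma>) ^ N" using growth_less[OF s(2)] by blast
  interpret b: block_bases m1 m2 m3 a1 a2 N "language N"
    using N by unfold_locales (auto simp: language_def)
  obtain s t p q where st: "s \<in> digit_words m1 N" "t \<in> digit_words m2 N" "1 \<le> mw (zip s t) $ p $ q"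
    using exists_word by blast
  then have "fibre p q s t \<noteq> {}" using card_fibre[of s t p q] by (auto simp: length_digit_words)
  then obtain k where "k \<in> fibre p q s t" by blast
  then have "(s, t, k) \<in> language N" using st by (auto simp: language_def fibre_def length_digit_words)
  then have ne: "block_digits m1 m2 m3 (language N) \<noteq> {}" by (auto simp: block_digits_def)
  have "b.block.digit_weight (block_digits m1 m2 m3 (language N)) \<le> W N"
    unfolding b.digit_weight_block W_def total_eq
  proof (intro sum_mono powr_mono2)
    fix s t assume s: "s \<in> digit_words m1 N" and t: "t \<in> digit_words m2 N"
    \<comment> \<open>A word of the language is counted once here, but in the entry sum once for
      each pair of vertices that it joins.\<close>
    have "{k. (s, t, k) \<in> language N} = (\<Union>p. \<Union>q. fibre p q s t)"
      using s t by (auto simp: language_def fibre_def length_digit_words)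
    then have "card {k. (s, t, k) \<in> language N} \<le> (\<Sum>p\<in>UNIV. \<Sum>q\<in>UNIV. card (fibre p q s t))"
      by (simp add: order_trans[OF card_UN_le sum_mono] card_UN_le)
    then have "real (card {k. (s, t, k) \<in> language N}) \<le> real (\<Sum>p\<in>UNIV. \<Sum>q\<in>UNIV. card (fibre p q s t))"
      by (simp only: of_nat_le_iff)
    also have "\<dots> = entry_sum (mw (zip s t))"
      using s t by (simp add: entry_sum_def card_fibre length_digit_words)
    finally show "real (card {k. (s, t, k) \<in> language N}) \<le> entry_sum (mw (zip s t))" .
  qed (use a1_bounds a2_bounds in \<open>auto simp: length_digit_words intro!: sum_nonneg\<close>)
  also have "W N < real (m1 ^ N) powr \<sigma>"
    using N m_gt_1 by (simp add: powr_power powr_powr mult.commute flip: powr_realpow)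
  finally have "hausdorff_measure \<sigma> (R_map (m1 ^ N) (m2 ^ N) (m3 ^ N) ` sequences_over (block_digits m1 m2 m3 (language N))) = 0"
    using s(1) ne b.block_digits_box by (intro b.block.hausdorff_measure_sponge_eq_0) auto
  then show ?thesis using hausdorff_measure_mono[OF sofic_set_subset_language[OF N(1)], of \<sigma>] by simp
qed

lemma hausdorff_measure_sofic_ne_0:
  assumes s: "0 < \<sigma>" "real m1 powr \<sigma> < growth W"
  shows "hausdorff_measure \<sigma> (sofic_set m1 m2 m3 G lab) \<noteq> 0"
proof -
  obtain d where d: "d \<ge> 1" "\<forall>p q. 1 \<le> power_sum d $ p $ q" using primitive_power by blast
  fix i :: 'n
  define g where "g = growth W"
  define q where "q = real m1 powr \<sigma>"
  have g: "0 < g" "1 \<le> g" "0 < q" "q < g" using growth_ge_1 s m_gt_1 by (auto simp: g_def q_def)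
  \<comment> \<open>For the bases m_i ^ N, \<open>class_loss\<close> is at most 4 * (N * m3 + 1) ^
    3. As q < g, multiplication by (q / g) ^ N brings it below 1 / g ^ (2 * d), the price of the 2 *
    d letters that close words into loops.\<close>
  have "(\<lambda>N. 4 * ((real N * real m3 + 1) ^ 3 * (q / g) ^ N)) \<longlonglongrightarrow> 4 * 0"
    using g by (intro tendsto_mult tendsto_const cubic_times_power_tendsto_0) auto
  then have "eventually (\<lambda>N. 4 * ((real N * real m3 + 1) ^ 3 * (q / g) ^ N) < 1 / g ^ (2 * d)) sequentially"
    by (rule order_tendstoD(2)) (use g in simp)
  then obtain N0 where N0: "\<And>N. N \<ge> N0 \<Longrightarrow> 4 * ((real N * real m3 + 1) ^ 3 * (q / g) ^ N) < 1 / g ^ (2 * d)"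
    by (auto simp: eventually_sequentially)
  define N where "N = d + (N0 + d)"
  have N: "N \<ge> 1" "N \<ge> N0" using d(1) by (auto simp: N_def)
  interpret b: block_bases m1 m2 m3 a1 a2 N "loops i N"
    using N by unfold_locales (auto simp: loops_def)
  have lg: "real (lg (m ^ N)) \<le> real N * real m3" if "1 < m" "m \<le> m3" for m
  proof -
    have "2 ^ lg (m ^ N) \<le> m ^ N" using that by (intro lg_le) simp
    also have "\<dots> \<le> (2 ^ m) ^ N" using that by (intro power_mono) (auto intro: less_imp_le less_exp)
    also have "\<dots> \<le> 2 ^ (m * N)" by (simp add: power_mult)
    finally have "lg (m ^ N) \<le> m * N" by simp
    also have "\<dots> \<le> m3 * N" using that by simp
    finally have "real (lg (m ^ N)) \<le> real (m3 * N)" by (simp only: of_nat_le_iff)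
    then show ?thesis by (simp add: mult.commute)
  qed
  have "b.block.class_loss \<le> 4 * (real N * real m3 + 1)\<^sup>2 * (real N * real m3 + 1)"
    unfolding b.block.class_loss_def using lg[of m3] lg[of m2] m_bounds m_gt_1
    by (intro mult_mono power_mono add_mono) auto
  then have cl: "b.block.class_loss \<le> 4 * (real N * real m3 + 1) ^ 3"
    by (simp add: power2_eq_square power3_eq_cube mult_ac)
  have "b.block.class_loss * real (m1 ^ N) powr \<sigma> \<le> 4 * (real N * real m3 + 1) ^ 3 * q ^ N"
  proof -
    have "real (m1 ^ N) powr \<sigma> = q ^ N"
      using m_gt_1 by (simp add: q_def powr_power powr_powr mult.commute flip: powr_realpow)
    then show ?thesis using cl g by (intro mult_mono) auto
  qed
  also have "\<dots> = (4 * ((real N * real m3 + 1) ^ 3 * (q / g) ^ N)) * g ^ N"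
    using g by (simp add: power_divide)
  also have "\<dots> \<le> 1 / g ^ (2 * d) * g ^ N" using N0[OF N(2)] g by (intro mult_right_mono) auto
  also have "\<dots> = g ^ N0"
  proof -
    have "N = 2 * d + N0" by (simp add: N_def)
    then have "g ^ N = g ^ (2 * d) * g ^ N0" by (simp only: power_add)
    then show ?thesis using g by simp
  qed
  also have "\<dots> \<le> W N0" unfolding g_def by (rule growth_power_le)
  also have "\<dots> \<le> total (\<lambda>w. mw w $ i $ i) N" unfolding N_def by (rule W_le_loops[OF d(2)])
  also have "\<dots> = b.block.digit_weight (block_digits m1 m2 m3 (loops i N))"
    unfolding b.digit_weight_block total_eq
  proof (intro sum.cong refl arg_cong[where f = "\<lambda>x. x powr a1"] arg_cong[where f = "\<lambda>x. x powr a2"])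
    fix s t assume s: "s \<in> digit_words m1 N" and t: "t \<in> digit_words m2 N"
    have "{k. (s, t, k) \<in> loops i N} = fibre i i s t"
      using s t by (auto simp: loops_def fibre_def length_digit_words)
    then show "mw (zip s t) $ i $ i = real (card {k. (s, t, k) \<in> loops i N})"
      using s t by (simp add: card_fibre length_digit_words)
  qed
  finally have le: "b.block.class_loss * real (m1 ^ N) powr \<sigma> \<le> b.block.digit_weight (block_digits m1 m2 m3 (loops i N))" .
  have "0 < b.block.class_loss * real (m1 ^ N) powr \<sigma>"
    using m_gt_1 unfolding b.block.class_loss_def by (intro mult_pos_pos) auto
  then have "b.block.digit_weight (block_digits m1 m2 m3 (loops i N)) \<noteq> 0" using le by linarith
  then have ne: "block_digits m1 m2 m3 (loops i N) \<noteq> {}"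
    by (auto simp: b.block.digit_weight_def b.block.fibre_weight_def b.block.fibre_count_def)
  have "hausdorff_measure \<sigma> (R_map (m1 ^ N) (m2 ^ N) (m3 ^ N) ` sequences_over (block_digits m1 m2 m3 (loops i N))) \<noteq> 0"
    using b.block_digits_box ne s(1) le by (rule b.block.hausdorff_measure_sponge_ne_0)
  then show ?thesis using hausdorff_measure_mono[OF loops_subset_sofic_set[OF N(1)], of \<sigma> i] by auto
qed

lemma hausdorff_dim_sofic:
  "hausdorff_dim (sofic_set m1 m2 m3 G lab) = ereal (log (real m1) (growth W))"
proof (rule antisym)
  let ?X = "sofic_set m1 m2 m3 G lab" and ?l = "log (real m1) (growth W)"
  \<comment> \<open>The dimension is an infimum over positive exponents; since this logarithm is
    nonnegative, every exponent above it is admissible.\<close>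
  have l0: "0 \<le> ?l" using growth_ge_1 m_gt_1 by (subst zero_le_log_cancel_iff) auto
  have g: "growth W = real m1 powr ?l" using growth_ge_1 m_gt_1 by simp
  show "hausdorff_dim ?X \<le> ereal ?l"
  proof (rule dense_ge)
    fix z assume z: "ereal ?l < z"
    show "hausdorff_dim ?X \<le> z"
    proof (cases z)
      case (real r)
      then have r: "?l < r" using z by simp
      have "growth W < real m1 powr r" by (subst g) (use r m_gt_1 in simp)
      then have "hausdorff_measure r ?X = 0" using l0 r by (intro hausdorff_measure_sofic_eq_0) auto
      then show ?thesis unfolding hausdorff_dim_def using l0 r real by (intro Inf_lower) auto
    qed (use z in auto)
  qed
  show "ereal ?l \<le> hausdorff_dim ?X"
    unfolding hausdorff_dim_def
  proof (rule Inf_greatest, clarify)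
    fix s :: real assume s: "0 < s" "hausdorff_measure s ?X = 0"
    have "\<not> s < ?l"
    proof
      assume "s < ?l"
      then have "real m1 powr s < growth W" by (subst g) (use m_gt_1 in simp)
      then show False using hausdorff_measure_sofic_ne_0[OF s(1)] s(2) by blast
    qed
    then show "ereal ?l \<le> ereal s" by simp
  qed
qed

end


section \<open>Recursive structure\<close>

definition avoiding_words :: "nat \<Rightarrow> nat \<Rightarrow> nat \<Rightarrow> nat list set" where
  "avoiding_words m u N = {s. s \<in> lists ({..<m} - {u}) \<and> length s = N}"

lemma sum_avoiding_words_Suc:
  "(\<Sum>s\<in>avoiding_words m u (Suc N). g s) = (\<Sum>x\<in>{..<m} - {u}. \<Sum>s\<in>avoiding_words m u N. g (x # s))"
proof -
  have "(\<Sum>s\<in>avoiding_words m u (Suc N). g s) = (\<Sum>(x, s)\<in>({..<m} - {u}) \<times> avoiding_words m u N. g (x # s))"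
    by (rule sum.reindex_bij_witness[of _ "\<lambda>(x, xs). x # xs" "\<lambda>xs. (hd xs, tl xs)"])
      (auto simp: avoiding_words_def length_Suc_conv)
  then show ?thesis by (simp add: sum.cartesian_product)
qed

text \<open>Words are sorted by the position k of their first \<open>u\<close>: the letters before
  it avoid \<open>u\<close>, those after it are free.\<close>

lemma sum_first_occurrence:
  assumes u: "u < m"
  shows "(\<Sum>s\<in>digit_words m N. h s) = (\<Sum>s\<in>avoiding_words m u N. h s)
    + (\<Sum>k<N. \<Sum>s\<in>avoiding_words m u k. \<Sum>s'\<in>digit_words m (N - Suc k). h (s @ u # s'))"
proof (induction N arbitrary: h)
  case 0
  have "avoiding_words m u 0 = {[]}" by (auto simp: avoiding_words_def)
  then show ?case by simp
next
  case (Suc N)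
  have "(\<Sum>s\<in>digit_words m (Suc N). h s)
      = (\<Sum>s\<in>digit_words m N. h (u # s)) + (\<Sum>x\<in>{..<m} - {u}. \<Sum>s\<in>digit_words m N. h (x # s))"
    unfolding sum_digit_words_Suc using u by (simp add: sum.remove)
  also have "(\<Sum>x\<in>{..<m} - {u}. \<Sum>s\<in>digit_words m N. h (x # s))
      = (\<Sum>s\<in>avoiding_words m u (Suc N). h s) + (\<Sum>k<N. \<Sum>s\<in>avoiding_words m u (Suc k). \<Sum>s'\<in>digit_words m (N - Suc k). h (s @ u # s'))"
  proof -
    have "(\<Sum>x\<in>{..<m} - {u}. \<Sum>k<N. \<Sum>s\<in>avoiding_words m u k. \<Sum>s'\<in>digit_words m (N - Suc k). h (x # s @ u # s'))
      = (\<Sum>k<N. \<Sum>x\<in>{..<m} - {u}. \<Sum>s\<in>avoiding_words m u k. \<Sum>s'\<in>digit_words m (N - Suc k). h (x # s @ u # s'))"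
      by (rule sum.swap)
    then show ?thesis by (simp add: Suc.IH sum.distrib sum_avoiding_words_Suc)
  qed
  also have "(\<Sum>s\<in>digit_words m N. h (u # s))
      = (\<Sum>s\<in>avoiding_words m u 0. \<Sum>s'\<in>digit_words m N. h (s @ u # s'))"
  proof -
    have "avoiding_words m u 0 = {[]}" by (auto simp: avoiding_words_def)
    then show ?thesis by simp
  qed
  finally show ?case by (subst sum.lessThan_Suc_shift) (simp add: add_ac)
qed

text \<open>Nonnegativity of \<open>v\<close> is an assumption here. At the end \<open>v\<close> is
  replaced by a suitable multiple, which changes none of the coefficients.\<close>

locale recursive_sofic = primitive_sofic G m1 m2 m3 lab a1 a2
  for G :: "('n::finite, 'e) pre_digraph" and m1 m2 m3 lab a1 a2 +
  fixes v :: "real^'n" and u :: nat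
  assumes recursive: "recursive_structure m1 m2 A v"
    and removable: "removable m1 m2 A v u"
    and v_nonneg: "\<And>q. 0 \<le> v $ q"
begin

abbreviation P :: "nat \<Rightarrow> nat set" where "P \<equiv> P_set m2 A v"
abbreviation J :: "nat set" where "J \<equiv> J_set m1 m2 A v"

definition vsum :: real where "vsum = (\<Sum>q\<in>UNIV. v $ q)"

text \<open>Extends \<open>D_coeff\<close> to all words, including those after which the row vector
  is no multiple of \<open>v\<close>; on words that end with a letter of Q the two agree.\<close>

definition \<delta> :: "(nat \<times> nat) list \<Rightarrow> real" where
  "\<delta> w = (\<Sum>q\<in>UNIV. (v v* mw w) $ q) / vsum"

lemma vsum_pos: "0 < vsum"
proof -
  obtain q where "v $ q \<noteq> 0" using recursive by (auto simp: recursive_structure_def vec_eq_iff)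
  then have "0 < v $ q" using v_nonneg[of q] by simp
  then show ?thesis unfolding vsum_def using v_nonneg by (intro sum_pos2[of _ q]) auto
qed

lemma vector_mw: "(v v* mw w) $ q = (\<Sum>p\<in>UNIV. v $ p * mw w $ p $ q)"
  by (simp add: vector_matrix_mult_def mult.commute)

lemma \<delta>_nonneg [simp]: "0 \<le> \<delta> w"
  unfolding \<delta>_def vector_mw using vsum_pos v_nonneg by (intro divide_nonneg_pos sum_nonneg) auto

lemma \<delta>_Nil [simp]: "\<delta> [] = 1"
  using vsum_pos by (simp add: \<delta>_def flip: vsum_def)

lemma \<delta>_le: "\<delta> w \<le> entry_sum (mw w)"
proof -
  have "(\<Sum>q\<in>UNIV. (v v* mw w) $ q) = (\<Sum>p\<in>UNIV. v $ p * (\<Sum>q\<in>UNIV. mw w $ p $ q))"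
    unfolding vector_mw by (subst sum.swap) (simp add: sum_distrib_left)
  also have "\<dots> \<le> (\<Sum>p\<in>UNIV. v $ p * entry_sum (mw w))"
    unfolding entry_sum_def using v_nonneg
    by (intro sum_mono mult_left_mono member_le_sum[of _ UNIV "\<lambda>p. \<Sum>q\<in>UNIV. mw w $ p $ q"]) (auto intro!: sum_nonneg)
  also have "\<dots> = vsum * entry_sum (mw w)" by (simp add: vsum_def sum_distrib_right)
  finally show ?thesis using vsum_pos by (simp add: \<delta>_def field_simps)
qed

text \<open>The matrix of the last letter is zero or has the line of \<open>v\<close> as its row
  image, so it sends any vector into this line. Summing coordinates identifies the factor.\<close>

lemma renewal_vector:
  assumes "t \<in> P a"
  shows "v v* mw (w @ [(a, t)]) = \<delta> (w @ [(a, t)]) *\<^sub>R v"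
proof -
  have "(v v* mw w) v* A (a, t) \<in> span {v}"
  proof (cases "A (a, t) = 0")
    case True
    then show ?thesis by (simp add: span_zero)
  next
    case False
    then have "row_image (A (a, t)) = span {v}" using assms by (simp add: P_set_def)
    then show ?thesis unfolding row_image_def by blast
  qed
  moreover have "v v* mw (w @ [(a, t)]) = (v v* mw w) v* A (a, t)"
    by (simp add: matrix_word_append vector_matrix_mul_assoc)
  ultimately obtain D where D: "v v* mw (w @ [(a, t)]) = D *\<^sub>R v" by (auto simp: span_singleton)
  then have "\<delta> (w @ [(a, t)]) = D"
    unfolding \<delta>_def using vsum_pos by (simp add: vsum_def flip: sum_distrib_left)
  then show ?thesis using D by simp
qed

text \<open>After a reset the row vector is \<open>\<delta> w\<close> times \<open>v\<close>, and
  the remaining matrices act on it as they would at the start.\<close>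

lemma \<delta>_append:
  assumes "w = [] \<or> snd (last w) \<in> P (fst (last w))"
  shows "\<delta> (w @ w') = \<delta> w * \<delta> w'"
proof (cases w rule: rev_cases)
  case (snoc w0 p)
  then have "v v* mw w = \<delta> w *\<^sub>R v" using renewal_vector[of "snd p" "fst p" w0] assms by simp
  then have "v v* mw (w @ w') = \<delta> w *\<^sub>R (v v* mw w')"
    by (simp add: matrix_word_append scaleR_vector_matrix_assoc flip: vector_matrix_mul_assoc)
  then have "(\<Sum>q\<in>UNIV. (v v* mw (w @ w')) $ q) = \<delta> w * (\<Sum>q\<in>UNIV. (v v* mw w') $ q)"
    by (simp add: sum_distrib_left)
  then show ?thesis by (simp add: \<delta>_def[of "w @ w'"] \<delta>_def[of w'])
qed simp

lemma D_coeff_eq: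
  assumes "t \<in> P a"
  shows "D_coeff A v w (a, t) = \<delta> (w @ [(a, t)])"
proof -
  have v0: "v \<noteq> 0" using recursive by (simp add: recursive_structure_def)
  show ?thesis unfolding D_coeff_def foldl_vector_matrix renewal_vector[OF assms] using v0 by simp
qed

section \<open>Splitting words at their last reset\<close>

definition pair_words :: "nat list \<Rightarrow> (nat \<times> nat) list set" where
  "pair_words s = {w \<in> lists ({..<m1} \<times> {..<m2}). map fst w = s}"

definition renewal_words :: "nat list \<Rightarrow> (nat \<times> nat) list set" where
  "renewal_words s = {w \<in> pair_words s. w = [] \<or> snd (last w) \<in> P (fst (last w))}"

abbreviation R_words' :: "nat list \<Rightarrow> (nat \<times> nat) list set" where
  "R_words' \<equiv> R_words m1 m2 A v"

lemma P_subset: "P a \<subseteq> {..<m2}"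
  by (auto simp: P_set_def)

lemma finite_pair_words [simp]: "finite (pair_words s)"
proof (rule finite_subset)
  show "pair_words s \<subseteq> {w. set w \<subseteq> {..<m1} \<times> {..<m2} \<and> length w = length s}"
    by (auto simp: pair_words_def)
qed (simp add: finite_lists_length_eq)

text \<open>Common shape of the three recursions that append a letter \<open>a\<close> with
  admissible second components.\<close>

lemma sum_snoc_words:
  assumes "\<And>w. w \<in> X' \<longleftrightarrow> (\<exists>w0 t. w = w0 @ [(a, t)] \<and> w0 \<in> X \<and> t \<in> T)"
  shows "(\<Sum>w\<in>X'. g w) = (\<Sum>w\<in>X. \<Sum>t\<in>T. g (w @ [(a, t)]))"
proof -
  have "(\<Sum>w\<in>X'. g w) = (\<Sum>(w, t)\<in>X \<times> T. g (w @ [(a, t)]))"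
    by (rule sum.reindex_bij_witness[of _ "\<lambda>(w, t). w @ [(a, t)]" "\<lambda>w. (butlast w, snd (last w))"])
      (auto simp: assms)
  then show ?thesis by (simp add: sum.cartesian_product)
qed

lemma map_fst_snoc: "map fst w = s @ [a] \<longleftrightarrow> (\<exists>w0 t. w = w0 @ [(a, t)] \<and> map fst w0 = s)"
  by (cases w rule: rev_cases) auto

lemma sum_pair_words_snoc:
  assumes "a < m1"
  shows "(\<Sum>w\<in>pair_words (s @ [a]). g w) = (\<Sum>w\<in>pair_words s. \<Sum>t<m2. g (w @ [(a, t)]))"
  by (rule sum_snoc_words) (use assms in \<open>auto simp: pair_words_def map_fst_snoc\<close>)

lemma sum_renewal_words_snoc:
  assumes "a < m1"
  shows "(\<Sum>w\<in>renewal_words (s @ [a]). g w) = (\<Sum>w\<in>pair_words s. \<Sum>t\<in>P a. g (w @ [(a, t)]))"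
  by (rule sum_snoc_words) (use assms in \<open>auto simp: renewal_words_def pair_words_def map_fst_snoc dest: subsetD[OF P_subset]\<close>)

lemma sum_R_words_snoc:
  assumes "a < m1"
  shows "(\<Sum>w\<in>R_words' (s @ [a]). g w) = (\<Sum>w\<in>R_words' s. \<Sum>t\<in>{..<m2} - P a. g (w @ [(a, t)]))"
  by (rule sum_snoc_words) (use assms in \<open>auto simp: R_words_def map_fst_snoc\<close>)

text \<open>Every word splits uniquely at its last letter from Q: up to the cut it is a renewal
  word, and after it no letter is in Q. The term j = 0 collects the words without any reset.\<close>

lemma sum_last_renewal:
  assumes "set s \<subseteq> {..<m1}"
  shows "(\<Sum>w\<in>pair_words s. g w) = (\<Sum>j\<le>length s. \<Sum>w\<in>renewal_words (take j s). \<Sum>w'\<in>R_words' (drop j s). g (w @ w'))"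
  using assms
proof (induction s arbitrary: g rule: rev_induct)
  case Nil
  have "pair_words [] = {[]}" "renewal_words [] = {[]}" "R_words' [] = {[]}"
    by (auto simp: pair_words_def renewal_words_def R_words_def)
  then show ?case by simp
next
  case (snoc a s)
  have a: "a < m1" and s: "set s \<subseteq> {..<m1}" using snoc.prems by auto
  have Nil: "R_words' [] = {[]}" by (auto simp: R_words_def)
  have split: "(\<Sum>t<m2. g (w @ [(a, t)])) = (\<Sum>t\<in>P a. g (w @ [(a, t)])) + (\<Sum>t\<in>{..<m2} - P a. g (w @ [(a, t)]))" for w
    using sum.subset_diff[OF P_subset finite_lessThan, of "\<lambda>t. g (w @ [(a, t)])" a] by (simp add: add.commute)
  have "(\<Sum>w\<in>pair_words (s @ [a]). g w) = (\<Sum>w\<in>renewal_words (s @ [a]). g w)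
      + (\<Sum>w\<in>pair_words s. \<Sum>t\<in>{..<m2} - P a. g (w @ [(a, t)]))"
    by (simp add: sum_pair_words_snoc[OF a] sum_renewal_words_snoc[OF a] split sum.distrib)
  also have "(\<Sum>w\<in>pair_words s. \<Sum>t\<in>{..<m2} - P a. g (w @ [(a, t)]))
      = (\<Sum>j\<le>length s. \<Sum>w\<in>renewal_words (take j s). \<Sum>w'\<in>R_words' (drop j s @ [a]). g (w @ w'))"
    by (simp add: snoc.IH[OF s] sum_R_words_snoc[OF a])
  also have "\<dots> = (\<Sum>j\<le>length s. \<Sum>w\<in>renewal_words (take j (s @ [a])). \<Sum>w'\<in>R_words' (drop j (s @ [a])). g (w @ w'))"
    by (intro sum.cong) auto
  finally show ?case by (simp add: Nil add.commute)
qed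

definition renewal_weight :: "nat list \<Rightarrow> real" where
  "renewal_weight s = (\<Sum>w\<in>renewal_words s. \<delta> w powr a2)"

lemma C_coeff_eq:
  "C_coeff m1 m2 A v a2 s a = (\<Sum>w\<in>R_words' s. \<Sum>t\<in>P a. \<delta> (w @ [(a, t)]) powr a2)"
proof -
  have "C_coeff m1 m2 A v a2 s a = (\<Sum>t\<in>P a. \<Sum>w\<in>R_words' s. D_coeff A v w (a, t) powr a2)"
    unfolding C_coeff_def Q_set_def by (simp add: sum.cartesian_product')
  also have "\<dots> = (\<Sum>t\<in>P a. \<Sum>w\<in>R_words' s. \<delta> (w @ [(a, t)]) powr a2)"
    by (intro sum.cong refl) (simp add: D_coeff_eq)
  finally show ?thesis by (subst sum.swap) simp
qed

text \<open>The index j marks the last reset before \<open>a\<close>. By multiplicativity the weight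
  factors into the part up to that reset and the coefficient of the stretch since then. The empty
  coordinate of \<open>M_op\<close> computes precisely this sum.\<close>

lemma renewal_weight_snoc:
  assumes "set s \<subseteq> {..<m1}" "a < m1"
  shows "renewal_weight (s @ [a]) = (\<Sum>j\<le>length s. C_coeff m1 m2 A v a2 (drop j s) a * renewal_weight (take j s))"
proof -
  have "renewal_weight (s @ [a]) = (\<Sum>w\<in>pair_words s. \<Sum>t\<in>P a. \<delta> (w @ [(a, t)]) powr a2)"
    unfolding renewal_weight_def by (rule sum_renewal_words_snoc[OF assms(2)])
  also have "\<dots> = (\<Sum>j\<le>length s. \<Sum>w\<in>renewal_words (take j s). \<Sum>w'\<in>R_words' (drop j s). \<Sum>t\<in>P a. \<delta> (w @ w' @ [(a, t)]) powr a2)"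
    by (subst sum_last_renewal[OF assms(1)]) simp
  also have "\<dots> = (\<Sum>j\<le>length s. C_coeff m1 m2 A v a2 (drop j s) a * renewal_weight (take j s))"
  proof (intro sum.cong refl)
    fix j
    have "(\<Sum>w\<in>renewal_words (take j s). \<Sum>w'\<in>R_words' (drop j s). \<Sum>t\<in>P a. \<delta> (w @ w' @ [(a, t)]) powr a2)
      = (\<Sum>w\<in>renewal_words (take j s). \<Sum>w'\<in>R_words' (drop j s). \<Sum>t\<in>P a. \<delta> w powr a2 * \<delta> (w' @ [(a, t)]) powr a2)"
      by (intro sum.cong refl) (simp add: \<delta>_append renewal_words_def powr_mult)
    also have "\<dots> = renewal_weight (take j s) * C_coeff m1 m2 A v a2 (drop j s) a"
      unfolding renewal_weight_def C_coeff_eq sum_distrib_left[symmetric] sum_distrib_right[symmetric] ..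
    finally show "(\<Sum>w\<in>renewal_words (take j s). \<Sum>w'\<in>R_words' (drop j s). \<Sum>t\<in>P a. \<delta> (w @ w' @ [(a, t)]) powr a2)
      = C_coeff m1 m2 A v a2 (drop j s) a * renewal_weight (take j s)" by simp
  qed
  finally show ?thesis .
qed

text \<open>A removable letter has no second component outside P. Hence suffixes outside \<Gamma>
  have coefficient 0 and may be included in sums over all suffixes.\<close>

lemma R_words_empty:
  assumes "set s \<subseteq> {..<m1}" "s \<notin> J_words m1 m2 A v"
  shows "R_words' s = {}"
proof -
  obtain a where a: "a \<in> set s" "a < m1" "a \<notin> J" using assms by (auto simp: in_lists_conv_set)
  then have Pa: "P a = {..<m2}" by (auto simp: J_set_def removable_def)
  have False if w: "w \<in> R_words' s" for w
  proof -
    have "a \<in> fst ` set w" using w a(1) by (auto simp: R_words_def)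
    then obtain t where t: "(a, t) \<in> set w" by auto
    then have "t < m2" "t \<notin> P a" using w by (auto simp: R_words_def)
    then show False using Pa by simp
  qed
  then show ?thesis by blast
qed

text \<open>After reading \<open>s\<close>, the coordinate at \<open>l\<close> stores the weight
  accumulated up to a reset just before the suffix \<open>l\<close>; the letters of \<open>l\<close>
  are charged only at the next reset, through \<open>C_coeff\<close>. So each letter lengthens the
  stored suffixes by one and refills the empty coordinate with the sum over all of them.\<close>

lemma fold_M_op_Phi0:
  assumes "set s \<subseteq> {..<m1}"
  shows "fold (M_op m1 m2 A v a2) s Phi0 = (\<lambda>l. if l \<in> J_words m1 m2 A v \<and> (\<exists>s0. s = s0 @ l)
    then renewal_weight (take (length s - length l) s) else 0)"
  using assms
proof (induction s rule: rev_induct)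
  case Nil
  have "renewal_words [] = {[]}" by (auto simp: renewal_words_def pair_words_def)
  then show ?case by (auto simp: Phi0_def fun_eq_iff renewal_weight_def)
next
  case (snoc a s)
  have a: "a < m1" and s: "set s \<subseteq> {..<m1}" using snoc.prems by auto
  define x where "x = fold (M_op m1 m2 A v a2) s Phi0"
  have x: "x l = (if l \<in> J_words m1 m2 A v \<and> (\<exists>s0. s = s0 @ l) then renewal_weight (take (length s - length l) s) else 0)" for l
    unfolding x_def snoc.IH[OF s] by simp
  show ?case
  proof
    fix l
    have "fold (M_op m1 m2 A v a2) (s @ [a]) Phi0 l = M_op m1 m2 A v a2 a x l" by (simp add: x_def)
    also have "\<dots> = (if l \<in> J_words m1 m2 A v \<and> (\<exists>s0. s @ [a] = s0 @ l)
      then renewal_weight (take (length (s @ [a]) - length l) (s @ [a])) else 0)"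
    proof (cases l rule: rev_cases)
      case Nil
      let ?C = "\<lambda>l. C_coeff m1 m2 A v a2 l a"
      have inj: "inj_on (\<lambda>j. drop j s) {..length s}"
        by (rule inj_onI) (metis atMost_iff diff_diff_cancel length_drop)
      have "M_op m1 m2 A v a2 a x [] = (\<Sum>l | l \<in> J_words m1 m2 A v \<and> x l \<noteq> 0. ?C l * x l)"
        by (simp add: M_op_def)
      also have "\<dots> = (\<Sum>l\<in>(\<lambda>j. drop j s) ` {..length s}. ?C l * x l)"
      proof (rule sum.mono_neutral_left)
        show "{l. l \<in> J_words m1 m2 A v \<and> x l \<noteq> 0} \<subseteq> (\<lambda>j. drop j s) ` {..length s}"
        proof
          fix l assume "l \<in> {l. l \<in> J_words m1 m2 A v \<and> x l \<noteq> 0}"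
          then obtain s0 where "s = s0 @ l" by (auto simp: x split: if_splits)
          then show "l \<in> (\<lambda>j. drop j s) ` {..length s}" by (intro image_eqI[of _ _ "length s0"]) auto
        qed
        show "\<forall>l\<in>(\<lambda>j. drop j s) ` {..length s} - {l. l \<in> J_words m1 m2 A v \<and> x l \<noteq> 0}. ?C l * x l = 0"
          by (auto simp: x)
      qed simp
      also have "\<dots> = (\<Sum>j\<le>length s. ?C (drop j s) * x (drop j s))"
        by (subst sum.reindex[OF inj]) simp
      also have "\<dots> = (\<Sum>j\<le>length s. ?C (drop j s) * renewal_weight (take j s))"
      proof (intro sum.cong refl)
        fix j assume j: "j \<in> {..length s}"
        show "?C (drop j s) * x (drop j s) = ?C (drop j s) * renewal_weight (take j s)"
        proof (cases "drop j s \<in> J_words m1 m2 A v")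
          case True
          have "\<exists>s0. s = s0 @ drop j s" by (rule exI[of _ "take j s"]) simp
          then show ?thesis using True j by (simp add: x)
        next
          case False
          \<comment> \<open>In this case \<open>x (drop j s)\<close> is 0 while
            \<open>renewal_weight (take j s)\<close> need not be; the two sides agree because the
            coefficient vanishes.\<close>
          then have "R_words' (drop j s) = {}" using s set_drop_subset[of j s] by (intro R_words_empty) auto
          then show ?thesis by (simp add: C_coeff_eq)
        qed
      qed
      also have "\<dots> = renewal_weight (s @ [a])" by (rule renewal_weight_snoc[OF s a, symmetric])
      finally show ?thesis using Nil by simp
    next
      case (snoc l' b)
      then show ?thesis by (auto simp: M_op_def x)
    qed
    finally show "fold (M_op m1 m2 A v a2) (s @ [a]) Phi0 l = (if l \<in> J_words m1 m2 A v \<and> (\<exists>s0. s @ [a] = s0 @ l)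
      then renewal_weight (take (length (s @ [a]) - length l) (s @ [a])) else 0)" .
  qed
qed

section \<open>Renewal along the occurrences of \<open>u\<close>\<close>

lemma u_props: "u < m1" "P u = {..<m2}" "u \<notin> J"
  using removable by (auto simp: removable_def J_set_def)

lemma sum_pair_words_eq_column:
  assumes "set s \<subseteq> {..<m1}"
  shows "(\<Sum>w\<in>pair_words s. \<phi> w powr a2) = column \<phi> s"
  unfolding column_def
  by (rule sum.reindex_bij_witness[of _ "\<lambda>t. zip s t" "map snd"])
    (use assms in \<open>auto simp: pair_words_def digit_words_def zip_map_fst_snd elim!: in_set_zipE\<close>)

text \<open>The last letter \<open>u\<close> is removable: it resets every word and lies outside
  \<open>J\<close>. So only the empty suffix survives, and its coordinate is the full column
  sum.\<close>

lemma c_coeff_eq: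
  assumes "set s \<subseteq> {..<m1}"
  shows "c_coeff m1 m2 A v a2 u s = column \<delta> (s @ [u])"
proof -
  have su: "set (s @ [u]) \<subseteq> {..<m1}" using assms u_props by simp
  have "renewal_words (s @ [u]) = pair_words (s @ [u])"
    using u_props by (auto simp: renewal_words_def pair_words_def map_fst_snoc)
  then have rw: "renewal_weight (s @ [u]) = column \<delta> (s @ [u])"
    unfolding renewal_weight_def using sum_pair_words_eq_column[OF su] by simp
  have nil: "l = []" if "l \<in> J_words m1 m2 A v" "s @ [u] = s0 @ l" for l s0
    using that u_props by (cases l rule: rev_cases) auto
  have "M_word m1 m2 A v a2 u s Phi0 = fold (M_op m1 m2 A v a2) (s @ [u]) Phi0" by (simp add: M_word_def)
  also have "\<dots> = (\<lambda>l. column \<delta> (s @ [u]) * Phi0 l)"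
    unfolding fold_M_op_Phi0[OF su] using nil by (auto simp: fun_eq_iff Phi0_def rw)
  finally have M: "M_word m1 m2 A v a2 u s Phi0 = (\<lambda>l. column \<delta> (s @ [u]) * Phi0 l)" .
  show ?thesis unfolding c_coeff_def M by (rule the_equality) (auto simp: Phi0_def dest: fun_cong[of _ _ "[]"])
qed

abbreviation b :: "nat \<Rightarrow> real" where "b \<equiv> b_coeff m1 m2 A v a1 a2 u"

lemma b_eq: "b k = (\<Sum>s\<in>avoiding_words m1 u k. column \<delta> (s @ [u]) powr a1)"
  unfolding b_coeff_def avoiding_words_def
  by (intro sum.cong refl arg_cong[where f = "\<lambda>x. x powr a1"] c_coeff_eq) auto

text \<open>The final \<open>u\<close> is one of the N letters, which leaves N - 1 free ones. The
  value 1 at 0 stands for the empty word and makes the term k = N of the renewal equation equal to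
  \<open>b N\<close>.\<close>

definition Z :: "nat \<Rightarrow> real" where
  "Z N = (if N = 0 then 1 else \<Sum>s\<in>digit_words m1 (N - 1). column \<delta> (s @ [u]) powr a1)"

text \<open>\<open>P u\<close> contains all second components, so every word over
  \<open>s @ [u]\<close> ends with a reset, at which \<open>\<delta>\<close> is
  multiplicative.\<close>

lemma column_renewal:
  "column \<delta> ((s @ [u]) @ s') = column \<delta> (s @ [u]) * column \<delta> s'"
proof -
  have "\<delta> (zip (s @ [u]) t @ w) = \<delta> (zip (s @ [u]) t) * \<delta> w" if tw: "t \<in> digit_words m2 (length (s @ [u]))" for t w
  proof (rule \<delta>_append)
    obtain t0 y where t: "t = t0 @ [y]" "length t0 = length s" "y < m2"
      using tw by (cases t rule: rev_cases) (auto simp: digit_words_def intro: that)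
    then show "zip (s @ [u]) t = [] \<or> snd (last (zip (s @ [u]) t)) \<in> P (fst (last (zip (s @ [u]) t)))"
      using u_props by simp
  qed
  then have "column \<delta> ((s @ [u]) @ s') = (\<Sum>t\<in>digit_words m2 (length (s @ [u])). \<Sum>t'\<in>digit_words m2 (length s').
      (\<delta> (zip (s @ [u]) t) * \<delta> (zip s' t')) powr a2)"
    unfolding column_append by (intro sum.cong refl) (simp only:)
  also have "\<dots> = column \<delta> (s @ [u]) * column \<delta> s'"
    unfolding column_def sum_product powr_mult ..
  finally show ?thesis .
qed

lemma exists_nonzero_row: "\<exists>t j r. t < m2 \<and> 1 \<le> A (u, t) $ j $ r"
proof -
  obtain t where t: "t < m2" "row_image (A (u, t)) = span {v}" and v: "v \<noteq> 0"
    using recursive u_props(1) by (auto simp: recursive_structure_def)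
  have "A (u, t) \<noteq> 0"
  proof
    assume "A (u, t) = 0"
    then have "span {v} = {0}" using t(2) by (auto simp: row_image_def)
    moreover have "v \<in> span {v}" by (simp add: span_base)
    ultimately show False using v by simp
  qed
  then obtain j r where "A (u, t) $ j $ r \<noteq> 0" by (auto simp: vec_eq_iff)
  then have "1 \<le> A (u, t) $ j $ r" by (rule one_le_if_natural[OF adjacency_eq_card])
  with t(1) show ?thesis by blast
qed

text \<open>Words are extended by \<open>d\<close> letters on both sides and then by
  \<open>u\<close>, so c = 2 * d + 1. The vertices are chosen such that \<open>v $ i\<close> is
  positive and row \<open>j\<close> of some \<open>A (u, t)\<close> is nonzero; then the (i, j)
  entry is controlled by the mass of the row vector after \<open>u\<close>.\<close>

lemma W_le_Z: "\<exists>C c. \<forall>N. W N \<le> C * Z (N + c)"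
proof -
  obtain d where d: "\<forall>p q. 1 \<le> power_sum d $ p $ q" using primitive_power by blast
  obtain t j r where t: "t < m2" "1 \<le> A (u, t) $ j $ r" using exists_nonzero_row by blast
  obtain i where "v $ i \<noteq> 0" using recursive by (auto simp: recursive_structure_def vec_eq_iff)
  then have i: "0 < v $ i" using v_nonneg[of i] by simp
  define \<psi> where "\<psi> w = \<delta> (w @ [(u, t)])" for w
  \<comment> \<open>Compensates the weight \<open>v $ i\<close> of the starting vertex and the
    normalisation of \<open>\<delta>\<close> by \<open>vsum\<close>.\<close>
  define C where "C = vsum / v $ i"
  have C: "0 \<le> C" using vsum_pos i by (simp add: C_def)
  have mw_snoc: "mw (w @ [q]) = mw w ** A q" for w q by (simp add: matrix_word_append)
  have entry: "mw w $ i $ j \<le> C * \<psi> w" for w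
  proof -
    have "v $ i * mw w $ i $ j * 1 \<le> v $ i * mw w $ i $ j * A (u, t) $ j $ r"
      using t(2) i by (intro mult_left_mono) auto
    also have "\<dots> = v $ i * (mw w $ i $ j * A (u, t) $ j $ r)" by simp
    also have "\<dots> \<le> v $ i * (mw (w @ [(u, t)]) $ i $ r)"
    proof (rule mult_left_mono)
      have "mw w $ i $ j * A (u, t) $ j $ r \<le> (\<Sum>l\<in>UNIV. mw w $ i $ l * A (u, t) $ l $ r)"
        using nonneg_adjacency[of "(u, t)"]
        by (intro member_le_sum[of j UNIV "\<lambda>l. mw w $ i $ l * A (u, t) $ l $ r"]) (auto simp: nonneg_matrix_def)
      then show "mw w $ i $ j * A (u, t) $ j $ r \<le> mw (w @ [(u, t)]) $ i $ r"
        by (simp only: mw_snoc) (simp add: matrix_matrix_mult_def)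
    qed (use i in simp)
    also have "\<dots> \<le> (v v* mw (w @ [(u, t)])) $ r"
      unfolding vector_mw using v_nonneg
      by (intro member_le_sum[of i UNIV "\<lambda>l. v $ l * mw (w @ [(u, t)]) $ l $ r"]) auto
    also have "\<dots> \<le> (\<Sum>q\<in>UNIV. (v v* mw (w @ [(u, t)])) $ q)"
      unfolding vector_mw using v_nonneg
      by (intro member_le_sum[of r UNIV "\<lambda>q. \<Sum>l\<in>UNIV. v $ l * mw (w @ [(u, t)]) $ l $ q"]) (auto intro!: sum_nonneg)
    also have "\<dots> = vsum * \<psi> w" using vsum_pos by (simp add: \<psi>_def \<delta>_def)
    finally show ?thesis using i by (simp add: C_def field_simps)
  qed
  have ext: "W N \<le> (C powr a2) powr a1 * total \<psi> (d + (N + d))" for N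
    unfolding W_def
  proof (rule total_le_extension)
    fix w
    have "entry_sum (mw w) \<le> (\<Sum>s'\<in>digit_words m1 d. \<Sum>s''\<in>digit_words m1 d.
        \<Sum>t'\<in>digit_words m2 d. \<Sum>t''\<in>digit_words m2 d. mw (zip s' t' @ w @ zip s'' t'') $ i $ j)"
      by (rule entry_sum_le_sandwich[OF d])
    also have "\<dots> \<le> (\<Sum>s'\<in>digit_words m1 d. \<Sum>s''\<in>digit_words m1 d.
        \<Sum>t'\<in>digit_words m2 d. \<Sum>t''\<in>digit_words m2 d. C * \<psi> (zip s' t' @ w @ zip s'' t''))"
      by (intro sum_mono entry)
    finally show "entry_sum (mw w) \<le> C * (\<Sum>s'\<in>digit_words m1 d. \<Sum>s''\<in>digit_words m1 d.
        \<Sum>t'\<in>digit_words m2 d. \<Sum>t''\<in>digit_words m2 d. \<psi> (zip s' t' @ w @ zip s'' t''))"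
      by (simp add: sum_distrib_left)
  qed (use C in \<open>auto simp: entry_sum_nonneg nonneg_mw \<psi>_def\<close>)
  have "total \<psi> n \<le> Z (Suc n)" for n
  proof -
    have "column \<psi> s \<le> column \<delta> (s @ [u])" for s
    proof -
      have "\<psi> (zip s t') powr a2 \<le> (\<Sum>y<m2. \<delta> (zip s t' @ [(u, y)]) powr a2)" for t'
        unfolding \<psi>_def using t(1) by (intro member_le_sum[of t]) auto
      then show ?thesis unfolding column_def[of \<psi>] column_append
        by (intro sum_mono) (simp add: sum_digit_words_Suc)
    qed
    then show ?thesis unfolding total_def Z_def using a1_bounds
      by (auto intro!: sum_mono powr_mono2)
  qed
  then have "W N \<le> (C powr a2) powr a1 * Z (N + Suc (d + d))" for N
    using order_trans[OF ext mult_left_mono, of N "Z (N + Suc (d + d))"] by (simp add: ac_simps)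
  then show ?thesis by blast
qed

lemma b_sums: "(\<lambda>k. b k / growth W ^ k) sums growth W"
proof -
  obtain C c where C: "\<And>N. W N \<le> C * Z (N + c)" using W_le_Z by blast
  interpret renewal W b Z C c
  proof
    show "0 \<le> b k" for k unfolding b_coeff_def by (intro sum_nonneg) auto
    show "Z 0 = 1" by (simp add: Z_def)
    show "Z (Suc N) = (\<Sum>k\<le>N. b k * Z (N - k))" for N
    proof -
      have "Z (Suc N) = (\<Sum>s\<in>digit_words m1 N. column \<delta> (s @ [u]) powr a1)" by (simp add: Z_def)
      \<comment> \<open>The N letters before the final \<open>u\<close> are sorted by their first
        \<open>u\<close>. If there is none, the final \<open>u\<close> is the first one, which is
        the term k = N.\<close>
      also have "\<dots> = (\<Sum>s\<in>avoiding_words m1 u N. column \<delta> (s @ [u]) powr a1)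
        + (\<Sum>k<N. \<Sum>s\<in>avoiding_words m1 u k. \<Sum>s'\<in>digit_words m1 (N - Suc k). column \<delta> ((s @ u # s') @ [u]) powr a1)"
        by (rule sum_first_occurrence[OF u_props(1)])
      also have "\<dots> = b N + (\<Sum>k<N. b k * Z (N - k))"
      proof -
        have "column \<delta> ((s @ u # s') @ [u]) powr a1 = column \<delta> (s @ [u]) powr a1 * column \<delta> (s' @ [u]) powr a1" for s s'
          using column_renewal[of s "s' @ [u]"] by (simp add: powr_mult)
        then have "(\<Sum>s\<in>avoiding_words m1 u k. \<Sum>s'\<in>digit_words m1 (N - Suc k). column \<delta> ((s @ u # s') @ [u]) powr a1)
            = b k * Z (N - k)" if "k < N" for k
          using that by (simp add: b_eq Z_def sum_product)
        then show ?thesis by (simp add: b_eq)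
      qed
      also have "\<dots> = (\<Sum>k\<le>N. b k * Z (N - k))"
        by (simp add: lessThan_Suc_atMost[symmetric] Z_def add.commute)
      finally show ?thesis .
    qed
    show "Z N \<le> W N" for N
    proof (cases N)
      case 0
      then show ?thesis using W_ge_1[of 0] by (simp add: Z_def)
    next
      case (Suc n)
      have "Z (Suc n) \<le> total \<delta> (Suc n)"
      proof -
        have "(\<Sum>s\<in>digit_words m1 n. column \<delta> (s @ [u]) powr a1) \<le> (\<Sum>s\<in>digit_words m1 n. \<Sum>x<m1. column \<delta> (s @ [x]) powr a1)"
          using u_props by (intro sum_mono member_le_sum[of u]) auto
        then show ?thesis unfolding Z_def total_def sum_digit_words_snoc by simp
      qed
      also have "\<dots> \<le> W (Suc n)" unfolding W_def by (rule total_mono) (simp add: \<delta>_le)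
      finally show ?thesis using Suc by simp
    qed
  qed (rule C)
  show ?thesis by (rule renewal_sums)
qed

end


section \<open>The dimension formula\<close>

context
  fixes A :: "nat \<times> nat \<Rightarrow> real^'n^'n" and v :: "real^'n" and c :: real
  assumes c: "c \<noteq> 0"
begin

lemma span_rescale: "span {c *\<^sub>R v} = span {v}"
  using span_image_scale[of "{v}" "\<lambda>_. c"] c by simp

lemma P_set_rescale: "P_set m2 A (c *\<^sub>R v) = P_set m2 A v"
  by (simp add: fun_eq_iff P_set_def span_rescale)

lemma removable_rescale: "removable m1 m2 A (c *\<^sub>R v) = removable m1 m2 A v"
  by (simp add: fun_eq_iff removable_def P_set_rescale)

text \<open>\<open>v\<close> stands on both sides of the defining equation, so a nonzero factor
  cancels. Everything built from these coefficients inherits the invariance.\<close>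

lemma D_coeff_rescale: "D_coeff A (c *\<^sub>R v) = D_coeff A v"
proof -
  have "c *\<^sub>R v v* B = d *\<^sub>R c *\<^sub>R v \<longleftrightarrow> v v* B = d *\<^sub>R v" for B d
  proof -
    have "c *\<^sub>R v v* B = c *\<^sub>R (v v* B)"
      by (simp add: vec_eq_iff vector_matrix_mult_def sum_distrib_left mult_ac)
    moreover have "d *\<^sub>R c *\<^sub>R v = c *\<^sub>R d *\<^sub>R v" by (rule scaleR_left_commute)
    ultimately show ?thesis using c by (simp only: scaleR_cancel_left) simp
  qed
  then show ?thesis by (simp add: fun_eq_iff D_coeff_def foldl_vector_matrix)
qed

lemma C_coeff_rescale: "C_coeff m1 m2 A (c *\<^sub>R v) a2 = C_coeff m1 m2 A v a2"
  by (simp add: fun_eq_iff C_coeff_def Q_set_def R_words_def P_set_rescale D_coeff_rescale)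

lemma b_coeff_rescale: "b_coeff m1 m2 A (c *\<^sub>R v) a1 a2 u = b_coeff m1 m2 A v a1 a2 u"
proof -
  have "M_op m1 m2 A (c *\<^sub>R v) a2 = M_op m1 m2 A v a2"
    by (intro ext) (simp add: M_op_def J_set_def removable_rescale C_coeff_rescale)
  then show ?thesis by (intro ext) (simp only: b_coeff_def c_coeff_def M_word_def)
qed

end

text \<open>\<open>v\<close> may have the wrong sign. A nonzero row of \<open>B\<close> is
  nonnegative and lies on the line of \<open>v\<close>, so it is the required multiple.\<close>

lemma nonneg_rescaling_exists:
  fixes B :: "real^'n^'n"
  assumes B: "nonneg_matrix B" and im: "row_image B = span {v}" and v: "v \<noteq> 0"
  shows "\<exists>c. c \<noteq> 0 \<and> (\<forall>q. 0 \<le> (c *\<^sub>R v) $ q)"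
proof -
  have "v \<in> row_image B" unfolding im by (simp add: span_base)
  then have "B \<noteq> 0" using v by (auto simp: row_image_def)
  then obtain p r where pr: "B $ p $ r \<noteq> 0" by (auto simp: vec_eq_iff)
  have row: "(axis p 1 v* B) $ q = B $ p $ q" for q
    by (simp add: vector_matrix_mult_def axis_def if_distrib[of "\<lambda>x. x * _"] if_distrib[of "\<lambda>x. _ * x"] cong: if_cong)
  have "axis p 1 v* B \<in> span {v}" unfolding im[symmetric] row_image_def by blast
  then obtain c where c: "axis p 1 v* B = c *\<^sub>R v" by (auto simp: span_singleton)
  have cq: "(c *\<^sub>R v) $ q = B $ p $ q" for q using row[of q] unfolding c .
  have "c \<noteq> 0" using cq[of r] pr by auto
  moreover have "\<forall>q. 0 \<le> (c *\<^sub>R v) $ q" using B unfolding cq nonneg_matrix_def by simp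
  ultimately show ?thesis by blast
qed

theorem proposition3p8:
  fixes G :: "('n::finite, 'e) pre_digraph"
    and lab :: "'e \<Rightarrow> nat \<times> nat \<times> nat"
    and m1 m2 m3 u :: nat
    and ts :: "nat list"
    and A :: "nat \<times> nat \<Rightarrow> real^'n^'n"
    and v :: "real^'n"
    and a1 a2 :: real
  assumes "labeled_graph G m1 m2 m3 lab"
    and "A = adjacency m3 G lab"
    and "a1 = log (real m2) (real m1)"
    and "a2 = log (real m3) (real m2)"
    and "recursive_structure m1 m2 A v"
    and "primitive_matrix (\<Sum>w\<in>{..<m1} \<times> {..<m2}. A w)"
    and "\<exists>i<m1. \<not> removable m1 m2 A v i"
    and "removable m1 m2 A v u"
    and "ts \<in> lists {..<m1}"
    and "l1_increasing (J_words m1 m2 A v) (M_word m1 m2 A v a2 u ts)"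
  shows "\<exists>r. 0 < r \<and>
             (\<lambda>k. b_coeff m1 m2 A v a1 a2 u k / r ^ k) sums r \<and>
             (\<forall>r'. 0 < r' \<and> (\<lambda>k. b_coeff m1 m2 A v a1 a2 u k / r' ^ k) sums r' \<longrightarrow> r' = r) \<and>
             hausdorff_dim (sofic_set m1 m2 m3 G lab) = ereal (log (real m1) r)"
proof -
  interpret primitive_sofic G m1 m2 m3 lab a1 a2
    using assms(1-4,6) by (simp add: primitive_sofic_def primitive_sofic_axioms_def)
  have v0: "v \<noteq> 0" using assms(5) by (simp add: recursive_structure_def)
  have "u < m1" using assms(8) by (simp add: removable_def)
  then obtain t where "row_image (A (u, t)) = span {v}"
    using assms(5) by (auto simp: recursive_structure_def)
  then obtain c where c: "c \<noteq> 0" "\<And>q. 0 \<le> (c *\<^sub>R v) $ q"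
    using nonneg_rescaling_exists[OF nonneg_adjacency _ v0] unfolding assms(2) by blast
  interpret recursive_sofic G m1 m2 m3 lab a1 a2 "c *\<^sub>R v" u
  proof
    show "recursive_structure m1 m2 (adjacency m3 G lab) (c *\<^sub>R v)"
      using assms(5) c(1) v0 unfolding assms(2) by (simp add: recursive_structure_def span_rescale[OF c(1)])
    show "removable m1 m2 (adjacency m3 G lab) (c *\<^sub>R v) u"
      using assms(8) unfolding assms(2) by (simp add: removable_rescale[OF c(1)])
  qed (rule c(2))
  have b_eq: "b_coeff m1 m2 A v a1 a2 u = b_coeff m1 m2 (adjacency m3 G lab) (c *\<^sub>R v) a1 a2 u"
    unfolding assms(2) b_coeff_rescale[OF c(1)] ..
  have b_nonneg: "0 \<le> b_coeff m1 m2 A v a1 a2 u k" for k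
    unfolding b_coeff_def by (intro sum_nonneg) auto
  have g: "0 < growth W" using growth_ge_1 by linarith
  show ?thesis
  proof (intro exI[of _ "growth W"] conjI allI impI)
    show sums: "(\<lambda>k. b_coeff m1 m2 A v a1 a2 u k / growth W ^ k) sums growth W"
      unfolding b_eq by (rule b_sums)
    show "r' = growth W" if "0 < r' \<and> (\<lambda>k. b_coeff m1 m2 A v a1 a2 u k / r' ^ k) sums r'" for r'
      using positive_solution_unique[OF b_nonneg g sums] that by blast
    show "hausdorff_dim (sofic_set m1 m2 m3 G lab) = ereal (log (real m1) (growth W))"
      by (rule hausdorff_dim_sofic)
  qed (rule g)
qed

end
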